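(* Let $K$ be a complete discrete valuation field of characteristic $p>0$, let $K'$ be a complete discrete valuation field contained in $K^{\mathrm{alg}}$ and purely inseparable over $K$, and let $\gamma:G_{K'}\xrightarrow{\sim}G_K$ be the isomorphism induced by the inclusion $K\subseteq K'$. Assume that $K'/K$ has strict ramification index $s$. Then, for any rational number $a\ge0$, $$\gamma\big(G^{sa}_{K'}\big)\subseteq G^a_K\quad\text{and}\quad\gamma\big(G^{sa}_{K',\log}\big)\subseteq G^a_{K,\log}.$$
   Context: Notation. For a complete discrete valuation field $K$ with residue field of characteristic $p>0$: $\mathcal O_K$ is its valuation ring, $\pi_K$ a uniformizer, $K^{\mathrm{alg}}$ an algebraic closure, $K^{\mathrm{sep}}$ the separable closure of $K$ in $K^{\mathrm{alg}}$, $G_K=\mathrm{Gal}(K^{\mathrm{sep}}/K)$, and $\mathbf v_K$ is the valuation of $K^{\mathrm{alg}}$ normalized by $\mathbf v_K(\pi_K)=1$. For $K'/K$ purely inseparable in $K^{\mathrm{alg}}$ (possibly of infinite degree), $K'^{\mathrm{sep}}=K'K^{\mathrm{sep}}$ and restriction to $K^{\mathrm{sep}}$ is an isomorphism $\gamma:G_{K'}\to G_K$. Strict ramification index. For $t\ge0$ put $K^{p^{-t}}=\{x\in K^{\mathrm{alg}}:x^{p^t}\in K\}$. Let $t\ge0$ be the integer with $K^{p^{-t}}\subseteq K'$ and $K^{p^{-t-1}}\not\subseteq K'$. The strict ramification index of $K'/K$ is the ramification index of $K'/K^{p^{-t}}$. Ramification filtration (Abbes-Saito). Let $D^n_K$ be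 the $n$-dimensional closed unit polydisc over $K$. Let $L/K$ be a finite separable extension, $Z=\{z_1,\dots,z_n\}$ a finite set generating $\mathcal O_L$ as an $\mathcal O_K$-algebra, and $I_Z$ the kernel of $\mathcal O_K[x_1,\dots,x_n]\to\mathcal O_L$, $x_i\mapsto z_i$. For rational $a>0$ let $$X_Z^a=\{\underline x\in D^n_K:\ \mathbf v_K(g(\underline x))\ge a\ \text{for all } g\in I_Z\},$$ an affinoid subdomain of $D_K^n$. The set $\pi_0^{\mathrm{geom}}(X_Z^a)$ of geometric connected components does not depend on $Z$ (canonically), and $\phi\mapsto(\phi(z_1),\dots,\phi(z_n))$ induces a $G_K$-equivariant surjection $\mathrm{Hom}_K(L,K^{\mathrm{alg}})\to\pi_0^{\mathrm{geom}}(X_Z^a)$. By Abbes-Saito there is a unique closed normal subgroup $G_K^a\subseteq G_K$ such that for all finite separable $L/K$ in $K^{\mathrm{sep}}$ this map identifies $\pi_0^{\mathrm{geom}}(X_Z^a)$ with $\mathrm{Hom}_K(L,K^{\mathrm{alg}})/G_K^a$. Put $G_K^0=G_K$. Logarithmic ramification filtration. Let $L/K$ be finite separable of ramification index $e_L$, $Z=\{z_1,\dots,z_n\}$ a finite set generating $\mathcal O_L$ as an $\mathcal O_K$-algebra and containing a uniformizer of $\mathcal O_L$, and $P\subseteq\{1,\dots,n\}$ such that $\{z_i\}_{i\in P}$ contains a uniformizer of $\mathcal O_L$ and does not contain $0$. For $i\in P$ put $e_i=\mathbf v_L(z_i)$ and choose a lifting $h_i\in\mathcal O_K[x_1,\dots,x_n]$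 of the unit $z_i^{e_L}/\pi_K^{e_i}\in\mathcal O_L$; for $(i,j)\in P^2$ choose a lifting $g_{i,j}\in\mathcal O_K[x_1,\dots,x_n]$ of the unit $z_i^{e_j}/z_j^{e_i}$. For rational $a>0$ let $Y^a_{Z,P}\subseteq X^a_Z$ be the affinoid subdomain of $\underline x\in X_Z^a$ with $\mathbf v_K(x_i^{e_L}-\pi_K^{e_i}h_i(\underline x))\ge a+e_i$ for $i\in P$ and $\mathbf v_K(x_i^{e_j}-x_j^{e_i}g_{i,j}(\underline x))\ge a+e_ie_j/e_L$ for $(i,j)\in P^2$. Again $\pi_0^{\mathrm{geom}}(Y^a_{Z,P})$ is independent of choices, there is a $G_K$-equivariant surjection $\mathrm{Hom}_K(L,K^{\mathrm{alg}})\to\pi_0^{\mathrm{geom}}(Y^a_{Z,P})$ induced by $\phi\mapsto(\phi(z_1),\dots,\phi(z_n))$, and there is a unique closed normal subgroup $G^a_{K,\log}\subseteq G_K$ such that for all finite separable $L/K$ in $K^{\mathrm{sep}}$ it identifies the target with $\mathrm{Hom}_K(L,K^{\mathrm{alg}})/G^a_{K,\log}$. Let $G^0_{K,\log}$ be the inertia subgroup of $G_K$. *)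

theory Defs
  imports
    "HOL-Analysis.Analysis"
    "HOL-Library.Poly_Mapping"
    "HOL-Algebra.Algebraic_Closure_Type"
    "HOL-Algebra.Bij"
    "HOL-Algebra.Coset"
begin

text \<open>
  Throughout, the type \<open>'a\<close> plays the role of \<open>K\<^sup>a\<^sup>l\<^sup>g\<close>, and \<open>K\<close>, \<open>L\<close>, \<open>F\<close> are
  subfields of it. One additive valuation \<open>w\<close> on \<open>'a\<close>, not normalized, serves all these
  fields at once; \<open>nval w K\<close> is its rescaling that takes the value 1 at the uniformizers of
  \<open>K\<close>, i.e. the valuation \<open>v\<^sub>K\<close> of \<open>K\<^sup>a\<^sup>l\<^sup>g\<close>.
\<close>

section \<open>Fields and Galois groups\<close>

definition is_subfield :: "'a::field set \<Rightarrow> bool" where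
  "is_subfield K \<longleftrightarrow> subfield K (ring_of_type_algebra :: 'a ring)"

definition fin_ext :: "'a::field set \<Rightarrow> 'a set \<Rightarrow> bool" where
  "fin_ext K L \<longleftrightarrow> is_subfield L \<and> K \<subseteq> L \<and>
     ring.finite_dimension (ring_of_type_algebra :: 'a ring) K L"

definition polys_over :: "'a::field set \<Rightarrow> 'a poly set" where
  "polys_over K = {p. \<forall>i. Polynomial.coeff p i \<in> K}"

definition algebraic_over :: "'a::field set \<Rightarrow> 'a \<Rightarrow> bool" where
  "algebraic_over K x \<longleftrightarrow> (\<exists>p\<in>polys_over K. p \<noteq> 0 \<and> poly p x = 0)"

definition is_min_poly :: "'a::field set \<Rightarrow> 'a \<Rightarrow> 'a poly \<Rightarrow> bool" where
  "is_min_poly K x p \<longleftrightarrow> p \<in> polys_over K \<and> Polynomial.lead_coeff p = 1 \<and> poly p x = 0 \<and>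
     (\<forall>q\<in>polys_over K. q \<noteq> 0 \<and> poly q x = 0 \<longrightarrow> Polynomial.degree p \<le> Polynomial.degree q)"

text \<open>
  \<open>rsquarefree\<close> excludes multiple roots in \<open>'a\<close>; as \<open>'a\<close> is algebraically closed this is
  separability of the minimal polynomial.
\<close>
definition sep_closure :: "'a::alg_closed_field set \<Rightarrow> 'a set" where
  "sep_closure K = {x. \<exists>p. is_min_poly K x p \<and> rsquarefree p}"

definition fin_sep_ext :: "'a::alg_closed_field set \<Rightarrow> 'a set \<Rightarrow> bool" where
  "fin_sep_ext K L \<longleftrightarrow> fin_ext K L \<and> L \<subseteq> sep_closure K"

text \<open>Homomorphisms \<open>L \<rightarrow> K\<^sup>a\<^sup>l\<^sup>g\<close> over \<open>K\<close>, made extensional so that equality is equality on \<open>L\<close>.\<close>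
definition Hom_over :: "'a::field set \<Rightarrow> 'a set \<Rightarrow> ('a \<Rightarrow> 'a) set" where
  "Hom_over K L = {\<phi> \<in> extensional L.
     (\<forall>x\<in>L. \<forall>y\<in>L. \<phi> (x + y) = \<phi> x + \<phi> y \<and> \<phi> (x * y) = \<phi> x * \<phi> y) \<and> (\<forall>x\<in>K. \<phi> x = x)}"

definition Gal :: "'a::alg_closed_field set \<Rightarrow> ('a \<Rightarrow> 'a) monoid" where
  "Gal K = BijGroup (sep_closure K)
     \<lparr>carrier := Hom_over K (sep_closure K) \<inter> Bij (sep_closure K)\<rparr>"

text \<open>
  The Krull topology is the topology of pointwise convergence for the discrete topology on
  \<open>K\<^sup>s\<^sup>e\<^sup>p\<close>.
\<close>
definition krull_topology :: "'a::alg_closed_field set \<Rightarrow> ('a \<Rightarrow> 'a) topology" where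
  "krull_topology K = subtopology
     (product_topology (\<lambda>_. discrete_topology (sep_closure K)) (sep_closure K))
     (carrier (Gal K))"

definition purely_insep_ext :: "'a::field set \<Rightarrow> 'a set \<Rightarrow> bool" where
  "purely_insep_ext K K' \<longleftrightarrow> is_subfield K' \<and> K \<subseteq> K' \<and> (\<forall>x\<in>K'. \<exists>k. x ^ (CHAR('a) ^ k) \<in> K)"

definition frob_root :: "nat \<Rightarrow> 'a::field set \<Rightarrow> 'a set" where
  "frob_root t K = {x. x ^ (CHAR('a) ^ t) \<in> K}"

text \<open>The isomorphism \<open>\<gamma>\<close> from \<open>G\<^sub>K\<^sub>'\<close> to \<open>G\<^sub>K\<close>, for \<open>K'\<close> purely inseparable over \<open>K\<close>.\<close>
definition gal_restrict :: "'a::alg_closed_field set \<Rightarrow> ('a \<Rightarrow> 'a) \<Rightarrow> 'a \<Rightarrow> 'a" where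
  "gal_restrict K \<sigma> = restrict \<sigma> (sep_closure K)"

section \<open>Valuations\<close>

definition valuation :: "('a::field \<Rightarrow> ereal) \<Rightarrow> bool" where
  "valuation w \<longleftrightarrow> w 0 = \<infinity> \<and> (\<forall>x. x \<noteq> 0 \<longrightarrow> \<bar>w x\<bar> \<noteq> \<infinity>) \<and>
     (\<forall>x y. w (x * y) = w x + w y) \<and> (\<forall>x y. min (w x) (w y) \<le> w (x + y))"

definition uniformizer :: "('a::field \<Rightarrow> ereal) \<Rightarrow> 'a set \<Rightarrow> 'a \<Rightarrow> bool" where
  "uniformizer w K \<pi> \<longleftrightarrow> \<pi> \<in> K \<and> \<pi> \<noteq> 0 \<and> 0 < w \<pi> \<and>
     (\<forall>x\<in>K - {0}. \<exists>m::int. w x = ereal (of_int m) * w \<pi>)"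

definition val_complete :: "('a::field \<Rightarrow> ereal) \<Rightarrow> 'a set \<Rightarrow> bool" where
  "val_complete w K \<longleftrightarrow> (\<forall>u. (\<forall>m. u m \<in> K) \<and>
      (\<forall>N::real. \<exists>M::nat. \<forall>i\<ge>M. \<forall>j\<ge>M. ereal N \<le> w (u i - u j)) \<longrightarrow>
      (\<exists>l\<in>K. \<forall>N::real. \<exists>M::nat. \<forall>i\<ge>M. ereal N \<le> w (u i - l)))"

definition complete_dvf :: "('a::field \<Rightarrow> ereal) \<Rightarrow> 'a set \<Rightarrow> bool" where
  "complete_dvf w K \<longleftrightarrow> is_subfield K \<and> (\<exists>\<pi>. uniformizer w K \<pi>) \<and> val_complete w K"

text \<open>All uniformizers of \<open>K\<close> have the same value, so the choice is harmless.\<close>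
definition nval :: "('a::field \<Rightarrow> ereal) \<Rightarrow> 'a set \<Rightarrow> 'a \<Rightarrow> ereal" where
  "nval w K x = w x / w (SOME \<pi>. uniformizer w K \<pi>)"

definition nval_nat :: "('a::field \<Rightarrow> ereal) \<Rightarrow> 'a set \<Rightarrow> 'a \<Rightarrow> nat" where
  "nval_nat w K x = (THE e. nval w K x = ereal (real e))"

definition val_ring :: "('a::field \<Rightarrow> ereal) \<Rightarrow> 'a set \<Rightarrow> 'a set" where
  "val_ring w K = {x \<in> K. 0 \<le> w x}"

definition ram_index :: "('a::field \<Rightarrow> ereal) \<Rightarrow> 'a set \<Rightarrow> 'a set \<Rightarrow> nat" where
  "ram_index w K L = nval_nat w L (SOME \<pi>. uniformizer w K \<pi>)"

definition strict_ram_index :: "('a::field \<Rightarrow> ereal) \<Rightarrow> 'a set \<Rightarrow> 'a set \<Rightarrow> nat \<Rightarrow> bool" where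
  "strict_ram_index w K K' s \<longleftrightarrow>
     (\<exists>t. frob_root t K \<subseteq> K' \<and> \<not> frob_root (Suc t) K \<subseteq> K' \<and> s = ram_index w (frob_root t K) K')"

section \<open>Polynomials in several variables\<close>

text \<open>
  A polynomial is a finitely supported map from exponent vectors to coefficients;
  \<open>mpolys A n\<close> are those with coefficients in \<open>A\<close> and variables \<open>x\<^sub>0, \<dots>, x\<^sub>n\<^sub>-\<^sub>1\<close>.
\<close>
type_synonym 'a mpol = "(nat \<Rightarrow>\<^sub>0 nat) \<Rightarrow>\<^sub>0 'a"

definition mpolys :: "'a::field set \<Rightarrow> nat \<Rightarrow> 'a mpol set" where
  "mpolys A n = {g. (\<forall>m. Poly_Mapping.lookup g m \<in> A) \<and>
     (\<forall>m\<in>Poly_Mapping.keys g. Poly_Mapping.keys m \<subseteq> {..<n})}"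

definition eval_mpol :: "'a::field mpol \<Rightarrow> (nat \<Rightarrow> 'a) \<Rightarrow> 'a" where
  "eval_mpol g x = (\<Sum>m\<in>Poly_Mapping.keys g. Poly_Mapping.lookup g m *
     (\<Prod>i\<in>Poly_Mapping.keys m. x i ^ Poly_Mapping.lookup m i))"

section \<open>Geometric connected components\<close>

text \<open>
  Let \<open>D\<close> be a Weierstrass domain in the unit polydisc over \<open>K\<close>, given by its \<open>K\<^sup>a\<^sup>l\<^sup>g\<close>-valued
  points (for the domains below the points are extensional on \<open>{..<n}\<close>). Let \<open>F\<close> be a finite
  extension of \<open>K\<close>. Polynomials over \<open>F\<close> are dense in the (reduced) affinoid algebra of \<open>D\<^sub>F\<close>, whose
  topology is that of the supremum norm, so that this algebra is the set of functions on \<open>D\<close>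
  that are uniform limits of polynomials. The condition is imposed on \<open>D\<close> only.
\<close>
definition affinoid_funs ::
  "('a::field \<Rightarrow> ereal) \<Rightarrow> 'a set \<Rightarrow> nat \<Rightarrow> (nat \<Rightarrow> 'a) set \<Rightarrow> ((nat \<Rightarrow> 'a) \<Rightarrow> 'a) set" where
  "affinoid_funs w F n D =
     {f. \<forall>N::real. \<exists>g\<in>mpolys F n. \<forall>x\<in>D. ereal N \<le> w (f x - eval_mpol g x)}"

text \<open>Rational subdomains: \<open>|f\<^sub>i| \<le> |f\<^sub>0|\<close> for \<open>i \<le> r\<close>, where \<open>f\<^sub>0, \<dots>, f\<^sub>r\<close> have no common zero.\<close>
definition rational_subdomain ::
  "('a::field \<Rightarrow> ereal) \<Rightarrow> 'a set \<Rightarrow> nat \<Rightarrow> (nat \<Rightarrow> 'a) set \<Rightarrow> (nat \<Rightarrow> 'a) set \<Rightarrow> bool" where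
  "rational_subdomain w F n D U \<longleftrightarrow>
     (\<exists>(r::nat) f. (\<forall>i\<le>r. f i \<in> affinoid_funs w F n D) \<and>
        (\<forall>x\<in>D. \<exists>i\<le>r. f i x \<noteq> 0) \<and> U = {x\<in>D. \<forall>i\<le>r. w (f 0 x) \<le> w (f i x)})"

text \<open>
  The G-topology whose admissible open sets are the finite unions of rational subdomains and
  whose admissible coverings are the finite ones. By the theorem of Gerritzen and Grauert
  every affinoid subdomain is admissible open. Points of \<open>D\<^sub>F\<close> are Galois orbits of points of
  \<open>D\<close>, and the admissible open sets are invariant, so points of \<open>D\<close> can be used throughout.
\<close>
definition adm_open ::
  "('a::field \<Rightarrow> ereal) \<Rightarrow> 'a set \<Rightarrow> nat \<Rightarrow> (nat \<Rightarrow> 'a) set \<Rightarrow> (nat \<Rightarrow> 'a) set \<Rightarrow> bool" where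
  "adm_open w F n D U \<longleftrightarrow>
     (\<exists>\<U>. finite \<U> \<and> (\<forall>V\<in>\<U>. rational_subdomain w F n D V) \<and> U = \<Union>\<U>)"

definition rig_connected ::
  "('a::field \<Rightarrow> ereal) \<Rightarrow> 'a set \<Rightarrow> nat \<Rightarrow> (nat \<Rightarrow> 'a) set \<Rightarrow> (nat \<Rightarrow> 'a) set \<Rightarrow> bool" where
  "rig_connected w F n D T \<longleftrightarrow> T \<subseteq> D \<and>
     \<not> (\<exists>U V. adm_open w F n D U \<and> adm_open w F n D V \<and>
          T \<subseteq> U \<union> V \<and> U \<inter> V \<inter> T = {} \<and> U \<inter> T \<noteq> {} \<and> V \<inter> T \<noteq> {})"

definition same_component ::
  "('a::field \<Rightarrow> ereal) \<Rightarrow> 'a set \<Rightarrow> nat \<Rightarrow> (nat \<Rightarrow> 'a) set \<Rightarrow> (nat \<Rightarrow> 'a) \<Rightarrow> (nat \<Rightarrow> 'a) \<Rightarrow> bool" where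
  "same_component w F n D x y \<longleftrightarrow> (\<exists>T. rig_connected w F n D T \<and> x \<in> T \<and> y \<in> T)"

text \<open>
  The geometric connected components form the limit of the sets of components of \<open>D\<^sub>F\<close>
  over the finite separable \<open>F\<close>. These sets are finite and stationary for large \<open>F\<close>, so two
  points have the same image in the limit iff they are in one component over every \<open>F\<close>, and
  every element of the limit is the image of a point.
\<close>
definition geom_rel ::
  "('a::alg_closed_field \<Rightarrow> ereal) \<Rightarrow> 'a set \<Rightarrow> nat \<Rightarrow> (nat \<Rightarrow> 'a) set \<Rightarrow> (nat \<Rightarrow> 'a) rel" where
  "geom_rel w K n D =
     {(x, y). x \<in> D \<and> y \<in> D \<and> (\<forall>F. fin_sep_ext K F \<longrightarrow> same_component w F n D x y)}"

definition pi0_geom ::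
  "('a::alg_closed_field \<Rightarrow> ereal) \<Rightarrow> 'a set \<Rightarrow> nat \<Rightarrow> (nat \<Rightarrow> 'a) set \<Rightarrow> (nat \<Rightarrow> 'a) set set" where
  "pi0_geom w K n D = D // geom_rel w K n D"

section \<open>The domains of Abbes and Saito\<close>

definition unit_polydisc :: "('a::field \<Rightarrow> ereal) \<Rightarrow> nat \<Rightarrow> (nat \<Rightarrow> 'a) set" where
  "unit_polydisc w n = {..<n} \<rightarrow>\<^sub>E {x. 0 \<le> w x}"

definition generates ::
  "('a::field \<Rightarrow> ereal) \<Rightarrow> 'a set \<Rightarrow> 'a set \<Rightarrow> nat \<Rightarrow> (nat \<Rightarrow> 'a) \<Rightarrow> bool" where
  "generates w K L n z \<longleftrightarrow> inj_on z {..<n} \<and> z ` {..<n} \<subseteq> val_ring w L \<and>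
     (\<lambda>g. eval_mpol g z) ` mpolys (val_ring w K) n = val_ring w L"

definition rel_ideal ::
  "('a::field \<Rightarrow> ereal) \<Rightarrow> 'a set \<Rightarrow> nat \<Rightarrow> (nat \<Rightarrow> 'a) \<Rightarrow> 'a mpol set" where
  "rel_ideal w K n z = {g \<in> mpolys (val_ring w K) n. eval_mpol g z = 0}"

definition AS_X ::
  "('a::field \<Rightarrow> ereal) \<Rightarrow> 'a set \<Rightarrow> nat \<Rightarrow> (nat \<Rightarrow> 'a) \<Rightarrow> rat \<Rightarrow> (nat \<Rightarrow> 'a) set" where
  "AS_X w K n z a = {x \<in> unit_polydisc w n.
     \<forall>g\<in>rel_ideal w K n z. ereal (of_rat a) \<le> nval w K (eval_mpol g x)}"

text \<open>
  The choices \<open>P\<close>, \<open>\<pi>\<^sub>K\<close> (a uniformizer of \<open>K\<close>), \<open>h\<^sub>i\<close> and \<open>g\<^sub>i\<^sub>,\<^sub>j\<close> in the logarithmic case.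
\<close>
definition log_data ::
  "('a::field \<Rightarrow> ereal) \<Rightarrow> 'a set \<Rightarrow> 'a set \<Rightarrow> nat \<Rightarrow> (nat \<Rightarrow> 'a) \<Rightarrow> nat set \<Rightarrow> 'a \<Rightarrow>
     (nat \<Rightarrow> 'a mpol) \<Rightarrow> (nat \<Rightarrow> nat \<Rightarrow> 'a mpol) \<Rightarrow> bool" where
  "log_data w K L n z P \<pi> h g \<longleftrightarrow>
     P \<subseteq> {..<n} \<and> (\<exists>i\<in>P. uniformizer w L (z i)) \<and> 0 \<notin> z ` P \<and> uniformizer w K \<pi> \<and>
     (\<forall>i\<in>P. h i \<in> mpolys (val_ring w K) n \<and>
        eval_mpol (h i) z = z i ^ ram_index w K L / \<pi> ^ nval_nat w L (z i)) \<and>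
     (\<forall>i\<in>P. \<forall>j\<in>P. g i j \<in> mpolys (val_ring w K) n \<and>
        eval_mpol (g i j) z = z i ^ nval_nat w L (z j) / z j ^ nval_nat w L (z i))"

definition AS_Y ::
  "('a::field \<Rightarrow> ereal) \<Rightarrow> 'a set \<Rightarrow> 'a set \<Rightarrow> nat \<Rightarrow> (nat \<Rightarrow> 'a) \<Rightarrow> nat set \<Rightarrow> 'a \<Rightarrow>
     (nat \<Rightarrow> 'a mpol) \<Rightarrow> (nat \<Rightarrow> nat \<Rightarrow> 'a mpol) \<Rightarrow> rat \<Rightarrow> (nat \<Rightarrow> 'a) set" where
  "AS_Y w K L n z P \<pi> h g a =
     (let e = nval_nat w L \<circ> z; eL = ram_index w K L in
      {x \<in> AS_X w K n z a.
         (\<forall>i\<in>P. ereal (of_rat a + real (e i))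
             \<le> nval w K (x i ^ eL - \<pi> ^ e i * eval_mpol (h i) x)) \<and>
         (\<forall>i\<in>P. \<forall>j\<in>P. ereal (of_rat a + real (e i * e j) / real eL)
             \<le> nval w K (x i ^ e j - x j ^ e i * eval_mpol (g i j) x))})"

section \<open>The ramification filtrations\<close>

text \<open>
  \<open>\<phi> \<mapsto> (\<phi>(z\<^sub>0), \<dots>, \<phi>(z\<^sub>n\<^sub>-\<^sub>1))\<close> induces a bijection from the orbits of \<open>H\<close> on
  \<open>Hom\<^sub>K(L, K\<^sup>a\<^sup>l\<^sup>g)\<close> to the geometric connected components of \<open>D\<close>.
\<close>
definition identifies_pi0 ::
  "('a::alg_closed_field \<Rightarrow> ereal) \<Rightarrow> 'a set \<Rightarrow> 'a set \<Rightarrow> ('a \<Rightarrow> 'a) set \<Rightarrow> nat \<Rightarrow> (nat \<Rightarrow> 'a) \<Rightarrow>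
     (nat \<Rightarrow> 'a) set \<Rightarrow> bool" where
  "identifies_pi0 w K L H n z D \<longleftrightarrow>
     (let c = (\<lambda>\<phi>. geom_rel w K n D `` {\<lambda>i\<in>{..<n}. \<phi> (z i)}) in
      c ` Hom_over K L = pi0_geom w K n D \<and>
      (\<forall>\<phi>\<in>Hom_over K L. \<forall>\<psi>\<in>Hom_over K L. c \<phi> = c \<psi> \<longleftrightarrow> (\<exists>\<sigma>\<in>H. \<psi> = compose L \<sigma> \<phi>)))"

definition closed_normal :: "'a::alg_closed_field set \<Rightarrow> ('a \<Rightarrow> 'a) set \<Rightarrow> bool" where
  "closed_normal K H \<longleftrightarrow> H \<lhd> Gal K \<and> closedin (krull_topology K) H"

text \<open>
  \<open>is_ram_group w K a H\<close> says that \<open>H\<close> is the group \<open>G\<^sub>K\<^sup>a\<close>, for rational \<open>a \<ge> 0\<close>, through the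
  property that characterizes it; \<open>is_log_ram_group\<close> does so for the logarithmic filtration.
\<close>
definition is_ram_group ::
  "('a::alg_closed_field \<Rightarrow> ereal) \<Rightarrow> 'a set \<Rightarrow> rat \<Rightarrow> ('a \<Rightarrow> 'a) set \<Rightarrow> bool" where
  "is_ram_group w K a H \<longleftrightarrow>
     (if a = 0 then H = carrier (Gal K)
      else closed_normal K H \<and>
        (\<forall>L n z. fin_sep_ext K L \<and> generates w K L n z \<longrightarrow>
           identifies_pi0 w K L H n z (AS_X w K n z a)))"

text \<open>The inertia group: the automorphisms acting trivially on the residue field of \<open>K\<^sup>s\<^sup>e\<^sup>p\<close>.\<close>
definition inertia :: "('a::alg_closed_field \<Rightarrow> ereal) \<Rightarrow> 'a set \<Rightarrow> ('a \<Rightarrow> 'a) set" where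
  "inertia w K = {\<sigma> \<in> carrier (Gal K). \<forall>x\<in>val_ring w (sep_closure K). 0 < w (\<sigma> x - x)}"

definition is_log_ram_group ::
  "('a::alg_closed_field \<Rightarrow> ereal) \<Rightarrow> 'a set \<Rightarrow> rat \<Rightarrow> ('a \<Rightarrow> 'a) set \<Rightarrow> bool" where
  "is_log_ram_group w K a H \<longleftrightarrow>
     (if a = 0 then H = inertia w K
      else closed_normal K H \<and>
        (\<forall>L n z P \<pi> h g. fin_sep_ext K L \<and> generates w K L n z \<and> log_data w K L n z P \<pi> h g \<longrightarrow>
           identifies_pi0 w K L H n z (AS_Y w K L n z P \<pi> h g a)))"

end

theory Submission
  imports Defs
begin

text \<open>
  Let \<open>q = p\<^sup>t\<close> with \<open>K\<^bsup>1/q\<^esup> \<subseteq> K'\<close>. For \<open>L/K\<close> finite separable choose a finite separable \<open>L'/K'\<close> containing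
  \<open>L\<^bsup>1/q\<^esup>\<close>, and complete the \<open>q\<close>-th roots of generators \<open>z\<close> of \<open>O\<^sub>L\<close> to generators \<open>z'\<close> of \<open>O\<^sub>L\<^sub>'\<close>. Since the
  \<open>q\<close>-th roots of the coefficients of a relation between the \<open>z\<^sub>i\<close> give a relation between the \<open>z'\<^sub>i\<close>,
  and \<open>v\<^sub>K\<^sub>' = q s v\<^sub>K\<close>, the map \<open>(x\<^sub>i) \<mapsto> (x\<^sub>i\<^sup>q)\<close> sends the domain of \<open>z'\<close> at level \<open>s a\<close> to that of \<open>z\<close> at
  level \<open>a\<close>. It pulls polynomials over \<open>F\<close> back to polynomials over \<open>F K'\<close>, hence preserves
  connectedness, and it is equivariant. So each element of \<open>G\<^sub>K\<^sub>'\<^bsup>sa\<^esup>\<close> agrees on \<open>L\<close> with an element of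
  \<open>G\<^sub>K\<^sup>a\<close>, and the latter group is closed. In the logarithmic case it suffices to let \<open>P\<close> consist of
  one uniformizer of \<open>L\<close>, and \<open>P'\<close> of its \<open>q\<close>-th root and a uniformizer of \<open>L'\<close>.
\<close>

section \<open>Subfields and linear algebra over them\<close>

text \<open>The levels scale by s alone for this reason: the q-th root of a uniformizer of K is a
  uniformizer of K^(1/q) and has value s under v_K'. Taking q-th powers of the coordinates
  multiplies values by q, which uses up the factor q in v_K' = q s v_K. That some finite separable
  L'/K' contains L^(1/q) rests on a criterion: x is separable over K iff x is a polynomial over K in
  x^p. An identity x = h(x^p) survives every ring homomorphism, here the q-th root map of K^alg,
  which sends K into K'. The same criterion shows, by counting dimensions, that finitely many
  separable elements generate a separable extension. Completeness enters through the finiteness of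
  the valuation rings of L and L' as modules, which provides finite generating families extending
  prescribed elements. The ramification groups are accessible only through components: an element of
  the group over K' puts two points into one component, and the image of this component must be
  translated back into an element of the group over K. For a = 0 the groups are given directly, and
  so is the inclusion.\<close>

lemma subring_type_iff:
  "subring K (ring_of_type_algebra :: 'a::field ring) \<longleftrightarrow>
     1 \<in> K \<and> (\<forall>x\<in>K. \<forall>y\<in>K. x - y \<in> K \<and> x * y \<in> K)" (is "?L \<longleftrightarrow> ?R")
proof
  interpret R: field "ring_of_type_algebra :: 'a ring" by (rule field_from_type_algebra)
  have minus: "a_inv ring_of_type_algebra x = - x" for x :: 'a
    by (metis R.add.inv_equality UNIV_I add.left_inverse partial_object.select_convs(1)
        ring_of_type_algebra_def ring_record_simps(11) ring_record_simps(12))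
  {
    assume ?L
    then show ?R
      using subringE[OF \<open>?L\<close>] minus
      by (simp add: ring_of_type_algebra_def) (metis add_uminus_conv_diff)
  }
  {
    assume R: ?R
    then have 0: "0 \<in> K" by (metis diff_self)
    then have n: "- x \<in> K" if "x \<in> K" for x using R that by (metis diff_0)
    then have "x + y \<in> K" if "x \<in> K" "y \<in> K" for x y using R that by (metis diff_minus_eq_add)
    then show ?L
      using R n minus by (intro R.subringI) (auto simp: ring_of_type_algebra_def)
  }
qed

text \<open>The definition speaks of the algebra record of the type; this form allows type-class
  arithmetic from here on. Including 0 in the last clause is harmless because
  \<open>inverse 0 = 0\<close>.\<close>

lemma is_subfield_iff:
  "is_subfield K \<longleftrightarrow> 1 \<in> K \<and> (\<forall>x\<in>K. \<forall>y\<in>K. x - y \<in> K \<and> x * y \<in> K) \<and> (\<forall>x\<in>K. inverse x \<in> K)"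
  (is "?L \<longleftrightarrow> ?R")
proof
  interpret R: field "ring_of_type_algebra :: 'a ring" by (rule field_from_type_algebra)
  have inv: "m_inv ring_of_type_algebra x = inverse x" if "x \<noteq> 0" for x :: 'a
    by (rule R.comm_inv_char) (use that in \<open>auto simp: ring_of_type_algebra_def\<close>)
  {
    assume ?L
    then have K: "subfield K (ring_of_type_algebra :: 'a ring)" by (simp add: is_subfield_def)
    have "inverse x \<in> K" if "x \<in> K" for x
    proof (cases "x = 0")
      case False
      then have "x \<in> K - {\<zero>\<^bsub>(ring_of_type_algebra :: 'a ring)\<^esub>}"
        using that by (simp add: ring_of_type_algebra_def)
      then show ?thesis using R.subfield_m_inv(1)[OF K, of x] inv[OF False] by simp
    qed (use that in simp)
    then show ?R using subfieldE(1)[OF K] by (simp add: subring_type_iff)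
  }
  {
    assume R: ?R
    have "subring K (ring_of_type_algebra :: 'a ring)" using R by (simp add: subring_type_iff)
    moreover have "m_inv ring_of_type_algebra k \<in> K"
      if "k \<in> K - {\<zero>\<^bsub>(ring_of_type_algebra :: 'a ring)\<^esub>}" for k
    proof -
      have "k \<in> K" "k \<noteq> 0" using that by (auto simp: ring_of_type_algebra_def)
      then show ?thesis using R inv by simp
    qed
    ultimately show ?L unfolding is_subfield_def by (rule R.subfieldI')
  }
qed

context
  fixes K :: "'a::field set"
  assumes K: "is_subfield K"
begin

lemma subfield_one: "1 \<in> K"
  and subfield_diff: "x \<in> K \<Longrightarrow> y \<in> K \<Longrightarrow> x - y \<in> K"
  and subfield_mult: "x \<in> K \<Longrightarrow> y \<in> K \<Longrightarrow> x * y \<in> K"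
  and subfield_inverse: "x \<in> K \<Longrightarrow> inverse x \<in> K"
  using K by (auto simp: is_subfield_iff)

lemma subfield_zero: "0 \<in> K" using subfield_diff[OF subfield_one subfield_one] by simp

lemma subfield_uminus: "x \<in> K \<Longrightarrow> - x \<in> K" using subfield_diff[OF subfield_zero] by simp

lemma subfield_add: "x \<in> K \<Longrightarrow> y \<in> K \<Longrightarrow> x + y \<in> K"
  using subfield_diff[of x "- y"] subfield_uminus by simp

lemma subfield_divide: "x \<in> K \<Longrightarrow> y \<in> K \<Longrightarrow> x / y \<in> K"
  using subfield_mult[of x "inverse y"] subfield_inverse by (simp add: divide_inverse)

lemma subfield_power: "x \<in> K \<Longrightarrow> x ^ n \<in> K"
  by (induction n) (auto simp: subfield_one subfield_mult)

lemma subfield_sum: "(\<And>i. i \<in> I \<Longrightarrow> f i \<in> K) \<Longrightarrow> sum f I \<in> K"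
  by (induction I rule: infinite_finite_induct) (auto simp: subfield_zero subfield_add)

end

lemmas subfield_closed = subfield_one subfield_diff subfield_mult subfield_inverse subfield_zero
  subfield_uminus subfield_add subfield_divide subfield_power subfield_sum

text \<open>Families are functions read only below \<open>n\<close>, so that passing to an initial
  segment or to an extension keeps the same indices.\<close>

definition lin_span :: "'a::field set \<Rightarrow> nat \<Rightarrow> (nat \<Rightarrow> 'a) \<Rightarrow> 'a set" where
  "lin_span K n b = {\<Sum>i<n. c i * b i | c. \<forall>i<n. c i \<in> K}"

definition lin_indep :: "'a::field set \<Rightarrow> nat \<Rightarrow> (nat \<Rightarrow> 'a) \<Rightarrow> bool" where
  "lin_indep K n b \<longleftrightarrow>
     (\<forall>c. (\<forall>i<n. c i \<in> K) \<and> (\<Sum>i<n. c i * b i) = 0 \<longrightarrow> (\<forall>i<n. c i = 0))"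

lemma combine_type:
  "length cs = length us \<Longrightarrow>
   ring.combine (ring_of_type_algebra :: 'a::field ring) cs us = (\<Sum>i<length us. cs ! i * us ! i)"
proof (induction cs us rule: list_induct2)
  interpret R: field "ring_of_type_algebra :: 'a ring" by (rule field_from_type_algebra)
  case (Cons c cs u us)
  then show ?case
    by (simp add: sum.lessThan_Suc_shift del: sum.lessThan_Suc)
       (simp add: ring_of_type_algebra_def)
next
  interpret R: field "ring_of_type_algebra :: 'a ring" by (rule field_from_type_algebra)
  case Nil
  then show ?case by simp (simp add: ring_of_type_algebra_def)
qed

lemma Span_type:
  assumes "is_subfield K"
  shows "ring.Span (ring_of_type_algebra :: 'a::field ring) K (map b [0..<n]) = lin_span K n b"
proof -
  interpret R: field "ring_of_type_algebra :: 'a ring" by (rule field_from_type_algebra)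
  have K: "subfield K (ring_of_type_algebra :: 'a ring)"
    using assms by (simp add: is_subfield_def)
  have "x \<in> R.Span K (map b [0..<n]) \<longleftrightarrow> x \<in> lin_span K n b" for x
  proof -
    have "x \<in> R.Span K (map b [0..<n]) \<longleftrightarrow>
        (\<exists>cs. set cs \<subseteq> K \<and> length cs = n \<and> x = R.combine cs (map b [0..<n]))"
      using R.Span_mem_iff_length_version[OF K, of "map b [0..<n]" x]
      by (simp add: ring_of_type_algebra_def)
    also have "\<dots> \<longleftrightarrow> x \<in> lin_span K n b"
    proof
      assume "\<exists>cs. set cs \<subseteq> K \<and> length cs = n \<and> x = R.combine cs (map b [0..<n])"
      then obtain cs where cs: "set cs \<subseteq> K" "length cs = n" "x = R.combine cs (map b [0..<n])"
        by blast
      then show "x \<in> lin_span K n b"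
        unfolding lin_span_def
        by (intro CollectI exI[of _ "(!) cs"])
           (auto simp: combine_type intro!: sum.cong)
    next
      assume "x \<in> lin_span K n b"
      then obtain c where c: "x = (\<Sum>i<n. c i * b i)" "\<forall>i<n. c i \<in> K"
        unfolding lin_span_def by blast
      then show "\<exists>cs. set cs \<subseteq> K \<and> length cs = n \<and> x = R.combine cs (map b [0..<n])"
        by (intro exI[of _ "map c [0..<n]"]) (auto simp: combine_type intro!: sum.cong)
    qed
    finally show ?thesis .
  qed
  then show ?thesis by blast
qed

lemma independent_type:
  assumes "is_subfield K"
  shows "ring.independent (ring_of_type_algebra :: 'a::field ring) K (map b [0..<n]) \<longleftrightarrow>
     lin_indep K n b"
proof -
  interpret R: field "ring_of_type_algebra :: 'a ring" by (rule field_from_type_algebra)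
  have K: "subfield K (ring_of_type_algebra :: 'a ring)"
    using assms by (simp add: is_subfield_def)
  have 0: "\<zero>\<^bsub>(ring_of_type_algebra :: 'a ring)\<^esub> = 0" by (simp add: ring_of_type_algebra_def)
  have U: "set us \<subseteq> carrier (ring_of_type_algebra :: 'a ring)" for us
    by (simp add: ring_of_type_algebra_def)
  show ?thesis
  proof
    assume I: "R.independent K (map b [0..<n])"
    show "lin_indep K n b" unfolding lin_indep_def
    proof safe
      fix c i assume c: "\<forall>i<n. c i \<in> K" "(\<Sum>i<n. c i * b i) = 0" "i < n"
      have "set (map c [0..<n]) \<subseteq> K" using c by auto
      moreover have "R.combine (map c [0..<n]) (map b [0..<n]) = \<zero>\<^bsub>ring_of_type_algebra\<^esub>"
        using c by (simp add: combine_type 0)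
      ultimately have "set (take (length (map b [0..<n])) (map c [0..<n])) \<subseteq> {\<zero>\<^bsub>ring_of_type_algebra\<^esub>}"
        by (rule R.independent_imp_trivial_combine[OF K I])
      then show "c i = 0" using c(3) by (fastforce simp: 0)
    qed
  next
    assume I: "lin_indep K n b"
    show "R.independent K (map b [0..<n])"
    proof (rule ccontr)
      assume "\<not> R.independent K (map b [0..<n])"
      then obtain Ks where Ks: "length Ks = length (map b [0..<n])"
        "R.combine Ks (map b [0..<n]) = \<zero>\<^bsub>ring_of_type_algebra\<^esub>"
        "set Ks \<subseteq> K" "set Ks \<noteq> {\<zero>\<^bsub>ring_of_type_algebra\<^esub>}"
        using R.dependent_imp_non_trivial_combine[OF K U] by blast
      have Ks': "length Ks = n" using Ks by simp
      have "(\<Sum>i<n. Ks ! i * b i) = 0" using Ks by (simp add: combine_type 0)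
      moreover have "\<forall>i<n. Ks ! i \<in> K" using Ks(3) Ks' by auto
      ultimately have "\<forall>i<n. Ks ! i = 0" using I unfolding lin_indep_def by blast
      then have "set Ks \<subseteq> {0}" using Ks' by (auto simp: in_set_conv_nth)
      then have "Ks = []" using Ks(4) 0 by (cases Ks) auto
      then have "n = 0" using Ks' by simp
      then show False using \<open>\<not> R.independent K (map b [0..<n])\<close> by simp
    qed
  qed
qed

text \<open>Each vector raises the dimension by one, or by nothing if it already lies in the span of
  the others; dimension \<open>n\<close> therefore leaves no redundant vector.\<close>

lemma lin_span_dimension:
  assumes "is_subfield K"
  shows "\<exists>k\<le>n. ring.dimension (ring_of_type_algebra :: 'a::field ring) k K (lin_span K n b) \<and>
     (k = n \<longrightarrow> lin_indep K n b)"
proof -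
  interpret R: field "ring_of_type_algebra :: 'a ring" by (rule field_from_type_algebra)
  have K: "subfield K (ring_of_type_algebra :: 'a ring)"
    using assms by (simp add: is_subfield_def)
  have U: "set us \<subseteq> carrier (ring_of_type_algebra :: 'a ring)" for us
    by (simp add: ring_of_type_algebra_def)
  have "\<exists>k\<le>length us. R.dimension k K (R.Span K us) \<and> (k = length us \<longrightarrow> R.independent K us)"
    for us
  proof (induction us)
    case Nil
    then show ?case by auto
  next
    case (Cons u us)
    then obtain k where k: "k \<le> length us" "R.dimension k K (R.Span K us)"
      "k = length us \<longrightarrow> R.independent K us" by blast
    show ?case
    proof (cases "u \<in> R.Span K us")
      case True
      have "R.Span K (u # us) = R.Span K us"
      proof
        show "R.Span K (u # us) \<subseteq> R.Span K us"
          using R.mono_Span_subset[OF K, of "u # us" us] True R.Span_base_incl[OF K U, of us] U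
          by (metis insert_subset list.simps(15))
        show "R.Span K us \<subseteq> R.Span K (u # us)"
          by (rule R.mono_Span_sublist[OF K]) (use U[of "u # us"] in auto)
      qed
      then show ?thesis using k by (intro exI[of _ k]) auto
    next
      case False
      have u: "u \<in> carrier ring_of_type_algebra" using U[of "[u]"] by auto
      have "R.dimension (Suc k) K (R.Span K (u # us))"
        using R.Suc_dim[OF u False k(2)] by simp
      moreover have "R.independent K (u # us)" if "k = length us"
        using R.li_Cons[OF u False] that k(3) by simp
      ultimately show ?thesis using k(1) by (intro exI[of _ "Suc k"]) auto
    qed
  qed
  from this[of "map b [0..<n]"] show ?thesis
    unfolding Span_type[OF assms] independent_type[OF assms] by simp
qed

lemma lin_indep_le:
  assumes "is_subfield K" "lin_indep K m u" "\<And>i. i < m \<Longrightarrow> u i \<in> lin_span K n b"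
  shows "m \<le> n"
proof -
  interpret R: field "ring_of_type_algebra :: 'a ring" by (rule field_from_type_algebra)
  have K: "subfield K (ring_of_type_algebra :: 'a ring)"
    using assms by (simp add: is_subfield_def)
  obtain k where k: "k \<le> n" "R.dimension k K (lin_span K n b)"
    using lin_span_dimension[OF assms(1)] by blast
  have "length (map u [0..<m]) \<le> k"
    by (rule R.independent_length_le_dimension[OF K k(2)])
       (use assms in \<open>auto simp: independent_type simp del: R.Span.simps\<close>)
  then show ?thesis using k(1) by simp
qed

lemma lin_indep_span:
  assumes "is_subfield K" "lin_indep K n u" "\<And>i. i < n \<Longrightarrow> u i \<in> lin_span K n b" "lin_indep K n b"
  shows "lin_span K n u = lin_span K n b"
proof -
  interpret R: field "ring_of_type_algebra :: 'a ring" by (rule field_from_type_algebra)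
  have K: "subfield K (ring_of_type_algebra :: 'a ring)"
    using assms by (simp add: is_subfield_def)
  have "R.dimension n K (lin_span K n b)"
    using R.dimension_independent[of K "map b [0..<n]"] assms
    unfolding Span_type[OF assms(1)] independent_type[OF assms(1)] by simp
  then have "length (map u [0..<n]) = n \<longleftrightarrow> R.Span K (map u [0..<n]) = lin_span K n b"
    by (rule R.independent_length_eq_dimension[OF K])
       (use assms in \<open>auto simp: independent_type simp del: R.Span.simps\<close>)
  then show ?thesis using assms(1) by (simp add: Span_type del: R.Span.simps)
qed

text \<open>As many vectors as the dimension, and they span. This is how spanning by p-th powers
  becomes independence of p-th powers.\<close>

lemma lin_span_indep:
  assumes "is_subfield K" "lin_indep K n b" "lin_span K n u = lin_span K n b"
  shows "lin_indep K n u"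
proof -
  interpret R: field "ring_of_type_algebra :: 'a ring" by (rule field_from_type_algebra)
  have K: "subfield K (ring_of_type_algebra :: 'a ring)"
    using assms by (simp add: is_subfield_def)
  obtain k where k: "k \<le> n" "R.dimension k K (lin_span K n u)" "k = n \<longrightarrow> lin_indep K n u"
    using lin_span_dimension[OF assms(1)] by blast
  have "R.dimension n K (lin_span K n b)"
    using R.dimension_independent[of K "map b [0..<n]"] assms
    unfolding Span_type[OF assms(1)] independent_type[OF assms(1)] by simp
  then have "k = n" using R.dimension_is_inj[OF K k(2)] assms(3) by simp
  then show ?thesis using k by simp
qed

lemma fin_ext_basis_extend:
  assumes "is_subfield K" "fin_ext K L" "lin_indep K m u" "\<And>i. i < m \<Longrightarrow> u i \<in> L"
  shows "\<exists>n v. lin_indep K n v \<and> lin_span K n v = L \<and> m \<le> n \<and> (\<forall>i<m. v i = u i)"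
proof -
  interpret R: field "ring_of_type_algebra :: 'a ring" by (rule field_from_type_algebra)
  have K: "subfield K (ring_of_type_algebra :: 'a ring)"
    using assms by (simp add: is_subfield_def)
  have U: "set us \<subseteq> carrier (ring_of_type_algebra :: 'a ring)" for us
    by (simp add: ring_of_type_algebra_def)
  obtain n where n: "R.dimension n K L" using assms(2) unfolding fin_ext_def by blast
  obtain vs where vs: "length (vs @ map u [0..<m]) = n" "R.independent K (vs @ map u [0..<m])"
      "R.Span K (vs @ map u [0..<m]) = L"
    using R.complete_base[OF K n, of "map u [0..<m]"] assms
    by (force simp: independent_type simp del: R.Span.simps)
  \<comment> \<open>Completion to a basis puts the new vectors in front; swapping the two parts
    keeps the given family at the indices below \<open>m\<close>.\<close>
  define ws where "ws = map u [0..<m] @ vs"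
  have len: "length ws = n" using vs(1) by (simp add: ws_def)
  have m: "map ((!) ws) [0..<n] = ws" using len by (metis map_nth)
  have S: "R.Span K ws = L"
    using R.Span_same_set[OF K U, of "vs @ map u [0..<m]" ws] vs(3) by (auto simp: ws_def)
  have I: "R.independent K ws"
    unfolding ws_def by (rule R.independent_same_set[OF K _ _ vs(2)]) auto
  show ?thesis
  proof (intro exI conjI)
    show "lin_indep K n ((!) ws)" using I independent_type[OF assms(1), of "(!) ws" n] m by simp
    show "lin_span K n ((!) ws) = L"
      using S Span_type[OF assms(1), of "(!) ws" n] m by (simp del: R.Span.simps)
    show "m \<le> n" using vs(1) by simp
    show "\<forall>i<m. ws ! i = u i" by (simp add: ws_def nth_append)
  qed
qed

lemma fin_ext_basis:
  assumes "is_subfield K" "fin_ext K L"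
  shows "\<exists>n v. lin_indep K n v \<and> lin_span K n v = L"
  using fin_ext_basis_extend[OF assms, of 0 "\<lambda>_. 0"] by (auto simp: lin_indep_def)

lemma lin_indep_mono: "lin_indep K n b \<Longrightarrow> m \<le> n \<Longrightarrow> is_subfield K \<Longrightarrow> lin_indep K m b"
  unfolding lin_indep_def
proof safe
  fix c i
  assume a: "\<forall>c. (\<forall>i<n. c i \<in> K) \<and> (\<Sum>i<n. c i * b i) = 0 \<longrightarrow> (\<forall>i<n. c i = 0)" "m \<le> n"
    "is_subfield K" "\<forall>i<m. c i \<in> K" "(\<Sum>i<m. c i * b i) = 0" "i < m"
  define d where "d i = (if i < m then c i else 0)" for i
  have "(\<Sum>i<n. d i * b i) = (\<Sum>i<m. c i * b i)"
    by (rule sum.mono_neutral_cong_right) (use a(2) in \<open>auto simp: d_def\<close>)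
  moreover have "\<forall>i<n. d i \<in> K" using a(4) subfield_zero[OF a(3)] by (simp add: d_def)
  ultimately have "\<forall>i<n. d i = 0" using a(1,5) by auto
  then show "c i = 0" using a(2,6) by (metis d_def order_less_le_trans)
qed

context
  fixes K :: "'a::field set"
  assumes K: "is_subfield K"
begin

lemma lin_spanI: "x = (\<Sum>i<n. c i * b i) \<Longrightarrow> (\<And>i. i < n \<Longrightarrow> c i \<in> K) \<Longrightarrow> x \<in> lin_span K n b"
  unfolding lin_span_def by blast

lemma lin_span_add: "x \<in> lin_span K n b \<Longrightarrow> y \<in> lin_span K n b \<Longrightarrow> x + y \<in> lin_span K n b"
proof -
  assume "x \<in> lin_span K n b" "y \<in> lin_span K n b"
  then obtain c d where "x = (\<Sum>i<n. c i * b i)" "\<forall>i<n. c i \<in> K"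
    "y = (\<Sum>i<n. d i * b i)" "\<forall>i<n. d i \<in> K" unfolding lin_span_def by blast
  then show ?thesis
    by (intro lin_spanI[where c = "\<lambda>i. c i + d i"])
       (auto simp: sum.distrib algebra_simps subfield_add[OF K])
qed

lemma lin_span_smult: "x \<in> lin_span K n b \<Longrightarrow> k \<in> K \<Longrightarrow> k * x \<in> lin_span K n b"
proof -
  assume "x \<in> lin_span K n b" "k \<in> K"
  then obtain c where "x = (\<Sum>i<n. c i * b i)" "\<forall>i<n. c i \<in> K" "k \<in> K"
    unfolding lin_span_def by blast
  then show ?thesis
    by (intro lin_spanI[where c = "\<lambda>i. k * c i"])
       (auto simp: sum_distrib_left algebra_simps subfield_mult[OF K])
qed

lemma lin_span_zero: "0 \<in> lin_span K n b"
  by (rule lin_spanI[where c = "\<lambda>_. 0"]) (auto simp: subfield_zero[OF K])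

lemma lin_span_diff: "x \<in> lin_span K n b \<Longrightarrow> y \<in> lin_span K n b \<Longrightarrow> x - y \<in> lin_span K n b"
  using lin_span_add[of x n b "- 1 * y"] lin_span_smult[of y n b "- 1"]
  by (simp add: subfield_closed[OF K])

lemma lin_span_sum: "(\<And>i. i \<in> I \<Longrightarrow> f i \<in> lin_span K n b) \<Longrightarrow> sum f I \<in> lin_span K n b"
  by (induction I rule: infinite_finite_induct) (auto simp: lin_span_zero lin_span_add)

lemma lin_span_base: "i < n \<Longrightarrow> b i \<in> lin_span K n b"
proof (rule lin_spanI)
  assume "i < n"
  then show "b i = (\<Sum>j<n. (if j = i then 1 else 0) * b j)"
    by (simp add: if_distrib[of "\<lambda>x. x * b _"] cong: if_cong)
qed (simp add: subfield_closed[OF K])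

end

section \<open>Polynomials over a subfield and separability\<close>

context
  fixes K :: "'a::field set"
  assumes K: "is_subfield K"
begin

lemma polys_over_coeff: "p \<in> polys_over K \<Longrightarrow> Polynomial.coeff p i \<in> K"
  by (simp add: polys_over_def)

lemma polys_over_diff: "p \<in> polys_over K \<Longrightarrow> q \<in> polys_over K \<Longrightarrow> p - q \<in> polys_over K"
  and polys_over_add: "p \<in> polys_over K \<Longrightarrow> q \<in> polys_over K \<Longrightarrow> p + q \<in> polys_over K"
  and polys_over_mult: "p \<in> polys_over K \<Longrightarrow> q \<in> polys_over K \<Longrightarrow> p * q \<in> polys_over K"
  and polys_over_smult: "c \<in> K \<Longrightarrow> q \<in> polys_over K \<Longrightarrow> Polynomial.smult c q \<in> polys_over K"
  and polys_over_monom: "c \<in> K \<Longrightarrow> Polynomial.monom c n \<in> polys_over K"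
  by (auto simp: polys_over_def coeff_mult intro!: subfield_closed[OF K])

lemma polys_over_pCons: "c \<in> K \<Longrightarrow> p \<in> polys_over K \<Longrightarrow> pCons c p \<in> polys_over K"
  by (auto simp: polys_over_def coeff_pCons split: nat.split)

lemma polys_over_zero: "0 \<in> polys_over K"
  by (simp add: polys_over_def subfield_zero[OF K])

lemma polys_over_sum: "(\<And>i. i \<in> I \<Longrightarrow> f i \<in> polys_over K) \<Longrightarrow> sum f I \<in> polys_over K"
  by (induction I rule: infinite_finite_induct) (auto simp: polys_over_zero polys_over_add)

lemma polys_over_pcompose:
  assumes "p \<in> polys_over K" "q \<in> polys_over K"
  shows "pcompose p q \<in> polys_over K"
  using assms(1)
proof (induction p)
  case (pCons a p)
  have "a \<in> K" using polys_over_coeff[OF pCons.prems, of 0] by simp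
  moreover have "p \<in> polys_over K"
    unfolding polys_over_def using polys_over_coeff[OF pCons.prems, of "Suc _"] by simp
  ultimately show ?case
    using pCons.IH assms(2)
    by (auto simp: pcompose_pCons polys_over_zero intro!: polys_over_add polys_over_mult polys_over_pCons)
qed (simp add: polys_over_zero)

text \<open>Ordinary long division: the leading term that is subtracted has coefficients in
  \<open>K\<close>, so quotient and remainder stay over \<open>K\<close>.\<close>

lemma polys_over_division:
  assumes "p \<in> polys_over K" "q \<in> polys_over K" "q \<noteq> 0"
  shows "\<exists>d\<in>polys_over K. \<exists>r\<in>polys_over K. p = q * d + r \<and> (r = 0 \<or> Polynomial.degree r < Polynomial.degree q)"
  using assms(1)
\<comment> \<open>The measure places the zero polynomial strictly below the constants, which have
  degree 0 as well; this matters when a constant is divided by a constant.\<close>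
proof (induction "if p = 0 then 0 else Suc (Polynomial.degree p)" arbitrary: p rule: less_induct)
  case less
  show ?case
  proof (cases "p = 0 \<or> Polynomial.degree p < Polynomial.degree q")
    case True
    then show ?thesis using less.prems polys_over_zero by (intro bexI[of _ 0] bexI[of _ p]) auto
  next
    case False
    define m where "m = Polynomial.monom (Polynomial.lead_coeff p / Polynomial.lead_coeff q) (Polynomial.degree p - Polynomial.degree q)"
    have m: "m \<in> polys_over K" unfolding m_def
      by (intro polys_over_monom subfield_divide[OF K] polys_over_coeff less.prems assms)
    define p' where "p' = p - q * m"
    have nz: "Polynomial.lead_coeff p / Polynomial.lead_coeff q \<noteq> 0" using False assms by auto
    have dq: "Polynomial.degree (q * m) = Polynomial.degree p"
    proof -
      have "Polynomial.degree m = Polynomial.degree p - Polynomial.degree q"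
        unfolding m_def by (rule Polynomial.degree_monom_eq[OF nz])
      moreover have "m \<noteq> 0" unfolding m_def using nz by (metis monom_eq_0_iff)
      ultimately show ?thesis using False assms(3) by (simp add: degree_mult_eq)
    qed
    have lc: "Polynomial.lead_coeff (q * m) = Polynomial.lead_coeff p"
    proof -
      have "Polynomial.lead_coeff m = Polynomial.lead_coeff p / Polynomial.lead_coeff q"
        unfolding m_def Polynomial.degree_monom_eq[OF nz] by simp
      then show ?thesis using assms(3) by (simp add: lead_coeff_mult)
    qed
    have "p' = 0 \<or> Polynomial.degree p' < Polynomial.degree p"
    proof (rule ccontr)
      assume a: "\<not> (p' = 0 \<or> Polynomial.degree p' < Polynomial.degree p)"
      have "Polynomial.degree p' \<le> Polynomial.degree p"
        unfolding p'_def using dq by (intro degree_diff_le) auto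
      then have d: "Polynomial.degree p' = Polynomial.degree p" using a by simp
      have "Polynomial.coeff p' (Polynomial.degree p) = 0" unfolding p'_def using dq lc by simp
      then show False using d a by (metis leading_coeff_0_iff)
    qed
    then have "(if p' = 0 then 0 else Suc (Polynomial.degree p')) < (if p = 0 then 0 else Suc (Polynomial.degree p))"
      using False by auto
    moreover have "p' \<in> polys_over K"
      unfolding p'_def by (intro polys_over_diff polys_over_mult less.prems assms m)
    ultimately obtain d r where dr: "d \<in> polys_over K" "r \<in> polys_over K" "p' = q * d + r"
      "r = 0 \<or> Polynomial.degree r < Polynomial.degree q" using less.hyps by blast
    have "p = q * (d + m) + r" using dr(3) by (simp add: p'_def algebra_simps)
    then show ?thesis using dr m polys_over_add by blast
  qed
qed

lemma min_poly_exists: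
  assumes "f \<in> polys_over K" "f \<noteq> 0" "poly f x = 0"
  shows "\<exists>q. is_min_poly K x q"
proof -
  let ?P = "\<lambda>q. q \<in> polys_over K \<and> q \<noteq> 0 \<and> poly q x = 0"
  define q where "q = arg_min Polynomial.degree ?P"
  have q: "?P q" "\<And>r. ?P r \<Longrightarrow> Polynomial.degree q \<le> Polynomial.degree r"
    unfolding q_def using assms arg_min_nat_lemma[of ?P f Polynomial.degree] by blast+
  let ?r = "Polynomial.smult (inverse (Polynomial.lead_coeff q)) q"
  have "is_min_poly K x ?r"
    unfolding is_min_poly_def
  proof (intro conjI ballI impI)
    show "?r \<in> polys_over K"
      by (intro polys_over_smult subfield_inverse[OF K] polys_over_coeff) (use q in auto)
  qed (use q in auto)
  then show ?thesis ..
qed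

lemma min_poly_dvd:
  assumes "is_min_poly K x q" "f \<in> polys_over K" "poly f x = 0"
  shows "q dvd f"
proof -
  have q: "q \<in> polys_over K" "q \<noteq> 0" "poly q x = 0" using assms(1) by (auto simp: is_min_poly_def)
  obtain d r where r: "r \<in> polys_over K" "f = q * d + r"
    "r = 0 \<or> Polynomial.degree r < Polynomial.degree q" using polys_over_division[OF assms(2) q(1,2)] by blast
  have "poly r x = 0" using r(2) assms(3) q(3) by simp
  then have "r = 0" using r assms(1) unfolding is_min_poly_def by (meson linorder_not_le)
  then show ?thesis using r(2) by simp
qed

end

section \<open>Separable elements and the criterion x in K[x^p]\<close>

lemma rsquarefree_dvd: "p dvd q \<Longrightarrow> rsquarefree q \<Longrightarrow> rsquarefree p"
proof -
  assume a: "p dvd q" "rsquarefree q"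
  then have q: "q \<noteq> 0" "Polynomial.order x q \<le> 1" for x
    unfolding rsquarefree_def by (auto, metis le_refl zero_le)
  then have "Polynomial.order x p \<le> 1" for x using dvd_imp_order_le[OF q(1) a(1)] le_trans by blast
  moreover have "p \<noteq> 0" using a(1) q(1) by auto
  ultimately show ?thesis unfolding rsquarefree_def by (simp add: le_Suc_eq)
qed

text \<open>The minimal polynomial divides \<open>f\<close> and inherits its simple roots, so any
  polynomial over \<open>K\<close> without multiple roots can witness separability.\<close>

lemma sep_closureI:
  assumes "is_subfield K" "f \<in> polys_over K" "rsquarefree f" "poly f x = 0"
  shows "x \<in> sep_closure K"
proof -
  have "f \<noteq> 0" using assms by (simp add: rsquarefree_def)
  then obtain q where q: "is_min_poly K x q" using min_poly_exists assms by blast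
  then have "rsquarefree q" using min_poly_dvd[OF assms(1) q assms(2,4)] assms(3) rsquarefree_dvd by blast
  then show ?thesis using q unfolding sep_closure_def by blast
qed

lemma sep_closureE:
  assumes "x \<in> sep_closure K"
  obtains f where "f \<in> polys_over K" "rsquarefree f" "poly f x = 0" "f \<noteq> 0"
  using assms unfolding sep_closure_def is_min_poly_def rsquarefree_def by blast

lemma sep_closure_mono:
  assumes "is_subfield K'" "K \<subseteq> K'"
  shows "sep_closure K \<subseteq> sep_closure K'"
proof
  fix x assume "x \<in> sep_closure K"
  then obtain f where f: "f \<in> polys_over K" "rsquarefree f" "poly f x = 0" by (rule sep_closureE)
  then have "f \<in> polys_over K'" using assms(2) by (auto simp: polys_over_def)
  then show "x \<in> sep_closure K'" using sep_closureI assms(1) f by blast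
qed

text \<open>A double root would be a root of the derivative. The case in view is X - h(X^p), whose
  derivative in characteristic p is exactly 1.\<close>

lemma rsquarefree_pderiv_one:
  fixes f :: "'a::field poly"
  assumes "pderiv f = 1"
  shows "rsquarefree f"
  unfolding rsquarefree_def
proof (intro conjI allI)
  show nz: "f \<noteq> 0" using assms by auto
  fix a
  have "\<not> 2 \<le> Polynomial.order a f"
  proof
    assume "2 \<le> Polynomial.order a f"
    then have "[:-a, 1:] ^ 2 dvd f" using nz order_divides by blast
    then obtain g where g: "f = [:-a, 1:] * ([:-a, 1:] * g)"
      by (metis dvdE mult.assoc power2_eq_square)
    have "poly (pderiv f) a = 0" by (simp add: g pderiv_mult del: mult_pCons_left)
    then show False using assms by simp
  qed
  then show "Polynomial.order a f = 0 \<or> Polynomial.order a f = 1" by linarith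
qed

text \<open>For algebraic \<open>y\<close> the ring K[y] is already a field; describing it by values
  of polynomials gives direct access to its elements. The second part feeds the theory of finite
  extensions.\<close>

lemma simple_extension_type:
  fixes K :: "'a::field set"
  assumes K: "is_subfield K" and "algebraic_over K y"
  shows "is_subfield {poly h y | h. h \<in> polys_over K}"
    and "ring.algebraic (ring_of_type_algebra :: 'a ring) K y"
proof -
  interpret R: field "ring_of_type_algebra :: 'a ring" by (rule field_from_type_algebra)
  have K': "subfield K (ring_of_type_algebra :: 'a ring)"
    using assms by (simp add: is_subfield_def)
  have y: "y \<in> carrier ring_of_type_algebra" by (simp add: ring_of_type_algebra_def)
  have pw: "y [^]\<^bsub>ring_of_type_algebra\<^esub> n = y ^ n" for n :: nat
    by (induction n) (auto simp: ring_of_type_algebra_def)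
  have 0: "\<zero>\<^bsub>(ring_of_type_algebra :: 'a ring)\<^esub> = 0" by (simp add: ring_of_type_algebra_def)
  \<comment> \<open>Polynomials as lists carry the leading coefficient first, whereas
    \<open>coeffs\<close> starts with the constant term; hence the reversal.\<close>
  have ev: "R.eval (rev cs) y = (\<Sum>i<length cs. cs ! i * y ^ i)" for cs
  proof (induction cs rule: rev_induct)
    case (snoc c cs)
    have "(\<Sum>i<length cs. (cs @ [c]) ! i * y ^ i) = (\<Sum>i<length cs. cs ! i * y ^ i)"
      by (intro sum.cong) (auto simp: nth_append)
    then show ?case using snoc by (simp add: pw) (simp add: ring_of_type_algebra_def)
  qed (simp add: 0)
  obtain p where p: "p \<in> polys_over K" "p \<noteq> 0" "poly p y = 0"
    using assms unfolding algebraic_over_def by blast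
  have cK: "set (Polynomial.coeffs p) \<subseteq> K"
    using p(1) by (auto simp: Polynomial.coeffs_def polys_over_def split: if_splits)
  have "rev (Polynomial.coeffs p) \<in> carrier (univ_poly ring_of_type_algebra K)"
    unfolding univ_poly_def polynomial_def
    using p(2) cK by (auto simp: hd_rev last_coeffs_eq_coeff_degree 0)
  moreover have "rev (Polynomial.coeffs p) \<noteq> []" using p(2) by simp
  moreover have "R.eval (rev (Polynomial.coeffs p)) y = \<zero>\<^bsub>ring_of_type_algebra\<^esub>"
    using p(2,3) unfolding ev 0
    by (simp add: poly_altdef length_coeffs_degree lessThan_Suc_atMost coeffs_nth)
  ultimately show "ring.algebraic (ring_of_type_algebra :: 'a ring) K y"
    using R.algebraicI by (simp add: over_def)
  then have "subfield (R.simple_extension K y) ring_of_type_algebra"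
    using R.simple_extension_is_subfield[OF K' y] by (simp add: over_def)
  moreover have "R.simple_extension K y = {poly h y | h. h \<in> polys_over K}"
  proof safe
    fix x assume "x \<in> R.simple_extension K y"
    then show "\<exists>h. x = poly h y \<and> h \<in> polys_over K"
    proof induction
      case zero
      then show ?case using polys_over_zero[OF K] 0 by (intro exI[of _ 0]) simp
    next
      case (lin k1 k2)
      then obtain h where "k1 = poly h y" "h \<in> polys_over K" by blast
      then show ?case using lin(2) polys_over_pCons[OF K]
        by (intro exI[of _ "pCons k2 h"]) (simp add: ring_of_type_algebra_def mult.commute add.commute)
    qed
  next
    fix h assume "h \<in> polys_over K"
    then show "poly h y \<in> R.simple_extension K y"
    proof (induction h)
      case 0
      then show ?case using R.simple_extension.zero[of K y] "0.prems" by (simp add: ring_of_type_algebra_def)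
    next
      case (pCons a h)
      have "a \<in> K" using polys_over_coeff[OF K pCons.prems, of 0] by simp
      moreover have "h \<in> polys_over K"
        unfolding polys_over_def using polys_over_coeff[OF K pCons.prems, of "Suc _"] by simp
      ultimately have "poly h y \<otimes>\<^bsub>ring_of_type_algebra\<^esub> y \<oplus>\<^bsub>ring_of_type_algebra\<^esub> a \<in> R.simple_extension K y"
        using pCons.IH by (intro R.simple_extension.lin) auto
      then show ?case by (simp add: ring_of_type_algebra_def mult.commute add.commute)
    qed
  qed
  ultimately show "is_subfield {poly h y | h. h \<in> polys_over K}" by (simp add: is_subfield_def)
qed

text \<open>
  Over \<open>E = K(x\<^sup>p)\<close> the minimal polynomial of \<open>x\<close> divides both \<open>(X - x)\<^sup>p\<close> and a squarefree
  polynomial, so that it is linear.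
\<close>
lemma sep_closure_power:
  fixes K :: "'a::alg_closed_field set"
  assumes K: "is_subfield K" and p: "CHAR('a) > 0" and x: "x \<in> sep_closure K"
  shows "\<exists>h\<in>polys_over K. x = poly h (x ^ CHAR('a))"
proof -
  define P where "P = CHAR('a)"
  define E where "E = {poly h (x ^ P) | h. h \<in> polys_over K}"
  obtain f where f: "f \<in> polys_over K" "rsquarefree f" "poly f x = 0" "f \<noteq> 0"
    using x by (rule sep_closureE)
  \<comment> \<open>All powers of \<open>x\<close> lie in the span of the first \<open>n\<close> of
    them, where \<open>n\<close> is the degree of the minimal polynomial; so \<open>n + 1\<close>
    powers of \<open>x ^ P\<close> must be dependent.\<close>
  have "algebraic_over K (x ^ P)"
  proof -
    obtain q where q: "is_min_poly K x q" using min_poly_exists[OF K f(1,4,3)] by blast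
    let ?n = "Polynomial.degree q"
    have q': "q \<in> polys_over K" "q \<noteq> 0" "poly q x = 0" using q by (auto simp: is_min_poly_def)
    have span: "x ^ j \<in> lin_span K ?n (\<lambda>i. x ^ i)" for j
    proof -
      have "Polynomial.monom 1 j \<in> polys_over K"
        by (intro polys_over_monom[OF K] subfield_one[OF K])
      then obtain d r where r: "r \<in> polys_over K" "Polynomial.monom 1 j = q * d + r"
        "r = 0 \<or> Polynomial.degree r < Polynomial.degree q"
        using polys_over_division[OF K _ q'(1,2)] by blast
      have "x ^ j = poly (q * d + r) x" by (simp flip: r(2) add: poly_monom)
      then have "x ^ j = poly r x" using q'(3) by simp
      moreover have "poly r x = (\<Sum>i<?n. Polynomial.coeff r i * x ^ i)"
      proof (cases "r = 0")
        case False
        then show ?thesis unfolding poly_altdef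
          by (intro sum.mono_neutral_left) (use r(3) in \<open>auto simp: coeff_eq_0\<close>)
      qed simp
      ultimately show ?thesis using r(1) by (intro lin_spanI[OF K]) (auto simp: polys_over_def)
    qed
    have "\<not> lin_indep K (Suc ?n) (\<lambda>i. (x ^ P) ^ i)"
    proof
      assume I: "lin_indep K (Suc ?n) (\<lambda>i. (x ^ P) ^ i)"
      have "Suc ?n \<le> ?n"
        by (rule lin_indep_le[OF K I, of ?n "\<lambda>i. x ^ i"]) (simp add: span flip: power_mult)
      then show False by simp
    qed
    then obtain c i where c: "\<forall>i<Suc ?n. c i \<in> K" "(\<Sum>i<Suc ?n. c i * (x ^ P) ^ i) = 0"
      "i < Suc ?n" "c i \<noteq> 0" unfolding lin_indep_def by blast
    define g where "g = (\<Sum>i<Suc ?n. Polynomial.monom (c i) i)"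
    have "Polynomial.coeff g i = c i" using c(3) by (simp add: g_def coeff_sum del: sum.lessThan_Suc)
    then have "g \<noteq> 0" using c(4) by auto
    moreover have "g \<in> polys_over K"
      unfolding g_def using c(1) by (intro polys_over_sum[OF K] polys_over_monom[OF K]) auto
    moreover have "poly g (x ^ P) = 0" using c(2)
      by (simp add: g_def poly_sum poly_monom del: sum.lessThan_Suc)
    ultimately show ?thesis unfolding algebraic_over_def by blast
  qed
  then have E: "is_subfield E" unfolding E_def by (rule simple_extension_type(1)[OF K])
  have KE: "K \<subseteq> E"
  proof
    fix k assume "k \<in> K"
    then have "[:k:] \<in> polys_over K" by (intro polys_over_pCons[OF K] polys_over_zero[OF K])
    then show "k \<in> E" unfolding E_def by (intro CollectI exI[of _ "[:k:]"]) simp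
  qed
  have xE: "x ^ P \<in> E" unfolding E_def
    by (intro CollectI exI[of _ "Polynomial.monom 1 1"])
       (auto simp: poly_monom intro: polys_over_monom[OF K] subfield_one[OF K])
  have fE: "f \<in> polys_over E" using f(1) KE by (auto simp: polys_over_def)
  obtain q where q: "is_min_poly E x q" using min_poly_exists[OF E fE f(4,3)] by blast
  have qf: "q dvd f" using min_poly_dvd[OF E q fE f(3)] .
  have pP: "Factorial_Ring.prime CHAR('a poly)" using prime_CHAR_semidom[OF p] by simp
  have PP: "P = CHAR('a poly)" by (simp add: P_def)
  have "P > 0" using p by (simp add: P_def)
  let ?g = "Polynomial.monom 1 P - [:x ^ P:]"
  \<comment> \<open>Additivity of Frobenius for polynomials identifies (X - x)^p with X^p - x^p,
    which has its coefficients in \<open>E\<close>.\<close>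
  have "[:0, 1:] ^ P = ([:-x, 1:] + [:x:]) ^ P" by simp
  also have "\<dots> = [:-x, 1:] ^ P + [:x:] ^ P" by (rule freshmans_dream[OF pP PP])
  finally have g: "[:-x, 1:] ^ P = ?g"
    by (simp add: monom_altdef poly_const_pow algebra_simps)
  have "?g \<in> polys_over E"
    by (intro polys_over_diff[OF E] polys_over_monom[OF E] polys_over_pCons[OF E] polys_over_zero[OF E] xE subfield_one[OF E])
  then have qg: "q dvd [:-x, 1:] ^ P"
    unfolding g by (intro min_poly_dvd[OF E q]) (simp_all add: poly_monom)
  have q': "q \<in> polys_over E" "Polynomial.lead_coeff q = 1" "q \<noteq> 0" "poly q x = 0"
    using q by (auto simp: is_min_poly_def)
  obtain r where r: "q = [:-x, 1:] * r" using q'(4) unfolding poly_eq_0_iff_dvd by (rule dvdE)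
  \<comment> \<open>A root of \<open>r\<close> is a root of (X - x)^p, hence equal to
    \<open>x\<close>; then \<open>x\<close> would be a double root of \<open>q\<close> and of
    \<open>f\<close>.\<close>
  have dr: "Polynomial.degree r = 0"
  proof (rule ccontr)
    assume "Polynomial.degree r \<noteq> 0"
    then obtain y where y: "poly r y = 0" using alg_closed_imp_poly_has_root by blast
    moreover have "r dvd [:-x, 1:] ^ P" using qg unfolding r by (rule dvd_mult_right)
    ultimately have "poly ([:-x, 1:] ^ P) y = 0" unfolding poly_eq_0_iff_dvd by (rule dvd_trans)
    then have "y = x" by simp
    then obtain s where "r = [:-x, 1:] * s" using y unfolding poly_eq_0_iff_dvd by (auto elim: dvdE)
    then have "q = [:-x, 1:] ^ 2 * s" using r by (simp add: power2_eq_square mult.assoc del: mult_pCons_left)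
    then have "[:-x, 1:] ^ 2 dvd f" using qf dvd_mult_left by blast
    then have "2 \<le> Polynomial.order x f" using f(4) order_divides by blast
    moreover have "Polynomial.order x f = 0 \<or> Polynomial.order x f = 1"
      using f(2) unfolding rsquarefree_def by blast
    ultimately show False by linarith
  qed
  then obtain c where c: "r = [:c:]" using degree_eq_zeroE by blast
  have "c = 1" using q'(2) r c by (simp split: if_splits)
  then have "Polynomial.coeff q 0 = - x" using r c by simp
  then have "x \<in> E" using polys_over_coeff[OF E q'(1), of 0] subfield_uminus[OF E, of "- x"] by simp
  then show ?thesis unfolding E_def P_def by blast
qed

text \<open>The polynomial X - h(X^p) vanishes at \<open>x\<close> and has derivative 1. Together
  with \<open>sep_closure_power\<close> this makes x in K[x^p] a criterion for separability that is
  a single identity.\<close>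

lemma sep_closure_powerI:
  fixes K :: "'a::alg_closed_field set"
  assumes K: "is_subfield K" and p: "CHAR('a) > 0" and h: "h \<in> polys_over K" "x = poly h (x ^ CHAR('a))"
  shows "x \<in> sep_closure K"
proof (rule sep_closureI[OF K])
  let ?m = "Polynomial.monom 1 CHAR('a) :: 'a poly"
  let ?f = "[:0, 1:] - pcompose h ?m"
  show "?f \<in> polys_over K"
    by (intro polys_over_diff[OF K] polys_over_pcompose[OF K] polys_over_monom[OF K] polys_over_pCons[OF K]
        polys_over_zero[OF K] subfield_closed[OF K] h(1))
  show "rsquarefree ?f"
    by (rule rsquarefree_pderiv_one)
       (simp add: pderiv_diff pderiv_pcompose pderiv_monom pderiv_pCons one_pCons)
  show "poly ?f x = 0" using h(2) by (simp add: poly_pcompose poly_monom)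
qed

text \<open>The final clause is minimality among subrings rather than subfields: it will be applied
  to a span of p-th powers, for which only the ring operations are checked.\<close>

lemma fin_ext_adjoin:
  fixes K :: "'a::field set"
  assumes K: "is_subfield K" and "finite S" "\<And>x. x \<in> S \<Longrightarrow> algebraic_over K x"
  shows "\<exists>L. fin_ext K L \<and> S \<subseteq> L \<and>
     (\<forall>M. 1 \<in> M \<and> (\<forall>x\<in>M. \<forall>y\<in>M. x - y \<in> M \<and> x * y \<in> M) \<and> K \<subseteq> M \<and> S \<subseteq> M \<longrightarrow> L \<subseteq> M)"
proof -
  interpret R: field "ring_of_type_algebra :: 'a ring" by (rule field_from_type_algebra)
  have K': "subfield K (ring_of_type_algebra :: 'a ring)"
    using assms by (simp add: is_subfield_def)
  have U: "Z \<subseteq> carrier (ring_of_type_algebra :: 'a ring)" for Z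
    by (simp add: ring_of_type_algebra_def)
  obtain xs where xs: "set xs = S" using finite_list[OF assms(2)] by blast
  let ?L = "R.finite_extension K xs"
  have alg: "x \<in> set xs \<Longrightarrow> (R.algebraic over K) x" for x
    unfolding over_def using simple_extension_type(2)[OF K assms(3)] xs by blast
  show ?thesis
  proof (intro exI[of _ ?L] conjI allI impI)
    show "fin_ext K ?L"
      unfolding fin_ext_def is_subfield_def
    proof (intro conjI)
      show "subfield ?L ring_of_type_algebra"
        by (rule R.finite_extension_is_subfield[OF K' U alg])
      show "K \<subseteq> ?L" by (rule R.finite_extension_incl[OF U U])
      show "R.finite_dimension K ?L"
        by (rule R.finite_extension_finite_dimension(1)[OF K' U alg])
    qed
    show "S \<subseteq> ?L" using R.finite_extension_mem[OF subfieldE(1)[OF K'] U, of xs] xs by simp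
  next
    fix M assume M: "1 \<in> M \<and> (\<forall>x\<in>M. \<forall>y\<in>M. x - y \<in> M \<and> x * y \<in> M) \<and> K \<subseteq> M \<and> S \<subseteq> M"
    then have "subring M (ring_of_type_algebra :: 'a ring)" by (simp add: subring_type_iff)
    then show "?L \<subseteq> M" by (rule R.finite_extension_subring_incl) (use M xs in auto)
  qed
qed

section \<open>Finite extensions generated by separable elements\<close>

context
  fixes K :: "'a::alg_closed_field set"
  assumes K: "is_subfield K" and char: "CHAR('a) > 0"
begin

text \<open>
  If \<open>K \<cdot> L\<^sup>p = L\<close>, then taking \<open>p\<close>-th powers preserves linear independence in \<open>L\<close> over \<open>K\<close>; so
  \<open>K[x\<^sup>p]\<close> has the same dimension as \<open>K[x]\<close>, for every \<open>x \<in> L\<close>.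
\<close>
lemma sep_closure_of_power_span:
  assumes L: "fin_ext K L" and span: "lin_indep K n v" "lin_span K n v = L"
    and pow: "lin_span K n (\<lambda>i. v i ^ CHAR('a)) = L" and x: "x \<in> L"
  shows "x \<in> sep_closure K"
proof -
  define p where "p = CHAR('a)"
  have sL: "is_subfield L" using L by (simp add: fin_ext_def)
  have pp: "Factorial_Ring.prime CHAR('a)" using prime_CHAR_semidom char by blast
  have sum_pow: "(\<Sum>i\<in>I. f i :: 'a) ^ p = (\<Sum>i\<in>I. f i ^ p)" for f and I :: "nat set"
    unfolding p_def by (rule freshmans_dream_sum[OF pp refl])
  \<comment> \<open>Extend \<open>u\<close> to a basis of \<open>L\<close>. Its p-th powers still
    span \<open>L\<close>, because Frobenius is additive and each \<open>v i ^ p\<close> is a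
    combination of them; a spanning family of the size of a basis is independent.\<close>
  have indep_pow: "lin_indep K m (\<lambda>i. u i ^ p)"
    if u: "lin_indep K m u" "\<And>i. i < m \<Longrightarrow> u i \<in> L" for m u
  proof -
    obtain n' u' where u': "lin_indep K n' u'" "lin_span K n' u' = L" "m \<le> n'" "\<forall>i<m. u' i = u i"
      using fin_ext_basis_extend[OF K L u] by blast
    have vu: "v i \<in> lin_span K n' u'" if "i < n" for i
      using lin_span_base[OF K that, of v] span(2) u'(2) by simp
    have "lin_span K n' (\<lambda>i. u' i ^ p) = L"
    proof
      show "lin_span K n' (\<lambda>i. u' i ^ p) \<subseteq> L"
      proof
        fix y assume "y \<in> lin_span K n' (\<lambda>i. u' i ^ p)"
        then obtain c where c: "y = (\<Sum>i<n'. c i * u' i ^ p)" "\<forall>i<n'. c i \<in> K"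
          unfolding lin_span_def by blast
        have "u' i \<in> L" if "i < n'" for i using lin_span_base[OF K that, of u'] u'(2) by simp
        then show "y \<in> L" using c L unfolding c(1)
          by (intro subfield_sum[OF sL] subfield_mult[OF sL] subfield_power[OF sL]) (auto simp: fin_ext_def)
      qed
      show "L \<subseteq> lin_span K n' (\<lambda>i. u' i ^ p)"
      proof
        fix y assume "y \<in> L"
        then obtain c where c: "y = (\<Sum>i<n. c i * v i ^ p)" "\<forall>i<n. c i \<in> K"
          using pow unfolding lin_span_def p_def by blast
        have "v i ^ p \<in> lin_span K n' (\<lambda>i. u' i ^ p)" if i: "i < n" for i
        proof -
          obtain d where d: "v i = (\<Sum>j<n'. d j * u' j)" "\<forall>j<n'. d j \<in> K"
            using vu[OF i] unfolding lin_span_def by blast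
          have "v i ^ p = (\<Sum>j<n'. d j ^ p * u' j ^ p)"
            unfolding d(1) sum_pow by (simp add: power_mult_distrib)
          then show ?thesis by (rule lin_spanI[OF K]) (use d(2) in \<open>auto intro: subfield_power[OF K]\<close>)
        qed
        then show "y \<in> lin_span K n' (\<lambda>i. u' i ^ p)"
          unfolding c(1) using c(2) by (intro lin_span_sum[OF K] lin_span_smult[OF K]) auto
      qed
    qed
    then have "lin_indep K n' (\<lambda>i. u' i ^ p)" using lin_span_indep[OF K u'(1)] u'(2) by simp
    then have "lin_indep K m (\<lambda>i. u' i ^ p)" using lin_indep_mono u'(3) K by blast
    then show ?thesis using u'(4) unfolding lin_indep_def by simp
  qed
  have le: "m \<le> n" if "lin_indep K m (\<lambda>i. x ^ i)" for m
    using lin_indep_le[OF K that, of n v] span(2) subfield_power[OF sL x] by simp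
  \<comment> \<open>This is the degree of \<open>x\<close> over \<open>K\<close>; the maximum exists
    because independent families in \<open>L\<close> have at most \<open>n\<close> members.\<close>
  define m where "m = (GREATEST m. lin_indep K m (\<lambda>i. x ^ i))"
  have "lin_indep K 0 (\<lambda>i. x ^ i)" by (simp add: lin_indep_def)
  then have m: "lin_indep K m (\<lambda>i. x ^ i)" unfolding m_def
    by (rule GreatestI_nat) (use le in blast)
  have m': "\<not> lin_indep K (Suc m) (\<lambda>i. x ^ i)"
    using Greatest_le_nat[of "\<lambda>m. lin_indep K m (\<lambda>i. x ^ i)" "Suc m" n] le unfolding m_def by fastforce
  then obtain c i0 where c: "\<forall>i<Suc m. c i \<in> K" "(\<Sum>i<Suc m. c i * x ^ i) = 0" "i0 < Suc m" "c i0 \<noteq> 0"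
    unfolding lin_indep_def by blast
  have cm: "c m \<noteq> 0"
  proof
    assume "c m = 0"
    then have "(\<Sum>i<m. c i * x ^ i) = 0" using c(2) by simp
    then have "\<forall>i<m. c i = 0" using m c(1) unfolding lin_indep_def by simp
    then show False using c(3,4) \<open>c m = 0\<close> less_Suc_eq by auto
  qed
  let ?W = "lin_span K m (\<lambda>i. x ^ i)"
  have "x ^ m = (\<Sum>i<m. (- c i / c m) * x ^ i)"
  proof -
    have "c m * x ^ m = - (\<Sum>i<m. c i * x ^ i)" using c(2) by (simp add: add_eq_0_iff)
    then have "x ^ m = (- (\<Sum>i<m. c i * x ^ i)) / c m" using cm by (simp add: field_simps)
    also have "\<dots> = (\<Sum>i<m. (- c i / c m) * x ^ i)"
      by (simp add: sum_divide_distrib sum_negf)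
    finally show ?thesis .
  qed
  then have xm: "x ^ m \<in> ?W"
    by (rule lin_spanI[OF K]) (use c(1) in \<open>auto intro!: subfield_closed[OF K]\<close>)
  have xW: "x * y \<in> ?W" if "y \<in> ?W" for y
  proof -
    obtain d where d: "y = (\<Sum>i<m. d i * x ^ i)" "\<forall>i<m. d i \<in> K"
      using \<open>y \<in> ?W\<close> unfolding lin_span_def by blast
    have "x * y = (\<Sum>i<m. d i * x ^ Suc i)" unfolding d(1) by (simp add: sum_distrib_left mult_ac)
    also have "\<dots> \<in> ?W"
    proof (intro lin_span_sum[OF K] lin_span_smult[OF K])
      fix i assume i: "i \<in> {..<m}"
      then show "d i \<in> K" using d(2) by simp
      show "x ^ Suc i \<in> ?W"
        by (cases "Suc i = m") (use i xm lin_span_base[OF K, of "Suc i" m "\<lambda>i. x ^ i"] in auto)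
    qed
    finally show ?thesis .
  qed
  have m0: "m > 0"
  proof (rule ccontr)
    assume "\<not> m > 0"
    then show False using xm by (simp add: lin_span_def)
  qed
  have Wx: "x ^ j \<in> ?W" for j
  proof (induction j)
    case 0
    then show ?case using lin_span_base[OF K m0, of "\<lambda>i. x ^ i"] by simp
  next
    case (Suc j)
    then show ?case using xW by simp
  qed
  have "lin_indep K m (\<lambda>i. (x ^ i) ^ p)"
    by (rule indep_pow[OF m]) (simp add: subfield_power[OF sL x])
  then have "lin_span K m (\<lambda>i. (x ^ i) ^ p) = ?W"
    by (rule lin_indep_span[OF K _ _ m]) (use Wx in \<open>simp flip: power_mult\<close>)
  then have "x \<in> lin_span K m (\<lambda>i. (x ^ i) ^ p)" using Wx[of 1] by simp
  then obtain d where d: "x = (\<Sum>i<m. d i * (x ^ i) ^ p)" "\<forall>i<m. d i \<in> K"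
    unfolding lin_span_def by blast
  have e: "(x ^ i) ^ p = (x ^ p) ^ i" for i
    unfolding power_mult[symmetric] by (simp add: mult.commute)
  show ?thesis
  proof (rule sep_closure_powerI[OF K char])
    show "(\<Sum>i<m. Polynomial.monom (d i) i) \<in> polys_over K"
      using d(2) by (intro polys_over_sum[OF K] polys_over_monom[OF K]) auto
    show "x = poly (\<Sum>i<m. Polynomial.monom (d i) i) (x ^ CHAR('a))"
      using d(1) unfolding e by (simp add: poly_sum poly_monom flip: p_def)
  qed
qed

text \<open>Let \<open>L\<close> be generated by \<open>S\<close>, and \<open>?N\<close> the
  \<open>K\<close>-span of the p-th powers of \<open>L\<close>. It is a ring containing
  \<open>K\<close>, and it contains \<open>S\<close> since every x in \<open>S\<close> is a
  polynomial over \<open>K\<close> in x^p. Minimality gives \<open>?N = L\<close>, the situation of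
  \<open>sep_closure_of_power_span\<close>.\<close>

lemma fin_sep_ext_adjoin:
  assumes S: "finite S" "S \<subseteq> sep_closure K"
  shows "\<exists>L. fin_sep_ext K L \<and> S \<subseteq> L"
proof -
  define p where "p = CHAR('a)"
  have pp: "Factorial_Ring.prime CHAR('a)" using prime_CHAR_semidom char by blast
  have alg: "algebraic_over K x" if "x \<in> S" for x
  proof -
    have "x \<in> sep_closure K" using that S by blast
    then show ?thesis unfolding algebraic_over_def by (rule sep_closureE) blast
  qed
  have "\<exists>L. fin_ext K L \<and> S \<subseteq> L \<and>
     (\<forall>M. 1 \<in> M \<and> (\<forall>x\<in>M. \<forall>y\<in>M. x - y \<in> M \<and> x * y \<in> M) \<and> K \<subseteq> M \<and> S \<subseteq> M \<longrightarrow> L \<subseteq> M)"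
    by (rule fin_ext_adjoin[OF K S(1) alg])
  then obtain L where L: "fin_ext K L" "S \<subseteq> L" and
    L': "\<forall>M. 1 \<in> M \<and> (\<forall>x\<in>M. \<forall>y\<in>M. x - y \<in> M \<and> x * y \<in> M) \<and> K \<subseteq> M \<and> S \<subseteq> M \<longrightarrow> L \<subseteq> M"
    by (elim exE conjE)
  have sL: "is_subfield L" and KL: "K \<subseteq> L" using L(1) by (auto simp: fin_ext_def)
  obtain n v where v: "lin_indep K n v" "lin_span K n v = L" using fin_ext_basis[OF K L(1)] by blast
  let ?N = "lin_span K n (\<lambda>i. v i ^ p)"
  have vL: "v i \<in> L" if "i < n" for i using lin_span_base[OF K that, of v] v(2) by simp
  have powN: "y ^ p \<in> ?N" if y: "y \<in> L" for y
  proof -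
    obtain c where c: "y = (\<Sum>i<n. c i * v i)" "\<forall>i<n. c i \<in> K"
      using y v(2) unfolding lin_span_def by blast
    have "y ^ p = (\<Sum>i<n. c i ^ p * v i ^ p)"
      unfolding c(1) p_def freshmans_dream_sum[OF pp refl] by (simp add: power_mult_distrib)
    then show ?thesis by (rule lin_spanI[OF K]) (use c(2) in \<open>auto intro: subfield_power[OF K]\<close>)
  qed
  have powN': "s * y ^ p \<in> ?N" if s: "s \<in> ?N" and y: "y \<in> L" for s y
  proof -
    obtain c where c: "s = (\<Sum>i<n. c i * v i ^ p)" "\<forall>i<n. c i \<in> K"
      using s unfolding lin_span_def by blast
    have "s * y ^ p = (\<Sum>i<n. c i * (v i * y) ^ p)"
      unfolding c(1) sum_distrib_right by (simp add: power_mult_distrib mult_ac)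
    then show ?thesis
      using c(2) vL y subfield_mult[OF sL]
      by (auto intro!: lin_span_sum[OF K] lin_span_smult[OF K] powN)
  qed
  have mulN: "s * t \<in> ?N" if s: "s \<in> ?N" and t: "t \<in> ?N" for s t
  proof -
    obtain c where c: "t = (\<Sum>i<n. c i * v i ^ p)" "\<forall>i<n. c i \<in> K"
      using t unfolding lin_span_def by blast
    have "s * t = (\<Sum>i<n. c i * (s * v i ^ p))"
      unfolding c(1) sum_distrib_left by (simp add: mult_ac)
    then show ?thesis
      using c(2) vL s by (auto intro!: lin_span_sum[OF K] lin_span_smult[OF K] powN')
  qed
  have "1 \<in> ?N" using powN[OF subfield_one[OF sL]] by simp
  then have KN: "K \<subseteq> ?N" using lin_span_smult[OF K, of 1 n "\<lambda>i. v i ^ p"] by auto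
  have "S \<subseteq> ?N"
  proof
    fix x assume x: "x \<in> S"
    then obtain h where h: "h \<in> polys_over K" "x = poly h (x ^ p)"
      using sep_closure_power[OF K char] S(2) unfolding p_def by blast
    have "poly h (x ^ p) = (\<Sum>i\<le>Polynomial.degree h. Polynomial.coeff h i * (x ^ i) ^ p)"
      by (simp add: poly_altdef mult.commute flip: power_mult)
    also have "\<dots> \<in> ?N"
      using x L(2) polys_over_coeff[OF K h(1)] subfield_power[OF sL]
      by (intro lin_span_sum[OF K] lin_span_smult[OF K] powN) auto
    finally show "x \<in> ?N" using h(2) by simp
  qed
  then have "L \<subseteq> ?N"
    using KN \<open>1 \<in> ?N\<close> mulN lin_span_diff[OF K] by (intro L'[rule_format]) auto
  moreover have "?N \<subseteq> L"
  proof
    fix y assume "y \<in> ?N"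
    then obtain c where c: "y = (\<Sum>i<n. c i * v i ^ p)" "\<forall>i<n. c i \<in> K"
      unfolding lin_span_def by blast
    show "y \<in> L" unfolding c(1) using c(2) KL vL
      by (intro subfield_sum[OF sL] subfield_mult[OF sL] subfield_power[OF sL]) auto
  qed
  ultimately have "?N = L" by simp
  then have "L \<subseteq> sep_closure K"
    using sep_closure_of_power_span[OF L(1) v] unfolding p_def by blast
  then show ?thesis using L(1,2) unfolding fin_sep_ext_def by blast
qed

text \<open>Two separable elements lie in one finite separable extension, so closure of
  \<open>sep_closure K\<close> under the operations comes out as a consequence.\<close>

lemma sep_closure_add: "x \<in> sep_closure K \<Longrightarrow> y \<in> sep_closure K \<Longrightarrow> x + y \<in> sep_closure K"
  and sep_closure_mult: "x \<in> sep_closure K \<Longrightarrow> y \<in> sep_closure K \<Longrightarrow> x * y \<in> sep_closure K"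
proof -
  assume "x \<in> sep_closure K" "y \<in> sep_closure K"
  then have "\<exists>L. fin_sep_ext K L \<and> {x, y} \<subseteq> L" by (intro fin_sep_ext_adjoin) simp_all
  then obtain L where L: "is_subfield L" "L \<subseteq> sep_closure K" "x \<in> L" "y \<in> L"
    unfolding fin_sep_ext_def fin_ext_def by (elim exE conjE) simp
  show "x + y \<in> sep_closure K" using subfield_add[OF L(1,3,4)] L(2) by (rule subsetD[rotated])
  show "x * y \<in> sep_closure K" using subfield_mult[OF L(1,3,4)] L(2) by (rule subsetD[rotated])
qed

lemma subset_sep_closure: "K \<subseteq> sep_closure K"
proof -
  have "\<exists>L. fin_sep_ext K L \<and> {} \<subseteq> L" by (intro fin_sep_ext_adjoin) simp_all
  then show ?thesis unfolding fin_sep_ext_def fin_ext_def by (elim exE conjE) (rule subset_trans)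
qed

end

text \<open>Each member v of a basis of \<open>F\<close> satisfies v = h(v^p) over \<open>K\<close>;
  applying \<open>\<theta>\<close> to the coefficients of h gives the same kind of identity for
  \<open>\<theta> v\<close> over \<open>K'\<close>. It serves for the q-th root map and, with
  \<open>\<theta>\<close> the identity, for enlarging the base field.\<close>

lemma fin_sep_ext_transfer:
  fixes K K' :: "'a::alg_closed_field set"
  assumes K: "is_subfield K" and K': "is_subfield K'" and char: "CHAR('a) > 0"
    and hom: "\<And>x y. \<theta> (x + y) = \<theta> x + \<theta> y" "\<And>x y. \<theta> (x * y) = \<theta> x * \<theta> y" "\<theta> 1 = 1"
    and KK': "\<theta> ` K \<subseteq> K'" and F: "fin_sep_ext K F"
  shows "\<exists>F'. fin_sep_ext K' F' \<and> \<theta> ` F \<subseteq> F'"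
proof -
  have h0: "\<theta> 0 = 0" using hom(1)[of 0 0] by (metis add_cancel_right_right add.right_neutral)
  have hsum: "\<theta> (sum f I) = (\<Sum>i\<in>I. \<theta> (f i))" for f and I :: "nat set"
    by (induction I rule: infinite_finite_induct) (auto simp: h0 hom)
  have hpow: "\<theta> (x ^ k) = \<theta> x ^ k" for x k by (induction k) (auto simp: hom)
  have FK: "fin_ext K F" "F \<subseteq> sep_closure K" using F by (auto simp: fin_sep_ext_def)
  obtain n v where v: "lin_span K n v = F" using fin_ext_basis[OF K FK(1)] by blast
  have "\<theta> ` v ` {..<n} \<subseteq> sep_closure K'"
  proof safe
    fix i assume "i < n"
    then have "v i \<in> sep_closure K" using lin_span_base[OF K, of i n v] v FK(2) by auto
    then obtain h where h: "h \<in> polys_over K" "v i = poly h (v i ^ CHAR('a))"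
      using sep_closure_power[OF K char] by blast
    have "\<theta> (v i) = \<theta> (\<Sum>j\<le>Polynomial.degree h. Polynomial.coeff h j * (v i ^ CHAR('a)) ^ j)"
      using h(2) by (simp add: poly_altdef)
    also have "\<dots> = poly (\<Sum>j\<le>Polynomial.degree h. Polynomial.monom (\<theta> (Polynomial.coeff h j)) j) (\<theta> (v i) ^ CHAR('a))"
      unfolding hsum by (simp add: poly_sum poly_monom hom hpow)
    finally show "\<theta> (v i) \<in> sep_closure K'"
      by (rule sep_closure_powerI[OF K' char, rotated])
         (use KK' polys_over_coeff[OF K h(1)] in \<open>auto intro!: polys_over_sum[OF K'] polys_over_monom[OF K']\<close>)
  qed
  then obtain F' where F': "fin_sep_ext K' F'" "\<theta> ` v ` {..<n} \<subseteq> F'"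
    using fin_sep_ext_adjoin[OF K' char, of "\<theta> ` v ` {..<n}"] by auto
  then have s: "is_subfield F'" "K' \<subseteq> F'" by (auto simp: fin_sep_ext_def fin_ext_def)
  have "\<theta> y \<in> F'" if y: "y \<in> F" for y
  proof -
    obtain c where c: "y = (\<Sum>i<n. c i * v i)" "\<forall>i<n. c i \<in> K" using y v unfolding lin_span_def by blast
    show ?thesis unfolding c(1) hsum hom
      using c(2) F'(2) KK' s by (intro subfield_sum[OF s(1)] subfield_mult[OF s(1)]) auto
  qed
  then show ?thesis using F'(1) by blast
qed

section \<open>Galois groups\<close>

lemma Hom_overD:
  assumes "\<phi> \<in> Hom_over K L"
  shows "x \<in> L \<Longrightarrow> y \<in> L \<Longrightarrow> \<phi> (x + y) = \<phi> x + \<phi> y"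
    and "x \<in> L \<Longrightarrow> y \<in> L \<Longrightarrow> \<phi> (x * y) = \<phi> x * \<phi> y"
    and "x \<in> K \<Longrightarrow> \<phi> x = x"
  using assms by (auto simp: Hom_over_def)

lemma Hom_over_restrict: "\<phi> \<in> Hom_over K M \<Longrightarrow> L \<subseteq> M \<Longrightarrow> K' \<subseteq> K \<Longrightarrow> K' \<subseteq> L \<Longrightarrow>
    (\<And>x y. x \<in> L \<Longrightarrow> y \<in> L \<Longrightarrow> x + y \<in> L \<and> x * y \<in> L) \<Longrightarrow> restrict \<phi> L \<in> Hom_over K' L"
  unfolding Hom_over_def by (simp add: subset_eq)

lemma carrier_Gal: "carrier (Gal K) = Hom_over K (sep_closure K) \<inter> Bij (sep_closure K)"
  by (simp add: Gal_def)

text \<open>\<open>\<sigma>\<close> fixes the coefficients of a polynomial over \<open>K\<close> and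
  so permutes its roots: it maps the separable closure into itself, and onto itself because an
  injective self-map of a finite root set is surjective.\<close>

lemma gal_restrict_carrier:
  fixes K K' :: "'a::alg_closed_field set"
  assumes K: "is_subfield K" and K': "is_subfield K'" "K \<subseteq> K'" and char: "CHAR('a) > 0"
    and \<sigma>: "\<sigma> \<in> carrier (Gal K')"
  shows "gal_restrict K \<sigma> \<in> carrier (Gal K)"
proof -
  let ?S = "sep_closure K" and ?S' = "sep_closure K'"
  have SS: "?S \<subseteq> ?S'" using sep_closure_mono[OF K'] .
  have h: "\<sigma> \<in> Hom_over K' ?S'" and b: "bij_betw \<sigma> ?S' ?S'" using \<sigma> by (auto simp: carrier_Gal Bij_def)
  note hD = Hom_overD[OF h]
  have S0: "?S' \<supseteq> K'" by (rule subset_sep_closure[OF K'(1) char])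
  have root: "poly f (\<sigma> x) = 0" if f: "f \<in> polys_over K" "poly f x = 0" and x: "x \<in> ?S'" for f x
  proof -
    have "poly f x \<in> ?S' \<and> \<sigma> (poly f x) = poly f (\<sigma> x)"
      using f(1)
    proof (induction f)
      case 0
      have "0 \<in> ?S'" "\<sigma> 0 = 0" using subfield_zero[OF K'(1)] S0 hD(3)[of 0] by blast+
      then show ?case by simp
    next
      case (pCons a f)
      have a: "a \<in> K'" using polys_over_coeff[OF K pCons.prems, of 0] K'(2) by auto
      have "f \<in> polys_over K"
        unfolding polys_over_def using polys_over_coeff[OF K pCons.prems, of "Suc _"] by simp
      then have IH: "poly f x \<in> ?S'" "\<sigma> (poly f x) = poly f (\<sigma> x)" using pCons.IH by auto
      have "x * poly f x \<in> ?S'" using IH x sep_closure_mult[OF K'(1) char] by blast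
      moreover have a': "a \<in> ?S'" using a S0 by blast
      ultimately have "\<sigma> (a + x * poly f x) = \<sigma> a + \<sigma> x * \<sigma> (poly f x)" "a + x * poly f x \<in> ?S'"
        using hD(1)[of a "x * poly f x"] hD(2)[OF x IH(1)] sep_closure_add[OF K'(1) char a'] by auto
      then show ?case using hD(3)[OF a] IH(2) by simp
    qed
    then show ?thesis using f(2) hD(3)[OF subfield_zero[OF K'(1)]] by simp
  qed
  have in_S: "\<sigma> x \<in> ?S" if x: "x \<in> ?S" for x
  proof -
    obtain f where f: "f \<in> polys_over K" "rsquarefree f" "poly f x = 0"
      using x by (rule sep_closureE)
    moreover have "x \<in> ?S'" using x SS by blast
    ultimately have "poly f (\<sigma> x) = 0" using root by blast
    then show ?thesis by (rule sep_closureI[OF K f(1,2)])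
  qed
  have "y \<in> \<sigma> ` ?S" if y: "y \<in> ?S" for y
  proof -
    obtain f where f: "f \<in> polys_over K" "rsquarefree f" "poly f y = 0" "f \<noteq> 0"
      using y by (rule sep_closureE)
    let ?R = "{x. poly f x = 0}"
    have RS: "?R \<subseteq> ?S" using sep_closureI[OF K f(1,2)] by blast
    have "finite ?R" using f(4) poly_roots_finite by blast
    moreover have "\<sigma> ` ?R \<subseteq> ?R" using root[OF f(1)] RS SS by blast
    moreover have "inj_on \<sigma> ?R" using b RS SS by (meson bij_betw_imp_inj_on inj_on_subset)
    ultimately have "\<sigma> ` ?R = ?R" using endo_inj_surj by blast
    then show ?thesis using f(3) RS by blast
  qed
  then have "\<sigma> ` ?S = ?S" using in_S by blast
  moreover have "inj_on \<sigma> ?S" using bij_betw_imp_inj_on[OF b] SS by (rule inj_on_subset)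
  ultimately have "bij_betw (restrict \<sigma> ?S) ?S ?S" by (simp add: bij_betw_def)
  then have "restrict \<sigma> ?S \<in> Bij ?S" unfolding Bij_def by simp
  moreover have "restrict \<sigma> ?S \<in> Hom_over K ?S"
    by (rule Hom_over_restrict[OF h SS K'(2) subset_sep_closure[OF K char]])
       (simp add: sep_closure_add[OF K char] sep_closure_mult[OF K char])
  ultimately show ?thesis by (simp add: carrier_Gal gal_restrict_def)
qed

text \<open>A basic open set of a product of discrete spaces constrains only finitely many values.
  If \<open>\<tau>\<close> were outside the closed set \<open>G\<close>, it would have such a
  neighbourhood disjoint from \<open>G\<close>, yet an element of \<open>G\<close> agrees with
  \<open>\<tau>\<close> at all constrained places.\<close>

lemma closed_normal_dense:
  assumes G: "closed_normal K G" and \<tau>: "\<tau> \<in> carrier (Gal K)"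
    and dense: "\<And>S. finite S \<Longrightarrow> S \<subseteq> sep_closure K \<Longrightarrow> \<exists>\<rho>\<in>G. \<forall>x\<in>S. \<rho> x = \<tau> x"
  shows "\<tau> \<in> G"
proof (rule ccontr)
  assume "\<tau> \<notin> G"
  let ?S = "sep_closure K" and ?T = "krull_topology K"
  let ?P = "product_topology (\<lambda>_. discrete_topology (sep_closure K)) (sep_closure K)"
  have car: "carrier (Gal K) \<subseteq> ?S \<rightarrow>\<^sub>E ?S"
  proof
    fix x assume "x \<in> carrier (Gal K)"
    then have "x \<in> Bij ?S" unfolding carrier_Gal by (rule IntD2)
    then have "x \<in> extensional ?S" "bij_betw x ?S ?S" unfolding Bij_def by simp_all
    then show "x \<in> ?S \<rightarrow>\<^sub>E ?S" unfolding PiE_def using bij_betw_apply by fastforce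
  qed
  have ts: "topspace ?T = carrier (Gal K)"
    unfolding krull_topology_def using car by (auto simp: topspace_product_topology)
  have GC: "G \<subseteq> carrier (Gal K)" using G ts unfolding closed_normal_def by (blast dest: closedin_subset)
  have "openin ?T (carrier (Gal K) - G)"
    using G ts by (auto simp: closed_normal_def closedin_def)
  then obtain U where U: "openin ?P U" "carrier (Gal K) - G = U \<inter> carrier (Gal K)"
    unfolding krull_topology_def openin_subtopology by blast
  have "\<tau> \<in> U" using U(2) \<tau> \<open>\<tau> \<notin> G\<close> by blast
  then have "\<exists>V. finite {i \<in> ?S. V i \<noteq> topspace (discrete_topology ?S)} \<and>
      (\<forall>i\<in>?S. openin (discrete_topology ?S) (V i)) \<and> \<tau> \<in> Pi\<^sub>E ?S V \<and> Pi\<^sub>E ?S V \<subseteq> U"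
    using U(1) unfolding openin_product_topology_alt by (rule bspec[rotated])
  then obtain V where V: "finite {i \<in> ?S. V i \<noteq> topspace (discrete_topology ?S)}"
    "\<tau> \<in> Pi\<^sub>E ?S V" "Pi\<^sub>E ?S V \<subseteq> U"
    by (elim exE conjE)
  define I where "I = {i \<in> ?S. V i \<noteq> ?S}"
  have "finite I" "I \<subseteq> ?S" using V(1) by (auto simp: I_def)
  then obtain \<rho> where \<rho>: "\<rho> \<in> G" "\<forall>x\<in>I. \<rho> x = \<tau> x" using dense by blast
  have \<rho>S: "\<rho> \<in> ?S \<rightarrow>\<^sub>E ?S" using \<rho>(1) GC car by blast
  have "\<rho> \<in> Pi\<^sub>E ?S V"
  proof (rule PiE_I)
    fix i assume i: "i \<in> ?S"
    show "\<rho> i \<in> V i"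
    proof (cases "i \<in> I")
      case True
      then show ?thesis using \<rho>(2) V(2) i by auto
    next
      case False
      then show ?thesis using \<rho>S i unfolding I_def by auto
    qed
  qed (use \<rho>S in auto)
  then show False using V(3) U(2) \<rho>(1) GC by blast
qed

section \<open>Polynomial functions\<close>

text \<open>The common ground of subfields, valuation rings and the unit ball of \<open>w\<close>,
  sufficient for evaluating and multiplying polynomials.\<close>

definition is_subsemiring :: "'a::field set \<Rightarrow> bool" where
  "is_subsemiring A \<longleftrightarrow> 0 \<in> A \<and> 1 \<in> A \<and> (\<forall>x\<in>A. \<forall>y\<in>A. x + y \<in> A \<and> x * y \<in> A)"

lemma is_subfield_subsemiring: "is_subfield K \<Longrightarrow> is_subsemiring K"
  by (simp add: is_subsemiring_def subfield_closed)

definition monomial_fun :: "(nat \<Rightarrow>\<^sub>0 nat) \<Rightarrow> (nat \<Rightarrow> 'a::field) \<Rightarrow> 'a" where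
  "monomial_fun m x = (\<Prod>i\<in>Poly_Mapping.keys m. x i ^ Poly_Mapping.lookup m i)"

lemma monomial_fun_superset:
  "finite I \<Longrightarrow> Poly_Mapping.keys m \<subseteq> I \<Longrightarrow> monomial_fun m x = (\<Prod>i\<in>I. x i ^ Poly_Mapping.lookup m i)"
  unfolding monomial_fun_def by (rule prod.mono_neutral_left) (auto simp: in_keys_iff)

lemma monomial_fun_add: "monomial_fun (m + m') x = monomial_fun m x * monomial_fun m' x"
proof -
  let ?I = "Poly_Mapping.keys m \<union> Poly_Mapping.keys m'"
  have "Poly_Mapping.keys (m + m') \<subseteq> ?I" by (rule Poly_Mapping.keys_add)
  then have "monomial_fun (m + m') x = (\<Prod>i\<in>?I. x i ^ Poly_Mapping.lookup (m + m') i)"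
    by (intro monomial_fun_superset) auto
  moreover have "monomial_fun m x = (\<Prod>i\<in>?I. x i ^ Poly_Mapping.lookup m i)"
    "monomial_fun m' x = (\<Prod>i\<in>?I. x i ^ Poly_Mapping.lookup m' i)"
    by (intro monomial_fun_superset; auto)+
  ultimately show ?thesis by (simp add: lookup_add power_add prod.distrib)
qed

lemma eval_mpol_superset:
  "finite M \<Longrightarrow> Poly_Mapping.keys g \<subseteq> M \<Longrightarrow>
   eval_mpol g x = (\<Sum>m\<in>M. Poly_Mapping.lookup g m * monomial_fun m x)"
  unfolding eval_mpol_def monomial_fun_def by (rule sum.mono_neutral_left) (auto simp: in_keys_iff)

lemma eval_mpol_add: "eval_mpol (g + h) x = eval_mpol g x + eval_mpol h x"
proof -
  let ?M = "Poly_Mapping.keys g \<union> Poly_Mapping.keys h"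
  have "Poly_Mapping.keys (g + h) \<subseteq> ?M" by (rule Poly_Mapping.keys_add)
  then have "eval_mpol (g + h) x = (\<Sum>m\<in>?M. Poly_Mapping.lookup (g + h) m * monomial_fun m x)"
    by (intro eval_mpol_superset) auto
  moreover have "eval_mpol g x = (\<Sum>m\<in>?M. Poly_Mapping.lookup g m * monomial_fun m x)"
    "eval_mpol h x = (\<Sum>m\<in>?M. Poly_Mapping.lookup h m * monomial_fun m x)"
    by (intro eval_mpol_superset; auto)+
  ultimately show ?thesis by (simp add: lookup_add algebra_simps sum.distrib)
qed

lemma eval_mpol_zero: "eval_mpol 0 x = 0"
  by (simp add: eval_mpol_def)

lemma eval_mpol_sum: "eval_mpol (sum f I) x = (\<Sum>i\<in>I. eval_mpol (f i) x)"
  by (induction I rule: infinite_finite_induct) (auto simp: eval_mpol_zero eval_mpol_add)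

lemma eval_mpol_single: "eval_mpol (Poly_Mapping.single m c) x = c * monomial_fun m x"
  by (subst eval_mpol_superset[of "{m}"]) auto

lemma mpol_eq_sum_single:
  fixes g :: "'a::field mpol"
  shows "g = (\<Sum>m\<in>Poly_Mapping.keys g. Poly_Mapping.single m (Poly_Mapping.lookup g m))"
  by (rule poly_mapping_eqI)
     (simp add: lookup_sum lookup_single Poly_Mapping.when_def in_keys_iff)

lemma mpol_mult_eq:
  fixes g h :: "'a::field mpol"
  shows "g * h = (\<Sum>m\<in>Poly_Mapping.keys g. \<Sum>m'\<in>Poly_Mapping.keys h.
     Poly_Mapping.single (m + m') (Poly_Mapping.lookup g m * Poly_Mapping.lookup h m'))"
proof -
  have "g * h = (\<Sum>m\<in>Poly_Mapping.keys g. Poly_Mapping.single m (Poly_Mapping.lookup g m)) *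
    (\<Sum>m\<in>Poly_Mapping.keys h. Poly_Mapping.single m (Poly_Mapping.lookup h m))"
    using mpol_eq_sum_single[of g] mpol_eq_sum_single[of h] by simp
  then show ?thesis by (simp add: sum_product Poly_Mapping.mult_single)
qed

lemma eval_mpol_mult: "eval_mpol (g * h) x = eval_mpol g x * eval_mpol h x"
proof -
  have "eval_mpol g x * eval_mpol h x =
      (\<Sum>m\<in>Poly_Mapping.keys g. \<Sum>m'\<in>Poly_Mapping.keys h.
         (Poly_Mapping.lookup g m * monomial_fun m x) * (Poly_Mapping.lookup h m' * monomial_fun m' x))"
    by (simp add: eval_mpol_def sum_product monomial_fun_def)
  then show ?thesis
    unfolding mpol_mult_eq[of g h] eval_mpol_sum eval_mpol_single monomial_fun_add
    by (simp add: mult_ac)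
qed

text \<open>New polynomials are built through the functions they induce, where composites can be
  written pointwise; membership then returns a polynomial with coefficients in
  \<open>A\<close>.\<close>

definition poly_funs :: "'a::field set \<Rightarrow> nat \<Rightarrow> ((nat \<Rightarrow> 'a) \<Rightarrow> 'a) set" where
  "poly_funs A n = eval_mpol ` mpolys A n"

context
  fixes A :: "'a::field set" and n :: nat
  assumes A: "is_subsemiring A"
begin

lemma mpolys_single:
  "c \<in> A \<Longrightarrow> Poly_Mapping.keys m \<subseteq> {..<n} \<Longrightarrow> Poly_Mapping.single m c \<in> mpolys A n"
  using A unfolding mpolys_def is_subsemiring_def
  by (auto simp: lookup_single Poly_Mapping.when_def split: if_splits)

lemma mpolys_add: "g \<in> mpolys A n \<Longrightarrow> h \<in> mpolys A n \<Longrightarrow> g + h \<in> mpolys A n"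
  using A Poly_Mapping.keys_add[of g h] unfolding mpolys_def is_subsemiring_def
  by (simp add: lookup_add) blast

lemma mpolys_sum: "(\<And>i. i \<in> I \<Longrightarrow> f i \<in> mpolys A n) \<Longrightarrow> sum f I \<in> mpolys A n"
proof (induction I rule: infinite_finite_induct)
  case (insert i I)
  then show ?case by (simp add: mpolys_add)
qed (use A in \<open>auto simp: mpolys_def is_subsemiring_def\<close>)

lemma mpolys_mult:
  assumes "g \<in> mpolys A n" "h \<in> mpolys A n"
  shows "g * h \<in> mpolys A n"
  unfolding mpol_mult_eq
proof (intro mpolys_sum mpolys_single)
  fix m m' assume m: "m \<in> Poly_Mapping.keys g" "m' \<in> Poly_Mapping.keys h"
  show "Poly_Mapping.lookup g m * Poly_Mapping.lookup h m' \<in> A"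
    using assms A by (auto simp: mpolys_def is_subsemiring_def)
  show "Poly_Mapping.keys (m + m') \<subseteq> {..<n}"
    using assms m Poly_Mapping.keys_add[of m m'] unfolding mpolys_def by blast
qed

lemma poly_funs_add: "f \<in> poly_funs A n \<Longrightarrow> g \<in> poly_funs A n \<Longrightarrow> (\<lambda>x. f x + g x) \<in> poly_funs A n"
  unfolding poly_funs_def using mpolys_add by (auto simp: image_iff fun_eq_iff simp flip: eval_mpol_add)

lemma poly_funs_mult: "f \<in> poly_funs A n \<Longrightarrow> g \<in> poly_funs A n \<Longrightarrow> (\<lambda>x. f x * g x) \<in> poly_funs A n"
  unfolding poly_funs_def using mpolys_mult by (auto simp: image_iff fun_eq_iff simp flip: eval_mpol_mult)

lemma poly_funs_const: "c \<in> A \<Longrightarrow> (\<lambda>x. c) \<in> poly_funs A n"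
  unfolding poly_funs_def
  by (rule image_eqI[OF _ mpolys_single[of c 0]]) (auto simp: eval_mpol_single monomial_fun_def)

lemma poly_funs_coord: "i < n \<Longrightarrow> (\<lambda>x. x i) \<in> poly_funs A n"
  unfolding poly_funs_def
  by (rule image_eqI[OF _ mpolys_single[of 1 "Poly_Mapping.single i 1"]])
     (use A in \<open>auto simp: eval_mpol_single monomial_fun_def is_subsemiring_def fun_eq_iff\<close>)

lemma poly_funs_power: "f \<in> poly_funs A n \<Longrightarrow> (\<lambda>x. f x ^ k) \<in> poly_funs A n"
proof (induction k)
  case 0
  then show ?case using poly_funs_const[of 1] A by (simp add: is_subsemiring_def)
next
  case (Suc k)
  then show ?case using poly_funs_mult[of f "\<lambda>x. f x ^ k"] by simp
qed

lemma poly_funs_sum: "(\<And>i. i \<in> I \<Longrightarrow> f i \<in> poly_funs A n) \<Longrightarrow> (\<lambda>x. \<Sum>i\<in>I. f i x) \<in> poly_funs A n"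
proof (induction I rule: infinite_finite_induct)
  case (insert i I)
  then show ?case using poly_funs_add[of "f i" "\<lambda>x. \<Sum>i\<in>I. f i x"] by simp
qed (use A poly_funs_const[of 0] in \<open>simp_all add: is_subsemiring_def\<close>)

lemma poly_funs_prod: "(\<And>i. i \<in> I \<Longrightarrow> f i \<in> poly_funs A n) \<Longrightarrow> (\<lambda>x. \<Prod>i\<in>I. f i x) \<in> poly_funs A n"
proof (induction I rule: infinite_finite_induct)
  case (insert i I)
  then show ?case using poly_funs_mult[of "f i" "\<lambda>x. \<Prod>i\<in>I. f i x"] by simp
qed (use A poly_funs_const[of 1] in \<open>simp_all add: is_subsemiring_def\<close>)

text \<open>The map \<open>c\<close> acts on coefficients. The identity gives substitution, a choice
  of q-th roots gives the q-th root of a polynomial.\<close>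

lemma poly_funs_subst:
  assumes g: "g \<in> mpolys B k" and y: "\<And>i. i < k \<Longrightarrow> y i \<in> poly_funs A n"
    and c: "\<And>b. b \<in> B \<Longrightarrow> c b \<in> A"
  shows "(\<lambda>x. \<Sum>m\<in>Poly_Mapping.keys g. c (Poly_Mapping.lookup g m) * monomial_fun m (\<lambda>i. y i x))
    \<in> poly_funs A n"
  unfolding monomial_fun_def
  using g y c
  by (intro poly_funs_sum poly_funs_mult poly_funs_const poly_funs_prod poly_funs_power)
     (auto simp: mpolys_def subset_iff)

end

lemma eval_mpol_cong: "g \<in> mpolys A n \<Longrightarrow> (\<And>i. i < n \<Longrightarrow> x i = y i) \<Longrightarrow> eval_mpol g x = eval_mpol g y"
  unfolding eval_mpol_def mpolys_def
  by (intro sum.cong arg_cong2[where f = "(*)"] prod.cong) (auto simp: subset_iff)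

text \<open>Frobenius is additive, so the polynomial whose coefficients are q-th roots of those of
  \<open>g\<close> has q-th power g evaluated at the q-th powers of the coordinates. This lifts
  relations from \<open>K\<close> to \<open>K'\<close>.\<close>

lemma mpolys_frob_root:
  fixes g :: "'a::field mpol"
  assumes A: "is_subsemiring A" and char: "CHAR('a) > 0" and q: "q = CHAR('a) ^ t"
    and g: "g \<in> mpolys B n" and roots: "\<And>b. b \<in> B \<Longrightarrow> \<exists>a\<in>A. a ^ q = b" and n: "n \<le> n'"
  shows "\<exists>f\<in>poly_funs A n'. \<forall>x. f x ^ q = eval_mpol g (\<lambda>i. x i ^ q)"
proof -
  have pp: "Factorial_Ring.prime CHAR('a)" using prime_CHAR_semidom char by blast
  obtain c where c: "\<And>b. b \<in> B \<Longrightarrow> c b \<in> A \<and> c b ^ q = b" using roots by metis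
  let ?f = "\<lambda>x. \<Sum>m\<in>Poly_Mapping.keys g. c (Poly_Mapping.lookup g m) * monomial_fun m (\<lambda>i. x i)"
  have "?f \<in> poly_funs A n'"
    by (rule poly_funs_subst[OF A g]) (use n c poly_funs_coord[OF A] in auto)
  moreover have "?f x ^ q = eval_mpol g (\<lambda>i. x i ^ q)" for x
  proof -
    have "?f x ^ q = (\<Sum>m\<in>Poly_Mapping.keys g. (c (Poly_Mapping.lookup g m) * monomial_fun m (\<lambda>i. x i)) ^ q)"
      by (rule freshmans_dream_sum'[OF pp q])
    also have "\<dots> = eval_mpol g (\<lambda>i. x i ^ q)"
      unfolding eval_mpol_def monomial_fun_def
      using g c by (intro sum.cong)
        (auto simp: mpolys_def power_mult_distrib prod_power_distrib mult.commute simp flip: power_mult)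
    finally show ?thesis .
  qed
  ultimately show ?thesis by (intro bexI[of _ ?f]) simp_all
qed

section \<open>Valuations\<close>

context
  fixes w :: "'a::field \<Rightarrow> ereal"
  assumes w: "valuation w"
begin

lemma val_zero: "w 0 = \<infinity>"
  and val_finite: "x \<noteq> 0 \<Longrightarrow> \<bar>w x\<bar> \<noteq> \<infinity>"
  and val_mult: "w (x * y) = w x + w y"
  and val_add: "min (w x) (w y) \<le> w (x + y)"
  using w by (auto simp: valuation_def)

lemma val_real: "x \<noteq> 0 \<Longrightarrow> \<exists>r. w x = ereal r"
  using val_finite[of x] by (cases "w x") auto

lemma val_infinity: "w x = \<infinity> \<longleftrightarrow> x = 0"
  by (cases "x = 0") (use val_finite[of x] val_zero in auto)

lemma val_one: "w 1 = 0"
proof -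
  obtain r where r: "w 1 = ereal r" using val_real[of 1] by auto
  have "w 1 = w 1 + w 1" using val_mult[of 1 1] by simp
  then show ?thesis using r by (simp add: zero_ereal_def)
qed

lemma val_uminus: "w (- x) = w x"
proof -
  obtain r where r: "w (- 1) = ereal r" using val_real[of "- 1"] by auto
  have "w (- 1) + w (- 1) = 0" using val_mult[of "- 1" "- 1"] val_one by simp
  then have "w (- 1) = 0" using r by (simp add: zero_ereal_def)
  then show ?thesis using val_mult[of "- 1" x] by simp
qed

lemma val_diff: "min (w x) (w y) \<le> w (x - y)"
  using val_add[of x "- y"] by (simp add: val_uminus)

lemma val_add_ge: "N \<le> w x \<Longrightarrow> N \<le> w y \<Longrightarrow> N \<le> w (x + y)"
  using val_add[of x y] by (meson min.boundedI order_trans)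

lemma val_diff_ge: "N \<le> w x \<Longrightarrow> N \<le> w y \<Longrightarrow> N \<le> w (x - y)"
  using val_diff[of x y] by (meson min.boundedI order_trans)

lemma val_sum_ge: "(\<And>i. i \<in> I \<Longrightarrow> N \<le> w (f i)) \<Longrightarrow> N \<le> w (sum f I)"
  by (induction I rule: infinite_finite_induct) (auto simp: val_zero val_add_ge)

lemma val_sum_gt: "finite I \<Longrightarrow> N < \<infinity> \<Longrightarrow> (\<And>i. i \<in> I \<Longrightarrow> N < w (f i)) \<Longrightarrow> N < w (sum f I)"
proof (induction I rule: finite_induct)
  case (insert i I)
  then have "N < min (w (f i)) (w (sum f I))" by simp
  also have "\<dots> \<le> w (f i + sum f I)" by (rule val_add)
  finally show ?case using insert by simp
qed (auto simp: val_zero)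

lemma val_power: "w (x ^ n) = ereal (real n) * w x"
proof (induction n)
  case 0
  then show ?case using val_one by (simp add: zero_ereal_def[symmetric])
next
  case (Suc n)
  show ?case
  proof (cases "x = 0")
    case True
    then show ?thesis using val_zero by simp
  next
    case False
    then obtain r where "w x = ereal r" using val_real by blast
    then show ?thesis using Suc by (simp add: val_mult algebra_simps)
  qed
qed

lemma val_inverse: "x \<noteq> 0 \<Longrightarrow> w (inverse x) = - w x"
proof -
  assume x: "x \<noteq> 0"
  obtain r s where "w x = ereal r" "w (inverse x) = ereal s" using val_real[OF x] val_real[of "inverse x"] x by auto
  moreover have "w x + w (inverse x) = 0" using x val_mult[of x "inverse x"] val_one by simp
  ultimately show ?thesis by (simp add: zero_ereal_def add_eq_0_iff)
qed

lemma val_divide: "y \<noteq> 0 \<Longrightarrow> w (x / y) = w x - w y"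
  using val_mult[of x "inverse y"] val_inverse[of y] by (simp add: divide_inverse minus_ereal_def)

lemma val_power_int: "x \<noteq> 0 \<Longrightarrow> w (x powi k) = ereal (of_int k) * w x"
proof -
  assume x: "x \<noteq> 0"
  obtain r where r: "w x = ereal r" using val_real x by blast
  show ?thesis
  proof (cases "k \<ge> 0")
    case True
    then show ?thesis using val_power[of x "nat k"] by (simp add: power_int_def)
  next
    case False
    then have "w (x powi k) = - (ereal (real (nat (- k))) * w x)"
      using x val_inverse[of "x ^ nat (- k)"] val_power[of x "nat (- k)"]
      by (simp add: power_int_def power_inverse)
    then show ?thesis using r False by simp
  qed
qed

lemma val_mult_ge: "N \<le> w x \<Longrightarrow> 0 \<le> w y \<Longrightarrow> N \<le> w (x * y)"
  using add_mono[of N "w x" 0 "w y"] by (simp add: val_mult)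

lemma val_power_ge: "ereal b \<le> w x \<Longrightarrow> ereal (real m * b) \<le> w (x ^ m)"
  unfolding val_power by (cases "w x") (auto intro: mult_left_mono)

lemma val_ring_subsemiring: "is_subfield K \<Longrightarrow> is_subsemiring (val_ring w K)"
  by (auto simp: is_subsemiring_def val_ring_def subfield_closed val_zero val_one val_mult
      intro: val_add_ge)

lemma val_ring_mono: "K \<subseteq> L \<Longrightarrow> val_ring w K \<subseteq> val_ring w L"
  by (auto simp: val_ring_def)

text \<open>The single term of least value cannot be cancelled by terms of strictly larger
  value.\<close>

lemma sum_distinct_val_nonzero:
  assumes I: "finite I" "I \<noteq> {}" and nz: "\<And>i. i \<in> I \<Longrightarrow> f i \<noteq> 0" and inj: "inj_on (\<lambda>i. w (f i)) I"
  shows "sum f I \<noteq> 0"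
proof
  assume s: "sum f I = 0"
  obtain i0 where i0: "i0 \<in> I" "\<forall>i\<in>I. w (f i0) \<le> w (f i)"
    using arg_min_if_finite[OF I, of "\<lambda>i. w (f i)"] by (meson linorder_not_le)
  have "w (f i0) < w (sum f (I - {i0}))"
  proof (rule val_sum_gt)
    fix i assume i: "i \<in> I - {i0}"
    then have "w (f i) \<noteq> w (f i0)" using inj i0(1) unfolding inj_on_def by blast
    then show "w (f i0) < w (f i)" using i i0(2) by (simp add: order_less_le)
  next
    show "w (f i0) < \<infinity>" using val_finite[OF nz[OF i0(1)]] by auto
  qed (use I in simp)
  moreover have "sum f (I - {i0}) = - f i0" using s sum.remove[OF I(1) i0(1), of f] by (simp add: add_eq_0_iff)
  ultimately show False by (simp add: val_uminus)
qed

section \<open>Uniformizers\<close>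

lemma uniformizer_real: "uniformizer w K \<pi> \<Longrightarrow> \<exists>\<gamma>>0. w \<pi> = ereal \<gamma>"
  using val_real[of \<pi>] by (auto simp: uniformizer_def)

lemma uniformizer_pos_ge:
  assumes "uniformizer w K \<pi>" "x \<in> K" "0 < w x"
  shows "w \<pi> \<le> w x"
proof (cases "x = 0")
  case False
  obtain \<gamma> where g: "\<gamma> > 0" "w \<pi> = ereal \<gamma>" using assms uniformizer_real by metis
  obtain m :: int where m: "w x = ereal (of_int m) * w \<pi>"
    using assms False unfolding uniformizer_def by blast
  then have "m > 0" using assms(3) g by (simp add: zero_less_mult_iff)
  then have "1 * \<gamma> \<le> of_int m * \<gamma>" using g by (intro mult_right_mono) auto
  then show ?thesis using m g by simp
qed (simp add: val_zero)

lemma uniformizer_unique: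
  assumes "uniformizer w K \<pi>" "uniformizer w K \<pi>'"
  shows "w \<pi> = w \<pi>'"
  using uniformizer_pos_ge[OF assms(1), of \<pi>'] uniformizer_pos_ge[OF assms(2), of \<pi>] assms
  by (simp add: uniformizer_def)

lemma uniformizer_val_nat:
  assumes "uniformizer w K \<pi>" "x \<in> K" "x \<noteq> 0" "0 \<le> w x"
  shows "\<exists>e. w x = ereal (real e) * w \<pi>"
proof -
  obtain \<gamma> where g: "\<gamma> > 0" "w \<pi> = ereal \<gamma>" using assms uniformizer_real by metis
  obtain m :: int where m: "w x = ereal (of_int m) * w \<pi>"
    using assms unfolding uniformizer_def by blast
  then have "m \<ge> 0" using assms(4) g by (simp add: zero_le_mult_iff)
  then show ?thesis using m by (intro exI[of _ "nat m"]) simp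
qed

text \<open>Conditions normalized for \<open>K\<close> and for \<open>K'\<close> become comparable
  once both are expressed by the one valuation \<open>w\<close> and the real value of a
  uniformizer.\<close>

lemma nval_ge_iff:
  assumes "uniformizer w K \<pi>" "w \<pi> = ereal \<gamma>"
  shows "ereal r \<le> nval w K x \<longleftrightarrow> ereal (r * \<gamma>) \<le> w x"
proof -
  have "uniformizer w K (SOME \<pi>. uniformizer w K \<pi>)" using assms(1) by (rule someI)
  then have n: "nval w K x = w x / ereal \<gamma>"
    using uniformizer_unique assms unfolding nval_def by metis
  have g: "\<gamma> > 0" using assms by (simp add: uniformizer_def)
  show ?thesis
    by (cases "w x") (use g in \<open>auto simp: n field_simps\<close>)
qed

lemma nval_nat_eq:
  assumes "uniformizer w K \<pi>" "w x = ereal (real e) * w \<pi>"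
  shows "nval_nat w K x = e"
proof -
  obtain \<gamma> where g: "\<gamma> > 0" "w \<pi> = ereal \<gamma>" using assms uniformizer_real by metis
  have "uniformizer w K (SOME \<pi>. uniformizer w K \<pi>)" using assms(1) by (rule someI)
  then have n: "nval w K x = w x / ereal \<gamma>"
    using uniformizer_unique assms g unfolding nval_def by metis
  then show ?thesis unfolding nval_nat_def using g assms(2) by auto
qed

lemma ram_index_eq:
  assumes "uniformizer w K \<pi>" "uniformizer w L \<pi>'" "w \<pi> = ereal (real e) * w \<pi>'"
  shows "ram_index w K L = e"
proof -
  have "uniformizer w K (SOME \<pi>. uniformizer w K \<pi>)" using assms(1) by (rule someI)
  then have "w (SOME \<pi>. uniformizer w K \<pi>) = ereal (real e) * w \<pi>'"
    using uniformizer_unique assms(1,3) by metis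
  then show ?thesis unfolding ram_index_def by (rule nval_nat_eq[OF assms(2)])
qed

text \<open>Elements of \<open>L\<close> with distinct values in the interval from 0 to
  \<open>w \<pi>\<close> have distinct values modulo the value group of \<open>K\<close>, hence are
  independent over \<open>K\<close>. So there are only finitely many such values, and a least
  positive one.\<close>

lemma uniformizer_exists:
  assumes \<pi>: "uniformizer w K \<pi>" and K: "is_subfield K" and L: "fin_ext K L"
  shows "\<exists>\<omega>. uniformizer w L \<omega>"
proof -
  obtain \<gamma> where g: "\<gamma> > 0" "w \<pi> = ereal \<gamma>" using \<pi> uniformizer_real by metis
  have sL: "is_subfield L" and KL: "K \<subseteq> L" using L by (auto simp: fin_ext_def)
  obtain n v where v: "lin_indep K n v" "lin_span K n v = L" using fin_ext_basis[OF K L] by blast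
  define V where "V = w ` {x \<in> L. x \<noteq> 0 \<and> 0 \<le> w x \<and> w x < w \<pi>}"
  have bound: "card W \<le> n" if W: "finite W" "W \<subseteq> V" for W
  proof -
    obtain h where h: "bij_betw h {0..<card W} W" using ex_bij_betw_nat_finite[OF W(1)] by blast
    have "\<forall>i<card W. \<exists>x. x \<in> L \<and> x \<noteq> 0 \<and> 0 \<le> w x \<and> w x < w \<pi> \<and> w x = h i"
    proof safe
      fix i assume "i < card W"
      then have "h i \<in> W" using bij_betwE[OF h] by simp
      then have "h i \<in> V" using W(2) by (rule subsetD[rotated])
      then show "\<exists>x. x \<in> L \<and> x \<noteq> 0 \<and> 0 \<le> w x \<and> w x < w \<pi> \<and> w x = h i"
        unfolding V_def by (elim imageE CollectE) (intro exI conjI, auto)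
    qed
    then obtain x where x: "\<And>i. i < card W \<Longrightarrow> x i \<in> L \<and> x i \<noteq> 0 \<and> 0 \<le> w (x i) \<and> w (x i) < w \<pi> \<and> w (x i) = h i"
      by metis
    have "lin_indep K (card W) x"
      unfolding lin_indep_def
    proof safe
      fix c i assume c: "\<forall>i<card W. c i \<in> K" "(\<Sum>i<card W. c i * x i) = 0" "i < card W"
      show "c i = 0"
      proof (rule ccontr)
        assume "c i \<noteq> 0"
        let ?I = "{i. i < card W \<and> c i \<noteq> 0}"
        have "(\<Sum>i\<in>?I. c i * x i) \<noteq> 0"
        proof (rule sum_distinct_val_nonzero)
          show "?I \<noteq> {}" using c(3) \<open>c i \<noteq> 0\<close> by blast
          show "\<And>i. i \<in> ?I \<Longrightarrow> c i * x i \<noteq> 0" using x by auto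
          show "inj_on (\<lambda>i. w (c i * x i)) ?I"
          proof (rule inj_onI)
            fix i j assume ij: "i \<in> ?I" "j \<in> ?I" "w (c i * x i) = w (c j * x j)"
            obtain k l :: int where kl: "w (c i) = ereal (of_int k) * w \<pi>" "w (c j) = ereal (of_int l) * w \<pi>"
              using \<pi> ij c(1) unfolding uniformizer_def by fastforce
            obtain r s where rs: "w (x i) = ereal r" "w (x j) = ereal s" using x ij val_real by blast
            have b: "0 \<le> r" "r < \<gamma>" "0 \<le> s" "s < \<gamma>" using x[of i] x[of j] ij rs g by auto
            have e: "of_int k * \<gamma> + r = of_int l * \<gamma> + s" using ij(3) kl rs g by (simp add: val_mult)
            \<comment> \<open>\<open>r\<close> and \<open>s\<close> both lie in the half-open
              interval from 0 to \<open>\<gamma>\<close>, so they cannot differ by a nonzero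
              multiple of \<open>\<gamma>\<close>.\<close>
            have "k = l"
            proof (rule ccontr)
              assume "k \<noteq> l"
              have "of_int (k - l) * \<gamma> = s - r" using e by (simp add: algebra_simps)
              then have "\<bar>of_int (k - l) * \<gamma>\<bar> < \<gamma>" using b by linarith
              then have "\<bar>of_int (k - l)\<bar> * \<gamma> < \<gamma>" using g by (simp add: abs_mult)
              then have "\<bar>real_of_int (k - l)\<bar> < 1" using g by simp
              then show False using \<open>k \<noteq> l\<close> by linarith
            qed
            then have "w (x i) = w (x j)" using e rs by simp
            then have "h i = h j" using x ij by simp
            then show "i = j" using h ij unfolding bij_betw_def inj_on_def by auto
          qed
        qed simp
        moreover have "(\<Sum>i\<in>?I. c i * x i) = (\<Sum>i<card W. c i * x i)"
          by (rule sum.mono_neutral_left) auto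
        ultimately show False using c(2) by simp
      qed
    qed
    then show "card W \<le> n" by (rule lin_indep_le[OF K]) (use v(2) x in auto)
  qed
  have "finite V"
  proof (rule ccontr)
    assume "infinite V"
    then obtain W where "W \<subseteq> V" "finite W" "card W = Suc n" using infinite_arbitrarily_large by blast
    then show False using bound by fastforce
  qed
  \<comment> \<open>\<open>w \<pi>\<close> is added so that the minimum also exists if no value lies
    strictly between 0 and \<open>w \<pi>\<close>.\<close>
  define V' where "V' = insert (w \<pi>) {v \<in> V. 0 < v}"
  have "finite V'" "V' \<noteq> {}" using \<open>finite V\<close> by (auto simp: V'_def)
  then have mn: "Min V' \<in> V'" "\<And>v. v \<in> V' \<Longrightarrow> Min V' \<le> v" by auto
  have "\<exists>\<omega>\<in>L. \<omega> \<noteq> 0 \<and> w \<omega> = u \<and> 0 < w \<omega>" if "u \<in> V'" for u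
  proof (cases "u = w \<pi>")
    case True
    then show ?thesis using \<pi> KL unfolding uniformizer_def by blast
  next
    case False
    then have "u \<in> V" "0 < u" using that by (simp_all add: V'_def)
    then show ?thesis unfolding V_def by blast
  qed
  from this[OF mn(1)] obtain \<omega> where \<omega>: "\<omega> \<in> L" "\<omega> \<noteq> 0" "w \<omega> = Min V'" "0 < w \<omega>"
    by (elim bexE conjE)
  obtain \<delta> where d: "w \<omega> = ereal \<delta>" "\<delta> > 0" using \<omega>(4) val_real[OF \<omega>(2)] by auto
  have "\<exists>m::int. w x = ereal (of_int m) * w \<omega>" if x: "x \<in> L" "x \<noteq> 0" for x
  proof -
    obtain r where r: "w x = ereal r" using val_real x by blast
    \<comment> \<open>Division by \<open>\<omega> powi k\<close> moves the value into the half-open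
      interval from 0 to \<open>w \<omega>\<close>, where minimality leaves only 0.\<close>
    define k where "k = \<lfloor>r / \<delta>\<rfloor>"
    define z where "z = x / \<omega> powi k"
    have nz: "\<omega> powi k \<noteq> 0" using \<omega> by simp
    have "\<omega> powi k \<in> L" using \<omega>(1) by (simp add: power_int_def subfield_closed[OF sL])
    then have zL: "z \<in> L" "z \<noteq> 0" using x nz subfield_divide[OF sL] by (auto simp: z_def)
    have wz: "w z = ereal (r - of_int k * \<delta>)"
      using r d val_power_int[OF \<omega>(2), of k] val_divide[OF nz, of x] by (simp add: z_def)
    have k: "of_int k * \<delta> \<le> r" "r < (of_int k + 1) * \<delta>"
      using d(2) unfolding k_def by (simp_all add: floor_divide_lower floor_divide_upper)
    have "\<not> 0 < w z"
    proof
      assume "0 < w z"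
      have "w z < w \<omega>" using k wz d by (simp add: algebra_simps)
      moreover have "w \<omega> \<le> w \<pi>" using mn(2)[of "w \<pi>"] \<omega>(3) by (simp add: V'_def)
      ultimately have "w z \<in> V'" using zL \<open>0 < w z\<close> unfolding V'_def V_def by auto
      then show False using mn(2) \<open>w z < w \<omega>\<close> \<omega>(3) by fastforce
    qed
    then have "r = of_int k * \<delta>" using wz k by simp
    then show ?thesis using r d by auto
  qed
  then have "uniformizer w L \<omega>" using \<omega> by (simp add: uniformizer_def)
  then show ?thesis ..
qed

end

section \<open>Finiteness of the valuation ring of a finite extension\<close>

text \<open>
  \<open>b\<close> is linearly independent modulo \<open>\<pi>\<close> over the residue field of \<open>K\<close>. A maximal such family generates
  the valuation ring of \<open>L\<close> modulo \<open>\<pi>\<close>, hence generates it since \<open>K\<close> is complete.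
\<close>
definition res_indep :: "('a::field \<Rightarrow> ereal) \<Rightarrow> 'a set \<Rightarrow> 'a \<Rightarrow> nat \<Rightarrow> (nat \<Rightarrow> 'a) \<Rightarrow> bool" where
  "res_indep w K \<pi> m b \<longleftrightarrow>
     (\<forall>c. (\<forall>i<m. c i \<in> val_ring w K) \<and> w \<pi> \<le> w (\<Sum>i<m. c i * b i) \<longrightarrow> (\<forall>i<m. 0 < w (c i)))"

text \<open>Dividing a relation by a coefficient of least value makes all coefficients integral and
  one of them 1, which independence modulo \<open>\<pi>\<close> forbids.\<close>

lemma res_indep_lin_indep:
  assumes w: "valuation w" and K: "is_subfield K" and b: "res_indep w K \<pi> m b"
  shows "lin_indep K m b"
  unfolding lin_indep_def
proof safe
  fix c i assume c: "\<forall>i<m. c i \<in> K" "(\<Sum>i<m. c i * b i) = 0" "i < m"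
  show "c i = 0"
  proof (rule ccontr)
    assume "c i \<noteq> 0"
    let ?I = "{i. i < m \<and> c i \<noteq> 0}"
    have I: "finite ?I" "?I \<noteq> {}" using c(3) \<open>c i \<noteq> 0\<close> by auto
    obtain j where j: "j \<in> ?I" "\<forall>i\<in>?I. w (c j) \<le> w (c i)"
      using arg_min_if_finite[OF I, of "\<lambda>i. w (c i)"] by (meson linorder_not_le)
    have cj: "c j \<noteq> 0" "c j \<in> K" "j < m" using j(1) c(1) by auto
    define d where "d i = c i / c j" for i
    have "d i \<in> val_ring w K" if "i < m" for i
    proof (cases "c i = 0")
      case True
      then show ?thesis using subfield_zero[OF K] val_zero[OF w] by (simp add: d_def val_ring_def)
    next
      case False
      then have "w (c j) \<le> w (c i)" using j(2) that by blast
      moreover obtain r s where "w (c i) = ereal r" "w (c j) = ereal s"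
        using val_real[OF w False] val_real[OF w cj(1)] by auto
      ultimately have "0 \<le> w (d i)" unfolding d_def val_divide[OF w cj(1)] by (simp add: zero_ereal_def)
      then show ?thesis using c(1) that cj subfield_divide[OF K] by (simp add: val_ring_def d_def)
    qed
    moreover have "(\<Sum>i<m. d i * b i) = (\<Sum>i<m. c i * b i) / c j"
      by (simp add: d_def sum_divide_distrib)
    then have "w \<pi> \<le> w (\<Sum>i<m. d i * b i)" using c(2) val_zero[OF w] by simp
    ultimately have "0 < w (d j)" using b cj(3) unfolding res_indep_def by blast
    then show False using cj(1) val_one[OF w] by (simp add: d_def)
  qed
qed

text \<open>Adjoining \<open>y\<close> to a maximal family independent modulo \<open>\<pi>\<close>
  creates a relation modulo \<open>\<pi>\<close>. The coefficient of \<open>y\<close> in it is a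
  unit, so the relation can be solved for \<open>y\<close>.\<close>

lemma val_ring_generators_mod:
  assumes w: "valuation w" and K: "is_subfield K" and \<pi>: "uniformizer w K \<pi>" and L: "fin_ext K L"
  shows "\<exists>(m::nat) b. (\<forall>i<m. b i \<in> val_ring w L) \<and>
    (\<forall>y\<in>val_ring w L. \<exists>c z. (\<forall>i<m. c i \<in> val_ring w K) \<and> z \<in> val_ring w L \<and>
       y = (\<Sum>i<m. c i * b i) + \<pi> * z)"
proof -
  obtain \<gamma> where g: "\<gamma> > 0" "w \<pi> = ereal \<gamma>" using \<pi> uniformizer_real[OF w] by metis
  have sL: "is_subfield L" and KL: "K \<subseteq> L" using L by (auto simp: fin_ext_def)
  have \<pi>0: "\<pi> \<noteq> 0" "\<pi> \<in> K" using \<pi> by (auto simp: uniformizer_def)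
  obtain n v where v: "lin_indep K n v" "lin_span K n v = L" using fin_ext_basis[OF K L] by blast
  let ?P = "\<lambda>m. \<exists>b. res_indep w K \<pi> m b \<and> (\<forall>i<m. b i \<in> val_ring w L)"
  have le: "m \<le> n" if m: "?P m" for m
  proof -
    obtain b where b: "res_indep w K \<pi> m b" "\<forall>i<m. b i \<in> val_ring w L" using m by blast
    show ?thesis
      by (rule lin_indep_le[OF K res_indep_lin_indep[OF w K b(1)], of n v])
         (use b(2) v(2) in \<open>simp add: val_ring_def\<close>)
  qed
  have P0: "?P 0" by (simp add: res_indep_def)
  define m where "m = (GREATEST m. ?P m)"
  have "?P m" unfolding m_def by (rule GreatestI_nat[of ?P, OF P0 le])
  then obtain b where b: "res_indep w K \<pi> m b" "\<forall>i<m. b i \<in> val_ring w L" by blast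
  have max: "\<not> ?P (Suc m)"
  proof
    assume P: "?P (Suc m)"
    have "Suc m \<le> (GREATEST m. ?P m)" by (rule Greatest_le_nat[of ?P, OF P le])
    then show False by (simp add: m_def)
  qed
  have gen: "\<exists>c z. (\<forall>i<m. c i \<in> val_ring w K) \<and> z \<in> val_ring w L \<and> y = (\<Sum>i<m. c i * b i) + \<pi> * z"
    if y: "y \<in> val_ring w L" for y
  proof -
    define b' where "b' = b(m := y)"
    have "\<forall>i<Suc m. b' i \<in> val_ring w L" using b(2) y by (simp add: b'_def less_Suc_eq)
    then have "\<not> res_indep w K \<pi> (Suc m) b'" using max by blast
    then obtain c j where c: "\<forall>i<Suc m. c i \<in> val_ring w K" "w \<pi> \<le> w (\<Sum>i<Suc m. c i * b' i)"
      "j < Suc m" "\<not> 0 < w (c j)" unfolding res_indep_def by blast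
    let ?s = "\<Sum>i<m. c i * b i"
    have s: "(\<Sum>i<Suc m. c i * b' i) = ?s + c m * y" by (simp add: b'_def)
    have cm: "c m \<in> K" "0 \<le> w (c m)" using c(1) by (auto simp: val_ring_def)
    \<comment> \<open>Otherwise \<open>c m * y\<close> vanishes modulo \<open>\<pi>\<close>, and
      independence of \<open>b\<close> forces positive value on every coefficient, against the
      choice of \<open>j\<close>.\<close>
    have "\<not> 0 < w (c m)"
    proof
      assume a: "0 < w (c m)"
      have "w \<pi> \<le> w (c m)" by (rule uniformizer_pos_ge[OF w \<pi> cm(1) a])
      moreover have "0 \<le> w y" using y by (simp add: val_ring_def)
      ultimately have "w \<pi> \<le> w (c m * y)" unfolding val_mult[OF w] by (metis add.right_neutral add_mono)
      then have "w \<pi> \<le> w ((?s + c m * y) - c m * y)"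
        using c(2) unfolding s by (intro val_diff_ge[OF w])
      then have "w \<pi> \<le> w ?s" by simp
      then have "\<forall>i<m. 0 < w (c i)" using b(1) c(1) unfolding res_indep_def by simp
      then show False using c(3,4) a by (metis less_Suc_eq)
    qed
    then have wcm: "w (c m) = 0" using cm(2) by simp
    then have cm0: "c m \<noteq> 0" using val_zero[OF w] by auto
    define z where "z = (?s + c m * y) / (c m * \<pi>)"
    have d: "- c i / c m \<in> val_ring w K" if "i < m" for i
    proof -
      have ci: "c i \<in> K" "0 \<le> w (c i)" using c(1) that by (auto simp: val_ring_def)
      have "w (- c i / c m) = w (c i)"
        unfolding val_divide[OF w cm0] val_uminus[OF w] wcm by (cases "w (c i)") auto
      then show ?thesis using ci cm subfield_closed(6)[OF K] subfield_divide[OF K]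
        by (simp add: val_ring_def)
    qed
    have bL: "b i \<in> L" if "i < m" for i using b(2) that by (simp add: val_ring_def)
    have "?s \<in> L" using c(1) bL KL by (intro subfield_sum[OF sL] subfield_mult[OF sL]) (auto simp: val_ring_def)
    then have zL: "z \<in> L" unfolding z_def
      using y cm(1) \<pi>0(2) KL by (intro subfield_divide[OF sL] subfield_add[OF sL] subfield_mult[OF sL]) (auto simp: val_ring_def)
    have "w (?s + c m * y) \<ge> w \<pi>" using c(2) s by simp
    then have "0 \<le> w z"
      using cm0 \<pi>0 g val_divide[OF w, of "c m * \<pi>" "?s + c m * y"] wcm val_mult[OF w, of "c m" \<pi>]
      by (cases "w (?s + c m * y)") (auto simp: z_def)
    moreover have "y = (\<Sum>i<m. (- c i / c m) * b i) + \<pi> * z"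
    proof -
      have "(\<Sum>i<m. (- c i / c m) * b i) = - ?s / c m"
        by (simp add: sum_divide_distrib sum_negf)
      then show ?thesis using cm0 \<pi>0 by (simp add: z_def field_simps)
    qed
    ultimately show ?thesis using d zL
      by (intro exI[of _ "\<lambda>i. - c i / c m"] exI[of _ z]) (simp add: val_ring_def)
  qed
  show ?thesis by (rule exI[of _ m], rule exI[of _ b]) (intro conjI ballI b(2) gen)
qed

text \<open>Repeating the approximation modulo \<open>\<pi>\<close> expands the coefficients of
  \<open>y\<close> into power series in \<open>\<pi>\<close>. They converge in \<open>K\<close> by
  completeness, and the limits represent \<open>y\<close> because the error has value above every
  real bound.\<close>

lemma val_ring_fin_gen:
  assumes w: "valuation w" and K: "complete_dvf w K" and L: "fin_ext K L"
  shows "\<exists>(m::nat) b. (\<forall>i<m. b i \<in> val_ring w L) \<and>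
    (\<forall>y\<in>val_ring w L. \<exists>c. (\<forall>i<m. c i \<in> val_ring w K) \<and> y = (\<Sum>i<m. c i * b i))"
proof -
  obtain \<pi> where \<pi>: "uniformizer w K \<pi>" using K by (auto simp: complete_dvf_def)
  have sK: "is_subfield K" and comp: "val_complete w K" using K by (auto simp: complete_dvf_def)
  obtain \<gamma> where g: "\<gamma> > 0" "w \<pi> = ereal \<gamma>" using \<pi> uniformizer_real[OF w] by metis
  have \<pi>0: "\<pi> \<noteq> 0" "\<pi> \<in> K" using \<pi> by (auto simp: uniformizer_def)
  obtain m :: nat and b where b: "\<forall>i<m. b i \<in> val_ring w L" and
    step: "\<forall>y\<in>val_ring w L. \<exists>c z. (\<forall>i<m. c i \<in> val_ring w K) \<and> z \<in> val_ring w L \<and>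
       y = (\<Sum>i<m. c i * b i) + \<pi> * z"
    using val_ring_generators_mod[OF w sK \<pi> L] by (elim exE conjE)
  obtain C where "\<forall>y\<in>val_ring w L. \<exists>z. (\<forall>i<m. C y i \<in> val_ring w K) \<and> z \<in> val_ring w L \<and>
       y = (\<Sum>i<m. C y i * b i) + \<pi> * z"
    using bchoice[OF step] by (elim exE)
  then obtain Z where Z: "\<forall>y\<in>val_ring w L. (\<forall>i<m. C y i \<in> val_ring w K) \<and> Z y \<in> val_ring w L \<and>
       y = (\<Sum>i<m. C y i * b i) + \<pi> * Z y"
    using bchoice[of "val_ring w L"] by (elim exE[OF bchoice])
  note CZ = bspec[OF Z]
  have gen: "\<exists>c. (\<forall>i<m. c i \<in> val_ring w K) \<and> y = (\<Sum>i<m. c i * b i)" if y: "y \<in> val_ring w L" for y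
  proof -
    \<comment> \<open>\<open>Y k\<close> is the remainder after \<open>k\<close> steps, and
      \<open>u N i\<close> the partial sum of the expansion of the i-th coefficient.\<close>
    define Y where "Y k = (Z ^^ k) y" for k
    have Y: "Y k \<in> val_ring w L" for k
      by (induction k) (use y CZ in \<open>simp_all add: Y_def\<close>)
    define u where "u N i = (\<Sum>k<N. \<pi> ^ k * C (Y k) i)" for N i
    have expand: "y = (\<Sum>i<m. u N i * b i) + \<pi> ^ N * Y N" for N
    proof (induction N)
      case 0
      then show ?case by (simp add: u_def Y_def)
    next
      case (Suc N)
      have "Z (Y N) = Y (Suc N)" by (simp add: Y_def)
      then have "Y N = (\<Sum>i<m. C (Y N) i * b i) + \<pi> * Y (Suc N)" using CZ[OF Y[of N]] by metis
      then have "\<pi> ^ N * Y N = \<pi> ^ N * ((\<Sum>i<m. C (Y N) i * b i) + \<pi> * Y (Suc N))" by (rule arg_cong)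
      then have "\<pi> ^ N * Y N = (\<Sum>i<m. \<pi> ^ N * C (Y N) i * b i) + \<pi> ^ Suc N * Y (Suc N)"
        by (simp add: distrib_left sum_distrib_left mult_ac)
      then show ?case using Suc by (simp add: u_def sum.distrib distrib_right)
    qed
    have wC: "0 \<le> w (C (Y k) i)" "C (Y k) i \<in> K" if "i < m" for k i
      using CZ[OF Y[of k]] that by (auto simp: val_ring_def)
    have wpow: "ereal (real k * \<gamma>) \<le> w (\<pi> ^ k * x)" if "0 \<le> w x" for k x
      using that val_power[OF w, of \<pi> k] g by (cases "w x") (auto simp: val_mult[OF w])
    have tail: "ereal (real M * \<gamma>) \<le> w (u N i - u M i)" if "i < m" "M \<le> N" for M N i
    proof -
      have "u N i - u M i = (\<Sum>k=M..<N. \<pi> ^ k * C (Y k) i)"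
        unfolding u_def using that(2) by (simp add: sum_diff_nat_ivl lessThan_atLeast0)
      moreover have "ereal (real M * \<gamma>) \<le> w (\<pi> ^ k * C (Y k) i)" if "k \<in> {M..<N}" for k
      proof -
        have "real M * \<gamma> \<le> real k * \<gamma>" using that g by (intro mult_right_mono) auto
        then show ?thesis using wpow[OF wC(1)[OF \<open>i < m\<close>], of k k] by (meson ereal_less_eq(3) order_trans)
      qed
      ultimately show ?thesis by (simp only:) (rule val_sum_ge[OF w])
    qed
    have big: "\<exists>M::nat. R \<le> real M * \<gamma>" for R
      using reals_Archimedean3[OF g(1)] by (metis order_less_imp_le)
    have lim: "\<exists>l\<in>K. \<forall>R::real. \<exists>M::nat. \<forall>N\<ge>M. ereal R \<le> w (u N i - l)" if i: "i < m" for i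
    proof -
      have "u N i \<in> K" for N unfolding u_def
        using wC(2)[OF i] \<pi>0 by (intro subfield_sum[OF sK] subfield_mult[OF sK] subfield_power[OF sK]) auto
      moreover have "\<exists>M::nat. \<forall>j\<ge>M. \<forall>k\<ge>M. ereal R \<le> w (u j i - u k i)" for R
      proof -
        obtain M where M: "R \<le> real M * \<gamma>" using big by blast
        have "ereal R \<le> w (u j i - u k i)" if "j \<ge> M" "k \<ge> M" for j k
        proof -
          have "ereal (real M * \<gamma>) \<le> w ((u j i - u M i) - (u k i - u M i))"
            by (rule val_diff_ge[OF w tail[OF i that(1)] tail[OF i that(2)]])
          then show ?thesis using M by (simp add: order_trans[of "ereal R" "ereal (real M * \<gamma>)"])
        qed
        then show ?thesis by blast
      qed
      ultimately show ?thesis using comp[unfolded val_complete_def, rule_format, of "\<lambda>N. u N i"] by blast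
    qed
    then obtain l where l: "\<And>i. i < m \<Longrightarrow> l i \<in> K \<and> (\<forall>R::real. \<exists>M::nat. \<forall>N\<ge>M. ereal R \<le> w (u N i - l i))"
      by metis
    have wu: "0 \<le> w (u N i)" if "i < m" for N i
      using tail[OF that, of 0 N] by (simp add: u_def flip: zero_ereal_def)
    have "l i \<in> val_ring w K" if i: "i < m" for i
    proof -
      obtain M where "\<forall>N\<ge>M. ereal 0 \<le> w (u N i - l i)" using l[OF i] by blast
      then have "0 \<le> w (u M i - l i)" by (simp flip: zero_ereal_def)
      then have "0 \<le> w (u M i - (u M i - l i))" by (rule val_diff_ge[OF w wu[OF i]])
      then show ?thesis using l[OF i] by (simp add: val_ring_def)
    qed
    moreover have "w (y - (\<Sum>i<m. l i * b i)) = \<infinity>"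
    proof (rule ereal_top)
      fix R :: real
      have "\<forall>i. \<exists>M::nat. i < m \<longrightarrow> (\<forall>N\<ge>M. ereal R \<le> w (u N i - l i))" using l by blast
      then obtain M where M: "\<And>i N. i < m \<Longrightarrow> N \<ge> M i \<Longrightarrow> ereal R \<le> w (u N i - l i)" by metis
      obtain M' where M': "R \<le> real M' * \<gamma>" using big by blast
      \<comment> \<open>A sum of the thresholds bounds all of them at once: those of the
        \<open>m\<close> limits and that of the remainder.\<close>
      define N where "N = M' + (\<Sum>i<m. M i)"
      have N: "M i \<le> N" if "i < m" for i
        using member_le_sum[of i "{..<m}" M] that by (simp add: N_def)
      have eq: "y - (\<Sum>i<m. l i * b i) = (\<Sum>i<m. (u N i - l i) * b i) + \<pi> ^ N * Y N"
        by (subst expand[of N]) (simp add: left_diff_distrib sum_subtractf)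
      have "ereal R \<le> w ((u N i - l i) * b i)" if "i < m" for i
      proof -
        have "ereal R \<le> w (u N i - l i)" "0 \<le> w (b i)" using M[OF that N[OF that]] b that by (auto simp: val_ring_def)
        then show ?thesis unfolding val_mult[OF w] by (metis add.right_neutral add_mono)
      qed
      moreover have "ereal R \<le> w (\<pi> ^ N * Y N)"
      proof -
        have "real M' * \<gamma> \<le> real N * \<gamma>" using g by (intro mult_right_mono) (auto simp: N_def sum_nonneg)
        then have "ereal R \<le> ereal (real N * \<gamma>)" using M' by simp
        also have "\<dots> \<le> w (\<pi> ^ N * Y N)" using wpow Y by (simp add: val_ring_def)
        finally show ?thesis .
      qed
      ultimately show "ereal R \<le> w (y - (\<Sum>i<m. l i * b i))"
        unfolding eq by (intro val_add_ge[OF w] val_sum_ge[OF w]) auto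
    qed
    then have "y = (\<Sum>i<m. l i * b i)" using val_infinity[OF w] by simp
    ultimately show ?thesis by blast
  qed
  show ?thesis by (rule exI[of _ m], rule exI[of _ b]) (intro conjI ballI b gen)
qed

section \<open>Functoriality of geometric connected components\<close>

lemma rig_connectedD:
  assumes "rig_connected w F n D T" "adm_open w F n D U" "adm_open w F n D V"
    "T \<subseteq> U \<union> V" "U \<inter> V \<inter> T = {}"
  shows "U \<inter> T = {} \<or> V \<inter> T = {}"
  using assms unfolding rig_connected_def by blast

text \<open>In any separation each of the two sets lies on one side, and the common point
  \<open>z\<close> makes it the same side.\<close>

lemma rig_connected_Un:
  assumes T: "rig_connected w F n D T1" "rig_connected w F n D T2" and z: "z \<in> T1" "z \<in> T2"
  shows "rig_connected w F n D (T1 \<union> T2)"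
  unfolding rig_connected_def
proof (intro conjI notI)
  show "T1 \<union> T2 \<subseteq> D" using T by (simp add: rig_connected_def)
  assume "\<exists>U V. adm_open w F n D U \<and> adm_open w F n D V \<and> T1 \<union> T2 \<subseteq> U \<union> V \<and>
    U \<inter> V \<inter> (T1 \<union> T2) = {} \<and> U \<inter> (T1 \<union> T2) \<noteq> {} \<and> V \<inter> (T1 \<union> T2) \<noteq> {}"
  then obtain U V where UV: "adm_open w F n D U" "adm_open w F n D V" "T1 \<union> T2 \<subseteq> U \<union> V"
    "U \<inter> V \<inter> (T1 \<union> T2) = {}" "U \<inter> (T1 \<union> T2) \<noteq> {}" "V \<inter> (T1 \<union> T2) \<noteq> {}"
    by (elim exE conjE)
  have "U \<inter> T1 = {} \<or> V \<inter> T1 = {}"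
    by (rule rig_connectedD[OF T(1) UV(1,2)]) (use UV(3,4) in blast)+
  moreover have "U \<inter> T2 = {} \<or> V \<inter> T2 = {}"
    by (rule rig_connectedD[OF T(2) UV(1,2)]) (use UV(3,4) in blast)+
  moreover have "z \<in> U \<or> z \<in> V" using z UV(3) by blast
  ultimately show False using z UV(5,6) by blast
qed

lemma same_component_trans:
  assumes "same_component w F n D x y" "same_component w F n D y z"
  shows "same_component w F n D x z"
proof -
  obtain T1 where T1: "rig_connected w F n D T1" "x \<in> T1" "y \<in> T1"
    using assms(1) unfolding same_component_def by blast
  obtain T2 where T2: "rig_connected w F n D T2" "y \<in> T2" "z \<in> T2"
    using assms(2) unfolding same_component_def by blast
  have "rig_connected w F n D (T1 \<union> T2)" by (rule rig_connected_Un[OF T1(1) T2(1) T1(3) T2(2)])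
  then show ?thesis using T1(2) T2(3) unfolding same_component_def by blast
qed

lemma same_component_sym: "same_component w F n D x y \<Longrightarrow> same_component w F n D y x"
  unfolding same_component_def by blast

lemma same_component_refl: "x \<in> D \<Longrightarrow> same_component w F n D x x"
  unfolding same_component_def rig_connected_def by (rule exI[of _ "{x}"]) blast

lemma geom_rel_sym: "(x, y) \<in> geom_rel w K n D \<Longrightarrow> (y, x) \<in> geom_rel w K n D"
  unfolding geom_rel_def using same_component_sym by blast

lemma geom_rel_trans: "(x, y) \<in> geom_rel w K n D \<Longrightarrow> (y, z) \<in> geom_rel w K n D \<Longrightarrow> (x, z) \<in> geom_rel w K n D"
  unfolding geom_rel_def using same_component_trans by blast

lemma geom_rel_refl: "x \<in> D \<Longrightarrow> (x, x) \<in> geom_rel w K n D"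
  unfolding geom_rel_def using same_component_refl by blast

text \<open>
  That the points \<open>(\<phi>(z\<^sub>i))\<close> lie in \<open>D\<close> is part of the identification with \<open>\<pi>\<^sub>0\<close>: the elements of the
  quotient are nonempty.
\<close>
lemma identifies_pi0_geom_rel:
  assumes I: "identifies_pi0 w K L H n z D" and \<phi>: "\<phi> \<in> Hom_over K L" "\<psi> \<in> Hom_over K L"
  shows "(\<lambda>i\<in>{..<n}. \<phi> (z i), \<lambda>i\<in>{..<n}. \<psi> (z i)) \<in> geom_rel w K n D \<longleftrightarrow>
    (\<exists>\<sigma>\<in>H. \<psi> = compose L \<sigma> \<phi>)"
proof -
  let ?pt = "\<lambda>\<phi>. \<lambda>i\<in>{..<n}. \<phi> (z i)"
  let ?R = "geom_rel w K n D"
  let ?c = "\<lambda>\<phi>. ?R `` {?pt \<phi>}"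
  have im: "?c ` Hom_over K L = pi0_geom w K n D"
    and eq: "?c \<phi> = ?c \<psi> \<longleftrightarrow> (\<exists>\<sigma>\<in>H. \<psi> = compose L \<sigma> \<phi>)"
    using I \<phi> unfolding identifies_pi0_def Let_def by blast+
  have ne: "(?pt \<theta>, ?pt \<theta>) \<in> ?R" if "\<theta> \<in> Hom_over K L" for \<theta>
  proof -
    have "?c \<theta> \<in> D // ?R" using im that unfolding pi0_geom_def by blast
    then obtain x where x: "x \<in> D" "?c \<theta> = ?R `` {x}" by (rule quotientE)
    then have "(?pt \<theta>, x) \<in> ?R" using geom_rel_refl[OF x(1), of w K n] by blast
    then show ?thesis using geom_rel_sym geom_rel_trans by metis
  qed
  have "?c \<phi> = ?c \<psi> \<longleftrightarrow> (?pt \<phi>, ?pt \<psi>) \<in> ?R"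
  proof
    assume "?c \<phi> = ?c \<psi>"
    then show "(?pt \<phi>, ?pt \<psi>) \<in> ?R" using ne[OF \<phi>(2)] by blast
  next
    assume a: "(?pt \<phi>, ?pt \<psi>) \<in> ?R"
    have "(?pt \<phi>, y) \<in> ?R \<longleftrightarrow> (?pt \<psi>, y) \<in> ?R" for y
      using geom_rel_trans[OF a, of y] geom_rel_trans[OF geom_rel_sym[OF a], of y] by blast
    then show "?c \<phi> = ?c \<psi>" by blast
  qed
  then show ?thesis using eq by simp
qed

section \<open>Maps of domains along which polynomials pull back to polynomials\<close>

context
  fixes w :: "'a::alg_closed_field \<Rightarrow> ereal" and F F' :: "'a set" and n n' :: nat
    and D D' :: "(nat \<Rightarrow> 'a) set" and f
  assumes fD: "f ` D' \<subseteq> D"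
    and pullback: "\<And>g. g \<in> mpolys F n \<Longrightarrow> \<exists>g'\<in>mpolys F' n'. \<forall>x\<in>D'. eval_mpol g' x = eval_mpol g (f x)"
begin

text \<open>Uniform approximation on \<open>D\<close> by polynomials turns into uniform
  approximation on \<open>D'\<close> with the same bounds, because \<open>f\<close> maps
  \<open>D'\<close> into \<open>D\<close>.\<close>

lemma affinoid_funs_pullback:
  assumes "h \<in> affinoid_funs w F n D"
  shows "h \<circ> f \<in> affinoid_funs w F' n' D'"
  unfolding affinoid_funs_def
proof (intro CollectI allI)
  fix N :: real
  obtain g where g: "g \<in> mpolys F n" "\<forall>x\<in>D. ereal N \<le> w (h x - eval_mpol g x)"
    using assms unfolding affinoid_funs_def by blast
  obtain g' where g': "g' \<in> mpolys F' n'" "\<forall>x\<in>D'. eval_mpol g' x = eval_mpol g (f x)"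
    using pullback[OF g(1)] by blast
  have "\<forall>x\<in>D'. ereal N \<le> w ((h \<circ> f) x - eval_mpol g' x)" using g(2) g'(2) fD by auto
  then show "\<exists>g\<in>mpolys F' n'. \<forall>x\<in>D'. ereal N \<le> w ((h \<circ> f) x - eval_mpol g x)" using g'(1) by blast
qed

lemma rational_subdomain_pullback:
  assumes "rational_subdomain w F n D U"
  shows "rational_subdomain w F' n' D' {x \<in> D'. f x \<in> U}"
proof -
  obtain r :: nat and h where h: "\<forall>i\<le>r. h i \<in> affinoid_funs w F n D" "\<forall>x\<in>D. \<exists>i\<le>r. h i x \<noteq> 0"
    "U = {x\<in>D. \<forall>i\<le>r. w (h 0 x) \<le> w (h i x)}"
    using assms unfolding rational_subdomain_def by (elim exE conjE)
  show ?thesis unfolding rational_subdomain_def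
  proof (rule exI[of _ r], rule exI[of _ "\<lambda>i. h i \<circ> f"], intro conjI)
    show "\<forall>i\<le>r. h i \<circ> f \<in> affinoid_funs w F' n' D'" using h(1) affinoid_funs_pullback by blast
    show "\<forall>x\<in>D'. \<exists>i\<le>r. (h i \<circ> f) x \<noteq> 0" using h(2) fD by auto
    show "{x \<in> D'. f x \<in> U} = {x \<in> D'. \<forall>i\<le>r. w ((h 0 \<circ> f) x) \<le> w ((h i \<circ> f) x)}"
      using h(3) fD by auto
  qed
qed

lemma adm_open_pullback:
  assumes "adm_open w F n D U"
  shows "adm_open w F' n' D' {x \<in> D'. f x \<in> U}"
proof -
  obtain \<U> where U: "finite \<U>" "\<forall>V\<in>\<U>. rational_subdomain w F n D V" "U = \<Union>\<U>"
    using assms unfolding adm_open_def by (elim exE conjE)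
  show ?thesis unfolding adm_open_def
  proof (rule exI[of _ "(\<lambda>V. {x \<in> D'. f x \<in> V}) ` \<U>"], intro conjI)
    show "\<forall>V\<in>(\<lambda>V. {x \<in> D'. f x \<in> V}) ` \<U>. rational_subdomain w F' n' D' V"
      using U(2) rational_subdomain_pullback by blast
  qed (use U in auto)
qed

text \<open>A separation of the image of \<open>T\<close> by admissible open sets pulls back to a
  separation of \<open>T\<close>.\<close>

lemma same_component_image:
  assumes "same_component w F' n' D' x y"
  shows "same_component w F n D (f x) (f y)"
proof -
  obtain T where T: "rig_connected w F' n' D' T" "x \<in> T" "y \<in> T"
    using assms unfolding same_component_def by blast
  have TD: "T \<subseteq> D'" using T(1) by (simp add: rig_connected_def)
  have "rig_connected w F n D (f ` T)"
    unfolding rig_connected_def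
  proof (intro conjI notI)
    show "f ` T \<subseteq> D" using TD fD by blast
    assume "\<exists>U V. adm_open w F n D U \<and> adm_open w F n D V \<and> f ` T \<subseteq> U \<union> V \<and>
      U \<inter> V \<inter> f ` T = {} \<and> U \<inter> f ` T \<noteq> {} \<and> V \<inter> f ` T \<noteq> {}"
    then obtain U V where UV: "adm_open w F n D U" "adm_open w F n D V" "f ` T \<subseteq> U \<union> V"
      "U \<inter> V \<inter> f ` T = {}" "U \<inter> f ` T \<noteq> {}" "V \<inter> f ` T \<noteq> {}" by (elim exE conjE)
    have "{x \<in> D'. f x \<in> U} \<inter> T = {} \<or> {x \<in> D'. f x \<in> V} \<inter> T = {}"
      by (rule rig_connectedD[OF T(1) adm_open_pullback[OF UV(1)] adm_open_pullback[OF UV(2)]])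
         (use UV(3,4) TD in blast)+
    then show False using UV(5,6) TD by blast
  qed
  then show ?thesis using T(2,3) unfolding same_component_def by blast
qed

end

text \<open>Here the coefficients stay as they are and only the variables are raised to the q-th
  power, so it suffices that \<open>F'\<close> contains \<open>F\<close>. The coordinates from
  \<open>n\<close> on are forgotten.\<close>

lemma frob_coordinates_pullback:
  assumes F: "is_subfield F'" "F \<subseteq> F'" and n: "n \<le> n'" and g: "g \<in> mpolys F n"
  shows "\<exists>g'\<in>mpolys F' n'. \<forall>x. eval_mpol g' x = eval_mpol g (\<lambda>i\<in>{..<n}. x i ^ q)"
proof -
  note A = is_subfield_subsemiring[OF F(1)]
  have "(\<lambda>x. \<Sum>m\<in>Poly_Mapping.keys g. Poly_Mapping.lookup g m * monomial_fun m (\<lambda>i. x i ^ q)) \<in> poly_funs F' n'"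
    by (rule poly_funs_subst[OF A g, where c = "\<lambda>x. x" and y = "\<lambda>i x. x i ^ q"])
       (use n F(2) in \<open>auto intro!: poly_funs_power[OF A] poly_funs_coord[OF A]\<close>)
  then obtain g' where g': "g' \<in> mpolys F' n'"
    "(\<lambda>x. \<Sum>m\<in>Poly_Mapping.keys g. Poly_Mapping.lookup g m * monomial_fun m (\<lambda>i. x i ^ q)) = eval_mpol g'"
    unfolding poly_funs_def by blast
  have "eval_mpol g' x = eval_mpol g (\<lambda>i\<in>{..<n}. x i ^ q)" for x
  proof -
    have "eval_mpol g' x = eval_mpol g (\<lambda>i. x i ^ q)"
      using fun_cong[OF g'(2), of x] by (simp add: eval_mpol_def monomial_fun_def)
    also have "\<dots> = eval_mpol g (\<lambda>i\<in>{..<n}. x i ^ q)" by (rule eval_mpol_cong[OF g]) simp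
    finally show ?thesis .
  qed
  then show ?thesis using g'(1) by blast
qed

text \<open>The argument shared by both filtrations; \<open>data\<close> collects what depends on
  the choice of domains. Every finite subset of the separable closure lies in some \<open>L\<close>,
  so agreement on each \<open>L\<close> is enough to conclude by closedness of
  \<open>G\<close>.\<close>

lemma ram_group_transfer:
  fixes K K' :: "'a::alg_closed_field set"
  assumes K: "is_subfield K" and K': "is_subfield K'" "K \<subseteq> K'" and char: "CHAR('a) > 0"
    and G: "closed_normal K G" and G': "closed_normal K' G'"
    and data: "\<And>L. fin_sep_ext K L \<Longrightarrow> \<exists>n z D L' n' z' D'. fin_sep_ext K' L' \<and>
      identifies_pi0 w K L G n z D \<and> identifies_pi0 w K' L' G' n' z' D' \<and> n \<le> n' \<and>
      (\<forall>i<n. z i \<in> L \<and> z i = z' i ^ q) \<and> (\<forall>i<n'. z' i \<in> L') \<and>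
      (\<lambda>x. \<lambda>i\<in>{..<n}. x i ^ q) ` D' \<subseteq> D"
  shows "gal_restrict K ` G' \<subseteq> G"
proof safe
  fix \<sigma> assume \<sigma>: "\<sigma> \<in> G'"
  have "G' \<subseteq> carrier (Gal K')"
    using G' unfolding closed_normal_def by (meson normal_imp_subgroup subgroup.subset)
  then have \<sigma>C: "\<sigma> \<in> carrier (Gal K')" using \<sigma> by blast
  have \<sigma>H: "\<sigma> \<in> Hom_over K' (sep_closure K')" using \<sigma>C by (simp add: carrier_Gal)
  have SS: "sep_closure K \<subseteq> sep_closure K'" using sep_closure_mono[OF K'] .
  show "gal_restrict K \<sigma> \<in> G"
  proof (rule closed_normal_dense[OF G gal_restrict_carrier[OF K K' char \<sigma>C]])
    fix S assume S: "finite S" "S \<subseteq> sep_closure K"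
    obtain L where L: "fin_sep_ext K L" "S \<subseteq> L" using fin_sep_ext_adjoin[OF K char S] by (elim exE conjE)
    obtain n z D L' n' z' D' where L': "fin_sep_ext K' L'" and
      I: "identifies_pi0 w K L G n z D" "identifies_pi0 w K' L' G' n' z' D'" and n: "n \<le> n'" and
      z: "\<forall>i<n. z i \<in> L \<and> z i = z' i ^ q" "\<forall>i<n'. z' i \<in> L'" and
      f: "(\<lambda>x. \<lambda>i\<in>{..<n}. x i ^ q) ` D' \<subseteq> D"
      using data[OF L(1)] by (elim exE conjE)
    let ?f = "\<lambda>x. \<lambda>i\<in>{..<n}. x i ^ q"
    have sL: "is_subfield L" "K \<subseteq> L" "L \<subseteq> sep_closure K"
      using L(1) by (auto simp: fin_sep_ext_def fin_ext_def)
    have sL': "is_subfield L'" "K' \<subseteq> L'" "L' \<subseteq> sep_closure K'"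
      using L' by (auto simp: fin_sep_ext_def fin_ext_def)
    have id: "restrict (\<lambda>x. x) M \<in> Hom_over k M" if "is_subfield M" "k \<subseteq> M" for M k :: "'a set"
      using that unfolding Hom_over_def
      by (simp add: subset_eq subfield_add[OF that(1)] subfield_mult[OF that(1)])
    have h': "restrict \<sigma> L' \<in> Hom_over K' L'"
      by (rule Hom_over_restrict[OF \<sigma>H sL'(3) order_refl sL'(2)])
         (simp add: subfield_add[OF sL'(1)] subfield_mult[OF sL'(1)])
    have h: "restrict \<sigma> L \<in> Hom_over K L"
      by (rule Hom_over_restrict[OF \<sigma>H order_trans[OF sL(3) SS] K'(2) sL(2)])
         (simp add: subfield_add[OF sL(1)] subfield_mult[OF sL(1)])
    \<comment> \<open>The inclusion of \<open>L'\<close> and its composite with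
      \<open>\<sigma>\<close> are in one orbit of \<open>G'\<close>, so the points z' and
      \<sigma>(z') are in one geometric component.\<close>
    have "restrict \<sigma> L' = compose L' \<sigma> (restrict (\<lambda>x. x) L')"
      by (auto simp: compose_def restrict_def)
    then have rel': "(\<lambda>i\<in>{..<n'}. restrict (\<lambda>x. x) L' (z' i), \<lambda>i\<in>{..<n'}. restrict \<sigma> L' (z' i)) \<in> geom_rel w K' n' D'"
      unfolding identifies_pi0_geom_rel[OF I(2) id[OF sL'(1,2)] h'] using \<sigma> by (rule bexI)
    \<comment> \<open>Equivariance of the map of domains: \<open>\<sigma>\<close> commutes with q-th
      powers, so the image of \<sigma>(z') is \<sigma>(z).\<close>
    have pow: "\<sigma> (x ^ m) = \<sigma> x ^ m" if x: "x \<in> L'" for x m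
    proof (induction m)
      case 0
      then show ?case using Hom_overD(3)[OF \<sigma>H subfield_one[OF K'(1)]] by simp
    next
      case (Suc m)
      have "x \<in> sep_closure K'" "x ^ m \<in> sep_closure K'" using x subfield_power[OF sL'(1) x] sL'(3) by blast+
      then show ?case using Suc Hom_overD(2)[OF \<sigma>H] by simp
    qed
    have pt1: "?f (\<lambda>i\<in>{..<n'}. restrict (\<lambda>x. x) L' (z' i)) = (\<lambda>i\<in>{..<n}. restrict (\<lambda>x. x) L (z i))"
    proof (rule restrict_ext)
      fix i assume "i \<in> {..<n}"
      then have i: "i < n" "i < n'" using n by auto
      then have "z' i \<in> L'" "z i \<in> L" "z' i ^ q = z i" using z by auto
      then show "(\<lambda>i\<in>{..<n'}. restrict (\<lambda>x. x) L' (z' i)) i ^ q = restrict (\<lambda>x. x) L (z i)"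
        using i by simp
    qed
    have pt2: "?f (\<lambda>i\<in>{..<n'}. restrict \<sigma> L' (z' i)) = (\<lambda>i\<in>{..<n}. restrict \<sigma> L (z i))"
    proof (rule restrict_ext)
      fix i assume "i \<in> {..<n}"
      then have i: "i < n" "i < n'" using n by auto
      then have "z' i \<in> L'" "z i \<in> L" "z i = z' i ^ q" using z by blast+
      then show "(\<lambda>i\<in>{..<n'}. restrict \<sigma> L' (z' i)) i ^ q = restrict \<sigma> L (z i)"
        using i pow by simp
    qed
    \<comment> \<open>For each \<open>F\<close> over \<open>K\<close> the components over
      \<open>F\<close> are reached from those over some finite separable \<open>F'\<close> over
      \<open>K'\<close> containing \<open>F\<close>.\<close>
    have "(?f x, ?f y) \<in> geom_rel w K n D" if xy: "(x, y) \<in> geom_rel w K' n' D'" for x y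
    proof -
      have D': "x \<in> D'" "y \<in> D'" and c: "\<And>F. fin_sep_ext K' F \<Longrightarrow> same_component w F n' D' x y"
        using xy by (auto simp: geom_rel_def)
      have "same_component w F n D (?f x) (?f y)" if F: "fin_sep_ext K F" for F
      proof -
        have "\<exists>F'. fin_sep_ext K' F' \<and> (\<lambda>x. x) ` F \<subseteq> F'"
          by (rule fin_sep_ext_transfer[OF K K'(1) char _ _ _ _ F]) (use K'(2) in auto)
        then obtain F' where F': "fin_sep_ext K' F'" "F \<subseteq> F'" by auto
        then have sF: "is_subfield F'" by (simp add: fin_sep_ext_def fin_ext_def)
        show ?thesis
        proof (rule same_component_image[OF f _ c[OF F'(1)]])
          fix g assume "g \<in> mpolys F n"
          then show "\<exists>g'\<in>mpolys F' n'. \<forall>x\<in>D'. eval_mpol g' x = eval_mpol g (?f x)"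
            using frob_coordinates_pullback[OF sF F'(2) n] by blast
        qed
      qed
      then show ?thesis using D' f unfolding geom_rel_def by blast
    qed
    from this[OF rel'] have "(\<lambda>i\<in>{..<n}. restrict (\<lambda>x. x) L (z i), \<lambda>i\<in>{..<n}. restrict \<sigma> L (z i)) \<in> geom_rel w K n D"
      unfolding pt1 pt2 .
    then obtain \<tau> where \<tau>: "\<tau> \<in> G" "restrict \<sigma> L = compose L \<tau> (restrict (\<lambda>x. x) L)"
      unfolding identifies_pi0_geom_rel[OF I(1) id[OF sL(1,2)] h] by (elim bexE)
    have "\<tau> x = gal_restrict K \<sigma> x" if "x \<in> S" for x
    proof -
      have "x \<in> L" "x \<in> sep_closure K" using that L(2) S(2) by blast+
      then show ?thesis using fun_cong[OF \<tau>(2), of x] by (simp add: compose_def gal_restrict_def)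
    qed
    then show "\<exists>\<rho>\<in>G. \<forall>x\<in>S. \<rho> x = gal_restrict K \<sigma> x" using \<tau>(1) by blast
  qed
qed

section \<open>Generators of valuation rings and roots of Frobenius\<close>

lemma eval_mpol_closed:
  assumes B: "is_subsemiring B" "A \<subseteq> B" and g: "g \<in> mpolys A n" and x: "\<And>i. i < n \<Longrightarrow> x i \<in> B"
  shows "eval_mpol g x \<in> B"
proof -
  have mult: "(\<Prod>i\<in>I. f i) \<in> B" if "\<And>i. i \<in> I \<Longrightarrow> f i \<in> B" for f and I :: "nat set"
    using that B(1) by (induction I rule: infinite_finite_induct) (auto simp: is_subsemiring_def)
  have add: "(\<Sum>i\<in>I. f i) \<in> B" if "\<And>i. i \<in> I \<Longrightarrow> f i \<in> B" for f and I :: "(nat \<Rightarrow>\<^sub>0 nat) set"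
    using that B(1) by (induction I rule: infinite_finite_induct) (auto simp: is_subsemiring_def)
  have pow: "y ^ k \<in> B" if "y \<in> B" for y k
    using that B(1) by (induction k) (auto simp: is_subsemiring_def)
  have m: "u * v \<in> B" if "u \<in> B" "v \<in> B" for u v using that B(1) by (simp add: is_subsemiring_def)
  show ?thesis unfolding eval_mpol_def
  proof (intro add m mult pow)
    fix k i assume "k \<in> Poly_Mapping.keys g"
    then show "Poly_Mapping.lookup g k \<in> B" using g B(2) by (auto simp: mpolys_def)
    assume "i \<in> Poly_Mapping.keys k"
    then have "i < n" using g \<open>k \<in> Poly_Mapping.keys g\<close> by (auto simp: mpolys_def)
    then show "x i \<in> B" by (rule x)
  qed
qed

text \<open>The prescribed elements keep their indices, since the map of domains pairs the
  coordinates by index. After them come \<open>E\<close> and module generators of the valuation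
  ring, without those already present, because \<open>generates\<close> demands an injective
  family.\<close>

lemma generates_exists:
  assumes w: "valuation w" and K: "complete_dvf w K" and L: "fin_ext K L"
    and y: "inj_on y {..<n}" "\<And>i. i < n \<Longrightarrow> y i \<in> val_ring w L"
    and E: "finite E" "E \<subseteq> val_ring w L"
  shows "\<exists>n' z. n \<le> n' \<and> (\<forall>i<n. z i = y i) \<and> E \<subseteq> z ` {..<n'} \<and> generates w K L n' z"
proof -
  have sK: "is_subfield K" using K by (simp add: complete_dvf_def)
  have sL: "is_subfield L" and KL: "K \<subseteq> L" using L by (auto simp: fin_ext_def)
  obtain m :: nat and b where b: "\<forall>i<m. b i \<in> val_ring w L" and
    gen: "\<forall>y\<in>val_ring w L. \<exists>c. (\<forall>i<m. c i \<in> val_ring w K) \<and> y = (\<Sum>i<m. c i * b i)"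
    using val_ring_fin_gen[OF w K L] by (elim exE conjE)
  define T where "T = (b ` {..<m} \<union> E) - y ` {..<n}"
  have "finite T" using E(1) by (simp add: T_def)
  then obtain xs where xs: "set xs = T" "distinct xs" using finite_distinct_list by blast
  define z where "z i = (if i < n then y i else xs ! (i - n))" for i
  define n' where "n' = n + length xs"
  have z1: "z i = y i" if "i < n" for i using that by (simp add: z_def)
  have z2: "z (n + i) = xs ! i" for i by (simp add: z_def)
  have zT: "z i \<in> T" if "i < n'" "\<not> i < n" for i
  proof -
    have "i - n < length xs" using that by (auto simp: n'_def)
    then show ?thesis using xs(1) that(2) unfolding z_def by (metis nth_mem)
  qed
  have img: "z ` {..<n'} = y ` {..<n} \<union> T"
  proof
    show "z ` {..<n'} \<subseteq> y ` {..<n} \<union> T"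
    proof safe
      fix i assume "i < n'" "z i \<notin> T"
      then have "i < n" using zT by blast
      then show "z i \<in> y ` {..<n}" using z1 by simp
    qed
    show "y ` {..<n} \<union> T \<subseteq> z ` {..<n'}"
    proof safe
      fix i assume "i < n"
      then show "y i \<in> z ` {..<n'}" by (intro image_eqI[of _ _ i]) (simp_all add: z1 n'_def)
    next
      fix t assume "t \<in> T"
      then obtain i where "i < length xs" "xs ! i = t" using xs(1) by (metis in_set_conv_nth)
      then show "t \<in> z ` {..<n'}" by (intro image_eqI[of _ _ "n + i"]) (simp_all add: z2 n'_def)
    qed
  qed
  have inj: "inj_on z {..<n'}"
  proof (rule inj_onI)
    fix i j assume ij: "i \<in> {..<n'}" "j \<in> {..<n'}" "z i = z j"
    consider "i < n" "j < n" | "i < n" "\<not> j < n" | "\<not> i < n" "j < n" | "\<not> i < n" "\<not> j < n" by blast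
    then show "i = j"
    proof cases
      case 1
      then show ?thesis using ij(3) z1 y(1) by (simp add: inj_on_def)
    next
      case 2
      then have "z j \<in> T" "z i \<in> y ` {..<n}" using zT[of j] ij(2) z1[of i] by simp_all
      then show ?thesis using ij(3) by (simp add: T_def)
    next
      case 3
      then have "z i \<in> T" "z j \<in> y ` {..<n}" using zT[of i] ij(1) z1[of j] by simp_all
      then show ?thesis using ij(3) by (simp add: T_def)
    next
      case 4
      then have "xs ! (i - n) = xs ! (j - n)" "i - n < length xs" "j - n < length xs"
        using ij by (auto simp: z_def n'_def)
      then have "i - n = j - n" using xs(2) by (simp add: nth_eq_iff_index_eq)
      then show ?thesis using 4 by simp
    qed
  qed
  have imL: "z ` {..<n'} \<subseteq> val_ring w L"
    unfolding img T_def using y(2) b E(2) by auto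
  have "(\<lambda>g. eval_mpol g z) ` mpolys (val_ring w K) n' = val_ring w L"
  proof
    show "(\<lambda>g. eval_mpol g z) ` mpolys (val_ring w K) n' \<subseteq> val_ring w L"
    proof safe
      fix g assume g: "g \<in> mpolys (val_ring w K) n'"
      show "eval_mpol g z \<in> val_ring w L"
        by (rule eval_mpol_closed[OF val_ring_subsemiring[OF w sL] val_ring_mono[OF w KL] g])
           (use imL in auto)
    qed
    show "val_ring w L \<subseteq> (\<lambda>g. eval_mpol g z) ` mpolys (val_ring w K) n'"
    proof
      fix v assume "v \<in> val_ring w L"
      then obtain c where c: "\<forall>i<m. c i \<in> val_ring w K" "v = (\<Sum>i<m. c i * b i)" using gen by blast
      have "\<forall>i<m. \<exists>k<n'. z k = b i"
      proof safe
        fix i assume "i < m"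
        then have "b i \<in> z ` {..<n'}" unfolding img T_def by blast
        then show "\<exists>k<n'. z k = b i" by auto
      qed
      then obtain k where k: "\<And>i. i < m \<Longrightarrow> k i < n' \<and> z (k i) = b i" by metis
      note A = val_ring_subsemiring[OF w sK]
      have "(\<lambda>x. \<Sum>i<m. c i * x (k i)) \<in> poly_funs (val_ring w K) n'"
        using c(1) k by (intro poly_funs_sum[OF A] poly_funs_mult[OF A] poly_funs_const[OF A] poly_funs_coord[OF A]) auto
      then obtain g where g: "g \<in> mpolys (val_ring w K) n'" "(\<lambda>x. \<Sum>i<m. c i * x (k i)) = eval_mpol g"
        unfolding poly_funs_def by blast
      have "v = eval_mpol g z" using fun_cong[OF g(2), of z] c(2) k by simp
      then show "v \<in> (\<lambda>g. eval_mpol g z) ` mpolys (val_ring w K) n'" using g(1) by blast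
    qed
  qed
  then have "generates w K L n' z" using inj imL by (simp add: generates_def)
  moreover have "E \<subseteq> z ` {..<n'}" unfolding img T_def by blast
  moreover have "n \<le> n'" by (simp add: n'_def)
  ultimately show ?thesis using z1 by blast
qed

text \<open>In characteristic p one has (x - y)^q = x^q - y^q.\<close>

lemma frob_power_inj:
  fixes x y :: "'a::field"
  assumes "CHAR('a) > 0" "q = CHAR('a) ^ t" "x ^ q = y ^ q"
  shows "x = y"
proof -
  have pp: "Factorial_Ring.prime CHAR('a)" using prime_CHAR_semidom assms(1) by blast
  have "((x - y) + y) ^ q = (x - y) ^ q + y ^ q" by (rule freshmans_dream'[OF pp assms(2)])
  then have "(x - y) ^ q = 0" using assms(3) by simp
  then show ?thesis by simp
qed

text \<open>\<open>\<theta>\<close> inverts the q-power Frobenius, which is bijective on an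
  algebraically closed field; each homomorphism law is checked after raising to the q-th
  power.\<close>

lemma frob_root_exists:
  assumes char: "CHAR('a::alg_closed_field) > 0" and q: "q = CHAR('a::alg_closed_field) ^ t"
  obtains \<theta> :: "'a::alg_closed_field \<Rightarrow> 'a" where "\<And>x. \<theta> x ^ q = x" "\<And>x y. \<theta> (x + y) = \<theta> x + \<theta> y"
    "\<And>x y. \<theta> (x * y) = \<theta> x * \<theta> y" "\<theta> 1 = 1"
proof -
  have pp: "Factorial_Ring.prime CHAR('a)" using prime_CHAR_semidom char by blast
  have "q > 0" using char q by simp
  then have "\<forall>x::'a. \<exists>y. y ^ q = x" using nth_root_exists by blast
  then obtain \<theta> :: "'a \<Rightarrow> 'a" where \<theta>: "\<And>x. \<theta> x ^ q = x" by metis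
  show ?thesis
  proof
    show "\<theta> x ^ q = x" for x by (rule \<theta>)
    show "\<theta> (x + y) = \<theta> x + \<theta> y" for x y
      by (rule frob_power_inj[OF char q]) (simp add: \<theta> freshmans_dream'[OF pp q])
    show "\<theta> (x * y) = \<theta> x * \<theta> y" for x y
      by (rule frob_power_inj[OF char q]) (simp add: \<theta> power_mult_distrib)
    show "\<theta> 1 = 1"
      by (rule frob_power_inj[OF char q]) (simp add: \<theta>)
  qed
qed

text \<open>The root \<open>\<theta> \<pi>\<close> is a uniformizer of K^(1/q): its value is that of
  \<open>\<pi>\<close> divided by q, and it is s times the value of \<open>\<pi>'\<close>. Hence the
  factor q s.\<close>

lemma strict_ram_index_uniformizers:
  fixes K K' :: "'a::alg_closed_field set"
  assumes char: "CHAR('a) > 0" and w: "valuation w" and s: "strict_ram_index w K K' s"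
    and \<pi>: "uniformizer w K \<pi>" and \<pi>': "uniformizer w K' \<pi>'"
  obtains t where "frob_root t K \<subseteq> K'" "s > 0"
    "w \<pi> = ereal (real (CHAR('a) ^ t) * real s) * w \<pi>'"
proof -
  obtain t where t: "frob_root t K \<subseteq> K'" "s = ram_index w (frob_root t K) K'"
    using s unfolding strict_ram_index_def by blast
  define q where "q = CHAR('a) ^ t"
  obtain \<theta> :: "'a \<Rightarrow> 'a" where \<theta>: "\<And>x. \<theta> x ^ q = x"
    using frob_root_exists[OF char q_def] by metis
  have q0: "q > 0" using char by (simp add: q_def)
  have wq: "w x = ereal (real q) * w (\<theta> x)" for x
    using val_power[OF w, of "\<theta> x" q] \<theta>[of x] by simp
  have mem: "\<theta> x \<in> frob_root t K" if "x \<in> K" for x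
    using that \<theta>[of x] by (simp add: frob_root_def flip: q_def)
  have p: "\<pi> \<in> K" "\<pi> \<noteq> 0" "0 < w \<pi>" "\<forall>x\<in>K - {0}. \<exists>m::int. w x = ereal (of_int m) * w \<pi>"
    using \<pi> by (auto simp: uniformizer_def)
  have t0: "\<theta> \<pi> \<noteq> 0" using \<theta>[of \<pi>] p(2) q0 by (metis power_eq_0_iff)
  then obtain \<delta> where d: "w (\<theta> \<pi>) = ereal \<delta>" using val_real[OF w] by blast
  have d0: "\<delta> > 0" using p(3) wq[of \<pi>] d q0 by (simp add: zero_less_mult_iff)
  have u: "uniformizer w (frob_root t K) (\<theta> \<pi>)"
    unfolding uniformizer_def
  proof (intro conjI ballI)
    fix x assume x: "x \<in> frob_root t K - {0}"
    then have "x ^ q \<in> K - {0}" by (simp add: frob_root_def q_def)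
    then obtain m :: int where m: "w (x ^ q) = ereal (of_int m) * w \<pi>" using p(4) by blast
    obtain r where r: "w x = ereal r" using val_real[OF w, of x] x by blast
    have "real q * r = of_int m * (real q * \<delta>)"
      using m wq[of \<pi>] val_power[OF w, of x q] r d by simp
    then have "r = of_int m * \<delta>" using q0 by simp
    then show "\<exists>m::int. w x = ereal (of_int m) * w (\<theta> \<pi>)" using r d by (intro exI[of _ m]) simp
  qed (use mem[OF p(1)] t0 d d0 in auto)
  have "\<theta> \<pi> \<in> K'" using mem[OF p(1)] t(1) by blast
  then obtain e where e: "w (\<theta> \<pi>) = ereal (real e) * w \<pi>'"
    using uniformizer_val_nat[OF w \<pi>' _ t0] d d0 by auto
  have "s = e" using ram_index_eq[OF w u \<pi>' e] t(2) by simp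
  moreover have "e > 0" using e d d0 by (cases "e = 0") (auto simp: zero_ereal_def[symmetric])
  moreover obtain \<gamma>' where "w \<pi>' = ereal \<gamma>'" using uniformizer_real[OF w \<pi>'] by blast
  then have "w \<pi> = ereal (real q * real e) * w \<pi>'" unfolding wq[of \<pi>] e by simp
  ultimately show ?thesis using that t(1) unfolding q_def by blast
qed

text \<open>The excess \<open>c\<close> of the value of the difference over the common bound
  \<open>b\<close> is preserved by powers: u^m - v^m is u - v times a sum of products of m - 1
  factors u or v.\<close>

lemma power_diff_val_ge:
  assumes w: "valuation w" and u: "ereal b \<le> w u" and v: "ereal b \<le> w v"
    and uv: "ereal (c + b) \<le> w (u - v)" and m: "m > 0"
  shows "ereal (c + real m * b) \<le> w (u ^ m - v ^ m)"
  using m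
proof (induction m)
  case (Suc m)
  show ?case
  proof (cases "m = 0")
    case False
    have pu: "ereal (real m * b) \<le> w (u ^ m)"
      unfolding val_power[OF w] using u by (cases "w u") (auto intro: mult_left_mono)
    have IH: "ereal (c + real m * b) \<le> w (u ^ m - v ^ m)" using Suc.IH False by simp
    have "ereal (c + real (Suc m) * b) = ereal (real m * b) + ereal (c + b)" by (simp add: algebra_simps)
    also have "\<dots> \<le> w (u ^ m * (u - v))" unfolding val_mult[OF w] by (rule add_mono[OF pu uv])
    finally have 1: "ereal (c + real (Suc m) * b) \<le> w (u ^ m * (u - v))" .
    have "ereal (c + real (Suc m) * b) = ereal (c + real m * b) + ereal b" by (simp add: algebra_simps)
    also have "\<dots> \<le> w ((u ^ m - v ^ m) * v)" unfolding val_mult[OF w] by (rule add_mono[OF IH v])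
    finally have 2: "ereal (c + real (Suc m) * b) \<le> w ((u ^ m - v ^ m) * v)" .
    have "u ^ Suc m - v ^ Suc m = u ^ m * (u - v) + (u ^ m - v ^ m) * v" by (simp add: algebra_simps)
    then show ?thesis using val_add_ge[OF w 1 2] by simp
  qed (use uv in simp)
qed simp

section \<open>The maps between the domains of Abbes and Saito\<close>

text \<open>\<open>\<theta>\<close> is the q-th root map, and \<open>\<gamma>\<close> the unit in
  which values over \<open>K'\<close> are measured; the unit over \<open>K\<close> is q s
  \<gamma>.\<close>

locale insep_setting =
  fixes w :: "'a::alg_closed_field \<Rightarrow> ereal" and K K' :: "'a set" and \<pi> \<pi>' :: 'a
    and \<gamma> :: real and s q t :: nat and \<theta> :: "'a \<Rightarrow> 'a"
  assumes char: "CHAR('a) > 0" and w: "valuation w"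
    and K: "complete_dvf w K" and K': "complete_dvf w K'" and KK': "K \<subseteq> K'"
    and \<pi>: "uniformizer w K \<pi>" and \<pi>': "uniformizer w K' \<pi>'"
    and w\<pi>': "w \<pi>' = ereal \<gamma>" and w\<pi>: "w \<pi> = ereal (real q * real s * \<gamma>)" and s: "s > 0"
    and q: "q = CHAR('a) ^ t" and root: "frob_root t K \<subseteq> K'"
    and \<theta>: "\<And>x. \<theta> x ^ q = x" "\<And>x y. \<theta> (x + y) = \<theta> x + \<theta> y" "\<And>x y. \<theta> (x * y) = \<theta> x * \<theta> y" "\<theta> 1 = 1"
begin

lemma sK: "is_subfield K" and sK': "is_subfield K'"
  using K K' by (simp_all add: complete_dvf_def)

lemma q0: "q > 0" and \<gamma>0: "\<gamma> > 0" and \<pi>0: "\<pi> \<noteq> 0" "\<pi> \<in> K" "\<pi>' \<noteq> 0" "\<pi>' \<in> K'"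
  using char q \<pi> \<pi>' w\<pi>' by (auto simp: uniformizer_def)

lemma \<theta>_K: "x \<in> K \<Longrightarrow> \<theta> x \<in> K'"
  using root \<theta>(1)[of x] by (auto simp: frob_root_def q)

lemma frob_inj: "x ^ q = y ^ q \<Longrightarrow> x = (y::'a)"
  using frob_power_inj[OF char q] .

lemma w_power_q: "ereal r \<le> w x \<longleftrightarrow> ereal (real q * r) \<le> w (x ^ q)"
  unfolding val_power[OF w] by (cases "w x") (use q0 in auto)

lemma \<theta>_ge: "0 \<le> w x \<Longrightarrow> 0 \<le> w (\<theta> x)"
  using w_power_q[of 0 "\<theta> x"] by (simp add: \<theta>(1) zero_ereal_def)

lemma nval_K: "ereal r \<le> nval w K x \<longleftrightarrow> ereal (r * (real q * real s * \<gamma>)) \<le> w x"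
  by (rule nval_ge_iff[OF w \<pi> w\<pi>])

lemma nval_K': "ereal r \<le> nval w K' x \<longleftrightarrow> ereal (r * \<gamma>) \<le> w x"
  by (rule nval_ge_iff[OF w \<pi>' w\<pi>'])

lemma val_ring_K': "is_subsemiring (val_ring w K')"
  by (rule val_ring_subsemiring[OF w sK'])

text \<open>K^(1/q) lies in \<open>K'\<close>, and a root of an integral element is integral, so the
  coefficientwise root of \<open>g\<close> is an integral polynomial over \<open>K'\<close>.\<close>

lemma root_poly:
  assumes "g \<in> mpolys (val_ring w K) n" "n \<le> n'"
  shows "\<exists>g'\<in>mpolys (val_ring w K') n'. \<forall>x. eval_mpol g' x ^ q = eval_mpol g (\<lambda>i\<in>{..<n}. x i ^ q)"
proof -
  have "\<exists>a\<in>val_ring w K'. a ^ q = b" if "b \<in> val_ring w K" for b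
    using that \<theta>_K[of b] \<theta>_ge[of b] \<theta>(1)[of b] by (auto simp: val_ring_def)
  then obtain f where f: "f \<in> poly_funs (val_ring w K') n'" "\<forall>x. f x ^ q = eval_mpol g (\<lambda>i. x i ^ q)"
    using mpolys_frob_root[OF val_ring_K' char q assms(1) _ assms(2)] by blast
  moreover have "eval_mpol g (\<lambda>i. x i ^ q) = eval_mpol g (\<lambda>i\<in>{..<n}. x i ^ q)" for x
    by (rule eval_mpol_cong[OF assms(1)]) simp
  ultimately show ?thesis unfolding poly_funs_def by auto
qed

section \<open>The q-power map sends the domains over K' into those over K\<close>

context
  fixes n n' :: nat and z z' :: "nat \<Rightarrow> 'a" and a :: rat
  assumes n: "n \<le> n'" and z: "\<And>i. i < n \<Longrightarrow> z i = z' i ^ q"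
begin

lemma AS_X_image:
  assumes x: "x \<in> AS_X w K' n' z' (of_nat s * a)"
  shows "(\<lambda>i\<in>{..<n}. x i ^ q) \<in> AS_X w K n z a"
  unfolding AS_X_def
proof (intro CollectI conjI ballI)
  have xp: "x \<in> {..<n'} \<rightarrow>\<^sub>E {y. 0 \<le> w y}" and
    xg: "\<And>g. g \<in> rel_ideal w K' n' z' \<Longrightarrow> ereal (of_rat (of_nat s * a)) \<le> nval w K' (eval_mpol g x)"
    using x by (auto simp: AS_X_def unit_polydisc_def)
  show "(\<lambda>i\<in>{..<n}. x i ^ q) \<in> unit_polydisc w n"
    unfolding unit_polydisc_def
  proof (rule restrict_PiE_iff[THEN iffD2], rule ballI)
    fix i assume "i \<in> {..<n}"
    then have "0 \<le> w (x i)" using xp n by (auto simp: PiE_iff)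
    then show "x i ^ q \<in> {y. 0 \<le> w y}" using w_power_q[of 0 "x i"] by (simp add: zero_ereal_def)
  qed
  fix g assume "g \<in> rel_ideal w K n z"
  then have g: "g \<in> mpolys (val_ring w K) n" "eval_mpol g z = 0" by (auto simp: rel_ideal_def)
  obtain g' where g': "g' \<in> mpolys (val_ring w K') n'"
    "\<forall>x. eval_mpol g' x ^ q = eval_mpol g (\<lambda>i\<in>{..<n}. x i ^ q)" using root_poly[OF g(1) n] by blast
  have "eval_mpol g (\<lambda>i\<in>{..<n}. z' i ^ q) = eval_mpol g z"
    by (rule eval_mpol_cong[OF g(1)]) (simp add: z)
  then have "eval_mpol g' z' ^ q = 0" using g'(2) g(2) by simp
  then have "g' \<in> rel_ideal w K' n' z'" using g'(1) by (simp add: rel_ideal_def)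
  \<comment> \<open>Level s a over \<open>K'\<close> is the value s a \<gamma>. The q-th power
    brings it to a q s \<gamma>, which is level a over \<open>K\<close>.\<close>
  then have "ereal (real s * of_rat a * \<gamma>) \<le> w (eval_mpol g' x)"
    using xg nval_K' by (simp add: of_rat_mult)
  then have "ereal (real q * (real s * of_rat a * \<gamma>)) \<le> w (eval_mpol g (\<lambda>i\<in>{..<n}. x i ^ q))"
    using g'(2) w_power_q[of "real s * of_rat a * \<gamma>" "eval_mpol g' x"] by simp
  then show "ereal (of_rat a) \<le> nval w K (eval_mpol g (\<lambda>i\<in>{..<n}. x i ^ q))"
    unfolding nval_K by (simp add: mult_ac)
qed

text \<open>
  The logarithmic conditions over \<open>K'\<close> for \<open>z'\<^sub>k\<close> and a uniformizer \<open>z'\<^sub>j\<close> of \<open>L'\<close> imply the one over \<open>K\<close>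
  for the uniformizer \<open>z\<^sub>k\<close> of \<open>L\<close>: with \<open>\<theta> \<pi> = u \<pi>'\<^sup>s\<close> one has
  \<open>x\<^sub>k\<^sup>e \<equiv> x\<^sub>j\<^bsup>de\<^esup> g\<^sup>e = x\<^sub>j\<^bsup>e's\<^esup> g\<^sup>e \<equiv> \<pi>'\<^sup>s h'\<^sup>s g\<^sup>e\<close>, and \<open>h'\<^sup>s g\<^sup>e - u h\<close> vanishes at \<open>z'\<close>.
\<close>
lemma log_condition:
  assumes x: "x \<in> AS_X w K' n' z' (of_nat s * a)" and a: "a \<ge> 0"
    and k: "k < n" and zj: "z' j \<noteq> 0"
    and h: "h \<in> mpolys (val_ring w K) n" "eval_mpol h z = z k ^ e / \<pi>"
    and h': "h' \<in> mpolys (val_ring w K') n'" "eval_mpol h' z' = z' j ^ e' / \<pi>'"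
    and g: "g \<in> mpolys (val_ring w K') n'" "eval_mpol g z' = z' k / z' j ^ d"
    and e: "e * d = s * e'" "e > 0" "e' > 0"
    and A: "ereal (of_rat (of_nat s * a) + 1) \<le> nval w K' (x j ^ e' - \<pi>' * eval_mpol h' x)"
    and B: "ereal (of_rat (of_nat s * a) + real d / real e') \<le> nval w K' (x k - x j ^ d * eval_mpol g x)"
  shows "ereal (of_rat a + 1) \<le> nval w K ((x k ^ q) ^ e - \<pi> * eval_mpol h (\<lambda>i\<in>{..<n}. x i ^ q))"
proof -
  define c where "c = real s * real_of_rat a * \<gamma>"
  have c0: "c \<ge> 0" using a \<gamma>0 by (simp add: c_def)
  have xp: "x \<in> {..<n'} \<rightarrow>\<^sub>E {y. 0 \<le> w y}" and
    xg: "\<And>g. g \<in> rel_ideal w K' n' z' \<Longrightarrow> ereal (of_rat (of_nat s * a)) \<le> nval w K' (eval_mpol g x)"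
    using x by (auto simp: AS_X_def unit_polydisc_def)
  have A': "ereal (c + \<gamma>) \<le> w (x j ^ e' - \<pi>' * eval_mpol h' x)"
    using A unfolding nval_K' by (simp add: c_def of_rat_mult algebra_simps)
  have B': "ereal (c + real d / real e' * \<gamma>) \<le> w (x k - x j ^ d * eval_mpol g x)"
    using B unfolding nval_K' by (simp add: c_def of_rat_mult algebra_simps)
  have int: "0 \<le> w (eval_mpol f x)" if f: "f \<in> mpolys (val_ring w K') n'" for f
  proof -
    have "is_subsemiring {y. 0 \<le> w y}"
      unfolding is_subsemiring_def
      by (auto simp: val_zero[OF w] val_one[OF w] val_mult[OF w] intro: val_add_ge[OF w])
    then have "eval_mpol f x \<in> {y. 0 \<le> w y}"
      by (rule eval_mpol_closed[OF _ _ f]) (use xp in \<open>auto simp: val_ring_def PiE_iff\<close>)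
    then show ?thesis by simp
  qed
  let ?hx = "eval_mpol h' x" and ?gx = "eval_mpol g x"
  have hx: "ereal \<gamma> \<le> w (\<pi>' * ?hx)"
    using int[OF h'(1)] w\<pi>' unfolding val_mult[OF w] by (cases "w ?hx") auto
  \<comment> \<open>The difference and \<open>\<pi>' * ?hx\<close> both have value at least
    \<open>\<gamma>\<close>, hence so has \<open>x j ^ e'\<close>; this bounds the value of
    \<open>x j\<close> below by \<open>\<gamma> / e'\<close>.\<close>
  have "ereal \<gamma> \<le> w (x j ^ e' - \<pi>' * ?hx)" by (rule order_trans[OF _ A']) (use c0 in simp)
  from val_add_ge[OF w this hx] have xje: "ereal \<gamma> \<le> w (x j ^ e')" by simp
  then have xj: "ereal (\<gamma> / real e') \<le> w (x j)"
    unfolding val_power[OF w] using e(3) by (cases "w (x j)") (auto simp: field_simps)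
  \<comment> \<open>The expected lower bound for the value of \<open>x k\<close>, namely
    \<open>d\<close> times the bound for \<open>x j\<close>.\<close>
  define b where "b = real d / real e' * \<gamma>"
  have b0: "b \<ge> 0" using \<gamma>0 by (simp add: b_def)
  have xd: "ereal b \<le> w (x j ^ d)"
    using val_power_ge[OF w xj, of d] by (simp add: b_def)
  have v0: "ereal b \<le> w (x j ^ d * ?gx)"
    by (rule val_mult_ge[OF w xd int[OF g(1)]])
  have "ereal b \<le> w (x k - x j ^ d * ?gx)"
    by (rule order_trans[OF _ B'[folded b_def]]) (use c0 in simp)
  from val_add_ge[OF w this v0] have u0: "ereal b \<le> w (x k)" by simp
  \<comment> \<open>The precision \<open>c\<close> beyond the common bound \<open>b\<close> survives
    the e-th power, and \<open>e * b\<close> is the value of \<open>\<pi>' ^ s\<close> because e d =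
    s e'.\<close>
  have "ereal (c + real e * b) \<le> w (x k ^ e - (x j ^ d * ?gx) ^ e)"
    by (rule power_diff_val_ge[OF w u0 v0 _ e(2)]) (use B' in \<open>simp add: b_def\<close>)
  moreover have eb: "real e * b = real s * \<gamma>"
  proof -
    have "real e * real d = real s * real e'" using e(1) by (metis of_nat_mult)
    then show ?thesis using e(3) by (simp add: b_def field_simps)
  qed
  ultimately have 1: "ereal (c + real s * \<gamma>) \<le> w (x k ^ e - (x j ^ d * ?gx) ^ e)" by simp
  have "ereal (c + real s * \<gamma>) \<le> w ((x j ^ e') ^ s - (\<pi>' * ?hx) ^ s)"
    by (rule power_diff_val_ge[OF w xje hx A' s])
  moreover have "0 \<le> w (?gx ^ e)" unfolding val_power[OF w] using int[OF g(1)] by simp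
  ultimately have 2: "ereal (c + real s * \<gamma>) \<le> w (((x j ^ e') ^ s - (\<pi>' * ?hx) ^ s) * ?gx ^ e)"
    by (rule val_mult_ge[OF w])
  obtain H where H: "H \<in> mpolys (val_ring w K') n'"
    "\<forall>x. eval_mpol H x ^ q = eval_mpol h (\<lambda>i\<in>{..<n}. x i ^ q)" using root_poly[OF h(1) n] by blast
  \<comment> \<open>The unit of the valuation ring of \<open>K'\<close> by which the two elements
    \<open>\<theta> \<pi>\<close> and \<open>\<pi>' ^ s\<close> of equal value differ.\<close>
  define u where "u = \<theta> \<pi> / \<pi>' ^ s"
  have "ereal (real q) * w (\<theta> \<pi>) = ereal (real q * (real s * \<gamma>))"
    unfolding val_power[OF w, symmetric] \<theta>(1) w\<pi> by (simp add: mult.assoc)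
  then have w\<theta>: "w (\<theta> \<pi>) = ereal (real s * \<gamma>)" using q0 by (cases "w (\<theta> \<pi>)") simp_all
  have "\<theta> \<pi> \<noteq> 0"
  proof
    assume "\<theta> \<pi> = 0"
    then have "\<theta> \<pi> ^ q = 0" using q0 by simp
    then show False using \<theta>(1)[of \<pi>] \<pi>0(1) by simp
  qed
  then have p0: "\<pi>' ^ s \<noteq> 0" "\<theta> \<pi> \<noteq> 0" using \<pi>0(3) by simp_all
  have wps: "w (\<pi>' ^ s) = ereal (real s * \<gamma>)" by (simp add: val_power[OF w] w\<pi>')
  have "w u = 0" unfolding u_def val_divide[OF w p0(1)] w\<theta> wps by (simp add: zero_ereal_def)
  moreover have "u \<in> K'" unfolding u_def
    by (intro subfield_divide[OF sK'] subfield_power[OF sK'] \<theta>_K \<pi>0)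
  ultimately have uK: "- u \<in> val_ring w K'"
    by (simp add: val_ring_def val_uminus[OF w] subfield_uminus[OF sK'])
  note V = val_ring_K'
  have "eval_mpol f \<in> poly_funs (val_ring w K') n'" if "f \<in> mpolys (val_ring w K') n'" for f
    using that by (simp add: poly_funs_def)
  then have "(\<lambda>y. eval_mpol h' y ^ s * eval_mpol g y ^ e + (- u) * eval_mpol H y) \<in> poly_funs (val_ring w K') n'"
    by (intro poly_funs_add[OF V] poly_funs_mult[OF V] poly_funs_power[OF V] poly_funs_const[OF V] uK)
       (use h' g H in auto)
  then obtain R where R: "R \<in> mpolys (val_ring w K') n'"
    "(\<lambda>y. eval_mpol h' y ^ s * eval_mpol g y ^ e + (- u) * eval_mpol H y) = eval_mpol R"
    unfolding poly_funs_def by blast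
  have R': "eval_mpol R y = eval_mpol h' y ^ s * eval_mpol g y ^ e - u * eval_mpol H y" for y
    using fun_cong[OF R(2), of y] by simp
  have Hz: "eval_mpol H z' = z' k ^ e / \<theta> \<pi>"
  proof (rule frob_inj)
    have "eval_mpol h (\<lambda>i\<in>{..<n}. z' i ^ q) = eval_mpol h z"
      by (rule eval_mpol_cong[OF h(1)]) (simp add: z)
    then have "eval_mpol H z' ^ q = (z' k ^ q) ^ e / \<pi>" using H(2) h(2) z[OF k] by simp
    then show "eval_mpol H z' ^ q = (z' k ^ e / \<theta> \<pi>) ^ q"
      by (simp add: power_divide \<theta>(1) mult.commute flip: power_mult)
  qed
  \<comment> \<open>The powers of \<open>z' j\<close> cancel because e d = s e'. As \<open>R\<close>
    is thus a relation between the z', membership of \<open>x\<close> in \<open>AS_X\<close> bounds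
    the value of R at \<open>x\<close>.\<close>
  have "eval_mpol R z' = 0"
  proof -
    have "eval_mpol h' z' ^ s * eval_mpol g z' ^ e = z' j ^ (e' * s) * z' k ^ e / (\<pi>' ^ s * z' j ^ (d * e))"
      unfolding h'(2) g(2) by (simp add: power_divide power_mult)
    also have "\<dots> = z' k ^ e / \<pi>' ^ s"
      using e(1) zj by (simp add: mult.commute)
    also have "\<dots> = u * eval_mpol H z'" using p0 by (simp add: u_def Hz)
    finally show ?thesis by (simp add: R')
  qed
  then have "R \<in> rel_ideal w K' n' z'" using R(1) by (simp add: rel_ideal_def)
  then have "ereal c \<le> w (eval_mpol R x)" using xg nval_K' by (simp add: of_rat_mult c_def)
  then have 3: "ereal (c + real s * \<gamma>) \<le> w (\<pi>' ^ s * eval_mpol R x)"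
    unfolding val_mult[OF w] wps by (cases "w (eval_mpol R x)") auto
  \<comment> \<open>The three estimates telescope to the q-th root of the wanted difference.\<close>
  have eq: "(x k ^ e - (x j ^ d * ?gx) ^ e) + ((x j ^ e') ^ s - (\<pi>' * ?hx) ^ s) * ?gx ^ e + \<pi>' ^ s * eval_mpol R x
      = x k ^ e - \<theta> \<pi> * eval_mpol H x"
  proof -
    have "(x j ^ d) ^ e = (x j ^ e') ^ s" unfolding power_mult[symmetric] using e(1) by (simp add: mult.commute)
    moreover have "\<theta> \<pi> = \<pi>' ^ s * u" using p0 by (simp add: u_def)
    ultimately show ?thesis by (simp add: R' power_mult_distrib algebra_simps)
  qed
  have "ereal (c + real s * \<gamma>) \<le> w (x k ^ e - \<theta> \<pi> * eval_mpol H x)"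
    using val_add_ge[OF w val_add_ge[OF w 1 2] 3] unfolding eq .
  \<comment> \<open>Since c + s \<gamma> is s \<gamma> (a + 1), the q-th power has value at least (a
    + 1) times that of \<open>\<pi>\<close>.\<close>
  then have "ereal (real q * (c + real s * \<gamma>)) \<le> w ((x k ^ e - \<theta> \<pi> * eval_mpol H x) ^ q)"
    by (rule w_power_q[THEN iffD1])
  moreover have "(x k ^ e - \<theta> \<pi> * eval_mpol H x) ^ q = (x k ^ q) ^ e - \<pi> * eval_mpol h (\<lambda>i\<in>{..<n}. x i ^ q)"
  proof -
    have pp: "Factorial_Ring.prime CHAR('a)" using prime_CHAR_semidom char by blast
    have "((x k ^ e - \<theta> \<pi> * eval_mpol H x) + \<theta> \<pi> * eval_mpol H x) ^ q
        = (x k ^ e - \<theta> \<pi> * eval_mpol H x) ^ q + (\<theta> \<pi> * eval_mpol H x) ^ q"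
      by (rule freshmans_dream'[OF pp q])
    then show ?thesis using H(2) by (simp add: power_mult_distrib \<theta>(1) mult.commute flip: power_mult)
  qed
  ultimately show ?thesis unfolding nval_K by (simp add: c_def algebra_simps)
qed

end

text \<open>The first \<open>n\<close> members of \<open>z'\<close> are the roots
  \<open>\<theta> (z i)\<close>. The set \<open>E\<close> lets a uniformizer of \<open>L\<close> be
  included downstairs; upstairs a uniformizer of \<open>L'\<close> is always included.\<close>

lemma lift_generators:
  assumes L: "fin_sep_ext K L" and E: "finite E" "E \<subseteq> val_ring w L"
  shows "\<exists>L' n z n' z'. fin_sep_ext K' L' \<and> generates w K L n z \<and> generates w K' L' n' z' \<and> n \<le> n' \<and>
    (\<forall>i<n. z i = z' i ^ q) \<and> E \<subseteq> z ` {..<n} \<and> (\<exists>j<n'. uniformizer w L' (z' j))"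
proof -
  have fL: "fin_ext K L" using L by (simp add: fin_sep_ext_def)
  \<comment> \<open>Downstairs no positions are prescribed, so the given initial family is
    empty.\<close>
  have "\<exists>n z. 0 \<le> n \<and> (\<forall>i<0. z i = 0) \<and> E \<subseteq> z ` {..<n} \<and> generates w K L n z"
    by (rule generates_exists[OF w K fL _ _ E]) simp_all
  then obtain n z where z: "E \<subseteq> z ` {..<n}" "generates w K L n z" by (elim exE conjE)
  have zL: "inj_on z {..<n}" "\<And>i. i < n \<Longrightarrow> z i \<in> val_ring w L"
    using z(2) by (auto simp: generates_def)
  have "\<theta> ` K \<subseteq> K'" using \<theta>_K by blast
  from fin_sep_ext_transfer[OF sK sK' char \<theta>(2,3,4) this L]
  obtain L' where L': "fin_sep_ext K' L'" "\<theta> ` L \<subseteq> L'" by (elim exE conjE)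
  have fL': "fin_ext K' L'" using L'(1) by (simp add: fin_sep_ext_def)
  obtain \<omega> where \<omega>: "uniformizer w L' \<omega>" using uniformizer_exists[OF w \<pi>' sK' fL'] by blast
  have inj: "inj_on (\<lambda>i. \<theta> (z i)) {..<n}"
  proof (rule inj_onI)
    fix i j assume ij: "i \<in> {..<n}" "j \<in> {..<n}" "\<theta> (z i) = \<theta> (z j)"
    from arg_cong[OF this(3), of "\<lambda>x. x ^ q"] have "z i = z j" by (simp add: \<theta>(1))
    then show "i = j" using zL(1) ij(1,2) by (simp add: inj_on_def)
  qed
  have \<theta>z: "\<theta> (z i) \<in> val_ring w L'" if "i < n" for i
  proof -
    have "z i \<in> L" "0 \<le> w (z i)" using zL(2)[OF that] by (simp_all add: val_ring_def)
    then have "\<theta> (z i) \<in> L'" "0 \<le> w (\<theta> (z i))" using L'(2) \<theta>_ge by blast+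
    then show ?thesis by (simp add: val_ring_def)
  qed
  have \<omega>L: "{\<omega>} \<subseteq> val_ring w L'" using \<omega> by (auto simp: uniformizer_def val_ring_def)
  have "\<exists>n' z'. n \<le> n' \<and> (\<forall>i<n. z' i = \<theta> (z i)) \<and> {\<omega>} \<subseteq> z' ` {..<n'} \<and> generates w K' L' n' z'"
    by (rule generates_exists[OF w K' fL' inj \<theta>z _ \<omega>L]) simp_all
  then obtain n' z' where z': "n \<le> n'" "\<forall>i<n. z' i = \<theta> (z i)" "{\<omega>} \<subseteq> z' ` {..<n'}"
    "generates w K' L' n' z'" by (elim exE conjE)
  have "\<exists>j<n'. uniformizer w L' (z' j)" using z'(3) \<omega> by auto
  moreover have "\<forall>i<n. z i = z' i ^ q" using z'(2) \<theta>(1) by simp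
  ultimately show ?thesis using L'(1) z z' by blast
qed

lemma AS_X_data:
  assumes G: "is_ram_group w K a G" and G': "is_ram_group w K' (of_nat s * a) G'"
    and a: "a > 0" and L: "fin_sep_ext K L"
  shows "\<exists>n z D L' n' z' D'. fin_sep_ext K' L' \<and>
      identifies_pi0 w K L G n z D \<and> identifies_pi0 w K' L' G' n' z' D' \<and> n \<le> n' \<and>
      (\<forall>i<n. z i \<in> L \<and> z i = z' i ^ q) \<and> (\<forall>i<n'. z' i \<in> L') \<and>
      (\<lambda>x. \<lambda>i\<in>{..<n}. x i ^ q) ` D' \<subseteq> D"
proof -
  obtain L' n z n' z' where L': "fin_sep_ext K' L'" and z: "generates w K L n z" and
    z': "generates w K' L' n' z'" and n: "n \<le> n'" and zz': "\<forall>i<n. z i = z' i ^ q"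
    using lift_generators[OF L, of "{}"] by (elim meta_impE exE conjE) simp_all
  have "identifies_pi0 w K L G n z (AS_X w K n z a)"
    using G a L z by (simp add: is_ram_group_def)
  moreover have "identifies_pi0 w K' L' G' n' z' (AS_X w K' n' z' (of_nat s * a))"
    using G' a s L' z' by (simp add: is_ram_group_def)
  moreover have "(\<lambda>x. \<lambda>i\<in>{..<n}. x i ^ q) ` AS_X w K' n' z' (of_nat s * a) \<subseteq> AS_X w K n z a"
    using AS_X_image[OF n] zz' by blast
  moreover have "\<forall>i<n. z i \<in> L \<and> z i = z' i ^ q" "\<forall>i<n'. z' i \<in> L'"
    using z z' zz' by (auto simp: generates_def val_ring_def)
  ultimately show ?thesis using L' n by blast
qed

text \<open>The logarithmic groups are characterized by all admissible \<open>P\<close> and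
  liftings, so the most convenient ones may be picked on each side. The uniformizer of
  \<open>L'\<close> in \<open>P'\<close> links the root of the uniformizer of \<open>L\<close> with
  \<open>\<pi>'\<close>.\<close>

lemma AS_Y_data:
  assumes G: "is_log_ram_group w K a G" and G': "is_log_ram_group w K' (of_nat s * a) G'"
    and a: "a > 0" and L: "fin_sep_ext K L"
  shows "\<exists>n z D L' n' z' D'. fin_sep_ext K' L' \<and>
      identifies_pi0 w K L G n z D \<and> identifies_pi0 w K' L' G' n' z' D' \<and> n \<le> n' \<and>
      (\<forall>i<n. z i \<in> L \<and> z i = z' i ^ q) \<and> (\<forall>i<n'. z' i \<in> L') \<and>
      (\<lambda>x. \<lambda>i\<in>{..<n}. x i ^ q) ` D' \<subseteq> D"
proof -
  have fL: "fin_ext K L" using L by (simp add: fin_sep_ext_def)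
  have sL: "is_subfield L" "K \<subseteq> L" using fL by (auto simp: fin_ext_def)
  obtain \<omega> where \<omega>: "uniformizer w L \<omega>" using uniformizer_exists[OF w \<pi> sK fL] by blast
  have \<omega>0: "\<omega> \<in> L" "\<omega> \<noteq> 0" "0 < w \<omega>" using \<omega> by (auto simp: uniformizer_def)
  have \<omega>L: "{\<omega>} \<subseteq> val_ring w L" using \<omega>0 by (simp add: val_ring_def)
  obtain L' n z n' z' j where L': "fin_sep_ext K' L'" and z: "generates w K L n z" and
    z': "generates w K' L' n' z'" and n: "n \<le> n'" and zz': "\<forall>i<n. z i = z' i ^ q" and
    \<omega>z: "{\<omega>} \<subseteq> z ` {..<n}" and j: "j < n'" "uniformizer w L' (z' j)"
    using lift_generators[OF L finite.insertI[OF finite.emptyI] \<omega>L] by (elim exE conjE)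
  obtain k where k: "k < n" "z k = \<omega>" using \<omega>z by auto
  have k': "k < n'" using k n by simp
  have zk: "z k = z' k ^ q" using zz' k by simp
  have sL': "is_subfield L'" "K' \<subseteq> L'" using L' by (auto simp: fin_sep_ext_def fin_ext_def)
  have zL': "z' i \<in> L'" "0 \<le> w (z' i)" if "i < n'" for i
    using z' that by (auto simp: generates_def val_ring_def)
  have zj: "z' j \<noteq> 0" using j by (simp add: uniformizer_def)
  have zk0: "z' k \<noteq> 0" using \<omega>0(2) k(2) zk q0 by auto
  obtain \<delta> where \<delta>: "\<delta> > 0" "w (z' j) = ereal \<delta>" using uniformizer_real[OF w j(2)] by blast
  obtain \<beta> where \<beta>: "\<beta> > 0" "w \<omega> = ereal \<beta>" using uniformizer_real[OF w \<omega>] by blast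
  have wK: "0 < w \<pi>" "0 < w \<pi>'" using \<pi> \<pi>' by (auto simp: uniformizer_def)
  obtain e where e: "w \<pi> = ereal (real e) * w \<omega>"
    using uniformizer_val_nat[OF w \<omega> subsetD[OF sL(2) \<pi>0(2)] \<pi>0(1) order_less_imp_le[OF wK(1)]] by blast
  obtain e' where e': "w \<pi>' = ereal (real e') * w (z' j)"
    using uniformizer_val_nat[OF w j(2) subsetD[OF sL'(2) \<pi>0(4)] \<pi>0(3) order_less_imp_le[OF wK(2)]] by blast
  obtain d where d: "w (z' k) = ereal (real d) * w (z' j)"
    using uniformizer_val_nat[OF w j(2) zL'(1)[OF k'] zk0 zL'(2)[OF k']] by blast
  have \<gamma>e: "real q * real s * \<gamma> = real e * \<beta>" using e \<beta> w\<pi> by simp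
  have \<gamma>e': "\<gamma> = real e' * \<delta>" using e' \<delta> w\<pi>' by simp
  have \<beta>d: "\<beta> = real q * (real d * \<delta>)"
    using val_power[OF w, of "z' k" q] d \<delta> \<beta> zk k(2) by simp
  have epos: "e > 0" "e' > 0"
    using \<gamma>e \<gamma>e' \<gamma>0 q0 s by (auto intro!: Nat.gr0I)
  \<comment> \<open>Up to the factor \<open>q\<close>, both sides give the value of
    \<open>\<theta> \<pi>\<close>: once through the root \<open>z' k\<close> of the uniformizer of
    \<open>L\<close>, once through \<open>\<pi>'\<close>.\<close>
  have "real q * \<delta> * (real e * real d) = real q * \<delta> * (real s * real e')"
    using \<gamma>e unfolding \<gamma>e' \<beta>d by (auto simp: mult_ac)
  then have "real (e * d) = real (s * e')" using q0 \<delta> by simp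
  then have ed: "e * d = s * e'" by linarith
  have eK: "ram_index w K L = e" by (rule ram_index_eq[OF w \<pi> \<omega> e])
  have eK': "ram_index w K' L' = e'" by (rule ram_index_eq[OF w \<pi>' j(2) e'])
  have nk: "nval_nat w L (z k) = 1" by (rule nval_nat_eq[OF w \<omega>]) (simp add: k(2) one_ereal_def[symmetric])
  have nj': "nval_nat w L' (z' j) = 1" by (rule nval_nat_eq[OF w j(2)]) (simp add: one_ereal_def[symmetric])
  have nk': "nval_nat w L' (z' k) = d" by (rule nval_nat_eq[OF w j(2) d])
  have lift: "\<exists>g. g \<in> mpolys (val_ring w K) n \<and> eval_mpol g z = y" if "y \<in> val_ring w L" for y
    using z that unfolding generates_def by (metis (no_types, lifting) imageE)
  have lift': "\<exists>g. g \<in> mpolys (val_ring w K') n' \<and> eval_mpol g z' = y" if "y \<in> val_ring w L'" for y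
    using z' that unfolding generates_def by (metis (no_types, lifting) imageE)
  have "z k ^ e / \<pi> \<in> L" using sL \<pi>0(2) \<omega>0(1) k(2)
    by (intro subfield_divide[OF sL(1)] subfield_power[OF sL(1)]) auto
  moreover have "w (z k ^ e / \<pi>) = 0"
    unfolding val_divide[OF w \<pi>0(1)] val_power[OF w] e k(2) \<beta>(2) by (simp add: zero_ereal_def)
  ultimately have "z k ^ e / \<pi> \<in> val_ring w L" by (simp add: val_ring_def)
  from lift[OF this] obtain h0 where h0: "h0 \<in> mpolys (val_ring w K) n" "eval_mpol h0 z = z k ^ e / \<pi>" by blast
  \<comment> \<open>The constant polynomial 1 lifts the unit belonging to the only pair (k, k) over
    \<open>K\<close>.\<close>
  define c where "c = Poly_Mapping.single (0 :: nat \<Rightarrow>\<^sub>0 nat) (1 :: 'a)"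
  have c: "c \<in> mpolys (val_ring w K) n" "eval_mpol c x = 1" for x
  proof -
    show "c \<in> mpolys (val_ring w K) n" unfolding c_def
      by (rule mpolys_single[OF val_ring_subsemiring[OF w sK]])
         (simp_all add: val_ring_def val_one[OF w] subfield_one[OF sK])
    have "eval_mpol c x = 1 * monomial_fun 0 x" unfolding c_def by (rule eval_mpol_single)
    then show "eval_mpol c x = 1" by (simp add: monomial_fun_def)
  qed
  have LD: "log_data w K L n z {k} \<pi> (\<lambda>_. h0) (\<lambda>_ _. c)"
    unfolding log_data_def using k \<omega> \<omega>0(2) \<pi> h0 c by (simp add: nk[unfolded k(2)] eK)
  let ?P = "{k, j}"
  let ?v = "\<lambda>i. nval_nat w L' (z' i)"
  have P: "i < n'" "z' i \<noteq> 0" "w (z' i) = ereal (real (?v i) * \<delta>)" if "i \<in> ?P" for i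
    using that k' j(1) zj zk0 d \<delta> by (auto simp: nk' nj')
  have v1: "z' i ^ e' / \<pi>' ^ ?v i \<in> val_ring w L'" if i: "i \<in> ?P" for i
  proof -
    have "z' i ^ e' / \<pi>' ^ ?v i \<in> L'" using sL'(2) \<pi>0(4) zL'(1)[OF P(1)[OF i]]
      by (intro subfield_divide[OF sL'(1)] subfield_power[OF sL'(1)]) auto
    moreover have "w (z' i ^ e' / \<pi>' ^ ?v i) = 0"
    proof -
      have "\<pi>' ^ ?v i \<noteq> 0" using \<pi>0(3) by simp
      then show ?thesis
        unfolding val_divide[OF w \<open>\<pi>' ^ ?v i \<noteq> 0\<close>] val_power[OF w] P(3)[OF i] w\<pi>' \<gamma>e'
        by (simp add: zero_ereal_def mult_ac)
    qed
    ultimately show ?thesis by (simp add: val_ring_def)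
  qed
  have v2: "z' i ^ ?v l / z' l ^ ?v i \<in> val_ring w L'" if i: "i \<in> ?P" and l: "l \<in> ?P" for i l
  proof -
    have "z' i ^ ?v l / z' l ^ ?v i \<in> L'" using zL'(1)[OF P(1)[OF i]] zL'(1)[OF P(1)[OF l]]
      by (intro subfield_divide[OF sL'(1)] subfield_power[OF sL'(1)])
    moreover have "w (z' i ^ ?v l / z' l ^ ?v i) = 0"
    proof -
      have "z' l ^ ?v i \<noteq> 0" using P(2)[OF l] by simp
      then show ?thesis
        unfolding val_divide[OF w \<open>z' l ^ ?v i \<noteq> 0\<close>] val_power[OF w] P(3)[OF i] P(3)[OF l]
        by (simp add: zero_ereal_def mult_ac)
    qed
    ultimately show ?thesis by (simp add: val_ring_def)
  qed
  have "\<forall>i\<in>?P. \<exists>g. g \<in> mpolys (val_ring w K') n' \<and> eval_mpol g z' = z' i ^ e' / \<pi>' ^ ?v i"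
    using lift' v1 by blast
  from bchoice[OF this] obtain h' where h': "\<forall>i\<in>?P. h' i \<in> mpolys (val_ring w K') n' \<and>
    eval_mpol (h' i) z' = z' i ^ e' / \<pi>' ^ ?v i" by (elim exE)
  define g' where "g' i l = (SOME g. g \<in> mpolys (val_ring w K') n' \<and> eval_mpol g z' = z' i ^ ?v l / z' l ^ ?v i)" for i l
  have g': "g' i l \<in> mpolys (val_ring w K') n' \<and> eval_mpol (g' i l) z' = z' i ^ ?v l / z' l ^ ?v i"
    if "i \<in> ?P" "l \<in> ?P" for i l
    unfolding g'_def by (rule someI_ex[OF lift'[OF v2[OF that]]])
  have LD': "log_data w K' L' n' z' ?P \<pi>' h' g'"
    unfolding log_data_def eK'
  proof (intro conjI)
    show "?P \<subseteq> {..<n'}" using k' j(1) by simp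
    show "\<exists>i\<in>?P. uniformizer w L' (z' i)" using j(2) by simp
    show "0 \<notin> z' ` ?P" using zj zk0 by auto
  qed (use \<pi>' h' g' in blast)+
  let ?D = "AS_Y w K L n z {k} \<pi> (\<lambda>_. h0) (\<lambda>_ _. c) a"
  let ?D' = "AS_Y w K' L' n' z' ?P \<pi>' h' g' (of_nat s * a)"
  have I: "identifies_pi0 w K L G n z ?D"
    using G a L z LD by (simp add: is_log_ram_group_def)
  have I': "identifies_pi0 w K' L' G' n' z' ?D'"
    using G' a s L' z' LD' by (simp add: is_log_ram_group_def)
  have "(\<lambda>i\<in>{..<n}. x i ^ q) \<in> ?D" if x: "x \<in> ?D'" for x
  proof -
    let ?y = "\<lambda>i\<in>{..<n}. x i ^ q"
    have xX: "x \<in> AS_X w K' n' z' (of_nat s * a)" using x by (simp add: AS_Y_def Let_def)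
    have "\<forall>i\<in>?P. ereal (of_rat (of_nat s * a) + real (?v i))
             \<le> nval w K' (x i ^ e' - \<pi>' ^ ?v i * eval_mpol (h' i) x)"
      using x unfolding AS_Y_def Let_def eK' by simp
    from bspec[OF this, of j] have A: "ereal (of_rat (of_nat s * a) + 1) \<le> nval w K' (x j ^ e' - \<pi>' * eval_mpol (h' j) x)"
      by (simp add: nj')
    have "\<forall>i\<in>?P. \<forall>l\<in>?P. ereal (of_rat (of_nat s * a) + real (?v i * ?v l) / real e')
             \<le> nval w K' (x i ^ ?v l - x l ^ ?v i * eval_mpol (g' i l) x)"
      using x unfolding AS_Y_def Let_def eK' by simp
    from bspec[OF bspec[OF this, of k], of j] have B: "ereal (of_rat (of_nat s * a) + real d / real e')
        \<le> nval w K' (x k - x j ^ d * eval_mpol (g' k j) x)"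
      by (simp add: nj' nk')
    have hj: "h' j \<in> mpolys (val_ring w K') n'" "eval_mpol (h' j) z' = z' j ^ e' / \<pi>'"
      using bspec[OF h', of j] by (simp_all add: nj')
    have gkj: "g' k j \<in> mpolys (val_ring w K') n'" "eval_mpol (g' k j) z' = z' k / z' j ^ d"
      using g'[of k j] by (simp_all add: nj' nk')
    have C: "ereal (of_rat a + 1) \<le> nval w K ((x k ^ q) ^ e - \<pi> * eval_mpol h0 ?y)"
      by (rule log_condition[OF n _ xX _ k(1) zj h0 hj gkj ed epos A B])
         (use zz' a k(2) \<omega>0(2) in auto)
    have X: "?y \<in> AS_X w K n z a" by (rule AS_X_image[OF n _ xX]) (use zz' in auto)
    \<comment> \<open>With the lifting 1, the condition for the pair (k, k) compares a coordinate
      with itself; the difference 0 meets every bound.\<close>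
    have top: "ereal r \<le> nval w K 0" for r unfolding nval_K by (simp add: val_zero[OF w])
    show ?thesis unfolding AS_Y_def Let_def
      using X C k(1) top by (simp add: nk eK c(2))
  qed
  then have "(\<lambda>x. \<lambda>i\<in>{..<n}. x i ^ q) ` ?D' \<subseteq> ?D" by blast
  moreover have "\<forall>i<n. z i \<in> L \<and> z i = z' i ^ q" "\<forall>i<n'. z' i \<in> L'"
    using z zz' zL'(1) by (auto simp: generates_def val_ring_def)
  ultimately show ?thesis using I I' L' n by blast
qed

end

theorem theorem4p7:
  fixes K K' :: "'a::alg_closed_field set"
    and w :: "'a \<Rightarrow> ereal" and s :: nat and a :: rat
  assumes "CHAR('a) > 0"
    and "\<forall>x. algebraic_over K x"
    and "valuation w"
    and "complete_dvf w K"
    and "complete_dvf w K'"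
    and "purely_insep_ext K K'"
    and "strict_ram_index w K K' s"
    and "a \<ge> 0"
  shows "(\<forall>G G'. is_ram_group w K a G \<and> is_ram_group w K' (of_nat s * a) G'
            \<longrightarrow> gal_restrict K ` G' \<subseteq> G) \<and>
         (\<forall>G G'. is_log_ram_group w K a G \<and> is_log_ram_group w K' (of_nat s * a) G'
            \<longrightarrow> gal_restrict K ` G' \<subseteq> G)"
proof -
  note char = assms(1) and w = assms(3) and K = assms(4) and K' = assms(5)
  have sK: "is_subfield K" and sK': "is_subfield K'" using K K' by (simp_all add: complete_dvf_def)
  have KK': "K \<subseteq> K'" using assms(6) by (simp add: purely_insep_ext_def)
  obtain \<pi> \<pi>' where \<pi>: "uniformizer w K \<pi>" and \<pi>': "uniformizer w K' \<pi>'"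
    using K K' by (auto simp: complete_dvf_def)
  obtain \<gamma> where \<gamma>: "w \<pi>' = ereal \<gamma>" using uniformizer_real[OF w \<pi>'] by blast
  obtain t where t: "frob_root t K \<subseteq> K'" "s > 0" "w \<pi> = ereal (real (CHAR('a) ^ t) * real s) * w \<pi>'"
    using strict_ram_index_uniformizers[OF char w assms(7) \<pi> \<pi>'] .
  define q where "q = CHAR('a) ^ t"
  obtain \<theta> :: "'a \<Rightarrow> 'a" where \<theta>: "\<And>x. \<theta> x ^ q = x" "\<And>x y. \<theta> (x + y) = \<theta> x + \<theta> y"
    "\<And>x y. \<theta> (x * y) = \<theta> x * \<theta> y" "\<theta> 1 = 1"
    by (rule frob_root_exists[OF char q_def]) (rule that)
  interpret insep_setting w K K' \<pi> \<pi>' \<gamma> s q t \<theta>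
    by standard (use char w K K' KK' \<pi> \<pi>' \<gamma> t \<theta> in \<open>simp_all add: q_def\<close>)
  have carrier: "gal_restrict K \<sigma> \<in> carrier (Gal K)" if "\<sigma> \<in> carrier (Gal K')" for \<sigma>
    by (rule gal_restrict_carrier[OF sK sK' KK' char that])
  \<comment> \<open>As s is positive, the levels a and s a vanish together, so the same clause of
    the definition applies over \<open>K\<close> and over \<open>K'\<close>.\<close>
  have sa0: "of_nat s * a = 0 \<longleftrightarrow> a = 0" using t(2) by simp
  show ?thesis
  proof (intro conjI allI impI)
    fix G G' assume "is_ram_group w K a G \<and> is_ram_group w K' (of_nat s * a) G'"
    then have G: "is_ram_group w K a G" and G': "is_ram_group w K' (of_nat s * a) G'" by blast+
    show "gal_restrict K ` G' \<subseteq> G"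
    proof (cases "a = 0")
      case True
      then have "G = carrier (Gal K)" "G' = carrier (Gal K')"
        using G G' by (simp_all add: is_ram_group_def)
      then show ?thesis using carrier by blast
    next
      case False
      then have a: "a > 0" using assms(8) by simp
      have "closed_normal K G" "closed_normal K' G'"
        using G G' False sa0 unfolding is_ram_group_def by presburger+
      then show ?thesis
        by (rule ram_group_transfer[OF sK sK' KK' char]) (rule AS_X_data[OF G G' a])
    qed
  next
    fix G G' assume "is_log_ram_group w K a G \<and> is_log_ram_group w K' (of_nat s * a) G'"
    then have G: "is_log_ram_group w K a G" and G': "is_log_ram_group w K' (of_nat s * a) G'" by blast+
    show "gal_restrict K ` G' \<subseteq> G"
    proof (cases "a = 0")
      case True
      then have eq: "G = inertia w K" "G' = inertia w K'"
        using G G' by (simp_all add: is_log_ram_group_def)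
      show ?thesis
      proof safe
        fix \<sigma> assume "\<sigma> \<in> G'"
        then have \<sigma>: "\<sigma> \<in> carrier (Gal K')" "\<forall>x\<in>val_ring w (sep_closure K'). 0 < w (\<sigma> x - x)"
          unfolding eq by (simp_all add: inertia_def)
        \<comment> \<open>Acting trivially on the residue field of the larger separable closure
          implies the same on that of the smaller, since one valuation \<open>w\<close> serves
          both.\<close>
        have "\<forall>x\<in>val_ring w (sep_closure K). 0 < w (gal_restrict K \<sigma> x - x)"
        proof
          fix x assume x: "x \<in> val_ring w (sep_closure K)"
          then have "x \<in> val_ring w (sep_closure K')" "x \<in> sep_closure K"
            using sep_closure_mono[OF sK' KK'] by (auto simp: val_ring_def)
          then show "0 < w (gal_restrict K \<sigma> x - x)" using \<sigma>(2) by (simp add: gal_restrict_def)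
        qed
        then show "gal_restrict K \<sigma> \<in> G" unfolding eq inertia_def using carrier[OF \<sigma>(1)] by blast
      qed
    next
      case False
      then have a: "a > 0" using assms(8) by simp
      have "closed_normal K G" "closed_normal K' G'"
        using G G' False sa0 unfolding is_log_ram_group_def by presburger+
      then show ?thesis
        by (rule ram_group_transfer[OF sK sK' KK' char]) (rule AS_Y_data[OF G G' a])
    qed
  qed
qed

end
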